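(* (A) Let $\alpha>0$. (A.1) If $\alpha\notin\mathbb{N}$, then $\Lambda_H^\alpha=C^\alpha(\mathbb{Z})$. (A.2) If $\alpha\in\mathbb{N}$, then $\Lambda_H^\alpha=Z_\alpha$. (B) Let $f:\mathbb{Z}\to\mathbb{R}$ be such that $\sum_{j\in\mathbb{Z}}\frac{|f(j)|}{1+|j|^2}<\infty$. (B.1) For every $\alpha>0$ with $\alpha\notin\mathbb{N}$: $f\in C^\alpha(\mathbb{Z})\Longleftrightarrow f\in\Lambda_H^\alpha\Longleftrightarrow f\in\Lambda_P^\alpha$. (B.2) For every $\alpha\in\mathbb{N}$: $f\in Z_\alpha\Longleftrightarrow f\in\Lambda_H^\alpha\Longleftrightarrow f\in\Lambda_P^\alpha$.
   Context: $\mathbb{N}=\{1,2,\dots\}$, $\mathbb{N}_0=\mathbb{N}\cup\{0\}$, $[x]$ is the integer part of $x$, and $\|\cdot\|_\infty$ is the supremum norm over $\mathbb{Z}$. Differences: $\delta_{right}f(n)=f(n)-f(n+1)$, $\delta_{left}f(n)=f(n)-f(n-1)$ (these commute), and $\delta_{right/left}^{l,s}=\delta_{right}^l\delta_{left}^s$ for $l,s\in\mathbb{N}_0$. Discrete H\"older spaces: for $\alpha=k+\beta>0$ with $k\in\mathbb{N}_0$, $0<\beta<1$, $C^\alpha(\mathbb{Z})$ is the set of $f:\mathbb{Z}\to\mathbb{R}$ such that for all $l,s\in\mathbb{N}_0$ with $l+s=k$, $\sup_{n\ne m}\frac{|\delta_{right/left}^{l,s}f(n)-\delta_{right/left}^{l,s}f(m)|}{|n-m|^\beta}<\infty$.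 Discrete Zygmund classes: $Z_1$ is the set of $f:\mathbb{Z}\to\mathbb{R}$ with $\frac{f}{1+|\cdot|}\in\ell^\infty(\mathbb{Z})$ and $\sup_{n\neq0}\frac{\|f(\cdot+n)+f(\cdot-n)-2f(\cdot)\|_\infty}{|n|}<\infty$. For $\alpha\in\mathbb{N}\setminus\{1\}$, $Z_\alpha$ is the set of $f:\mathbb{Z}\to\mathbb{R}$ with $\frac{f}{1+|\cdot|^\alpha}\in\ell^\infty(\mathbb{Z})$ and $\delta_{right/left}^{l,s}f\in Z_1$ for all $l,s\in\mathbb{N}_0$ with $l+s=\alpha-1$. Heat semigroup: $I_n(t)=\sum_{m=0}^\infty\frac{1}{m!\,\Gamma(m+n+1)}(t/2)^{2m+n}$ for $n\in\mathbb{N}_0$, $I_{-n}=I_n$; $G(t,n)=e^{-2t}I_n(2t)$ for $t>0$, $n\in\mathbb{Z}$; $e^{t\Delta_d}f(n)=\sum_{j\in\mathbb{Z}}G(t,n-j)f(j)$, where $\Delta_df(n)=f(n+1)-2f(n)+f(n-1)$. Poisson semigroup: $P(y,j)=\frac{y}{2\sqrt\pi}\int_0^\infty\frac{e^{-y^2/(4t)}}{t^{3/2}}G(t,j)\,dt$ for $y>0$, $j\in\mathbb{Z}$; $e^{-y\sqrt{-\Delta_d}}f(n)=\sum_{j\in\mathbb{Z}}P(y,j)f(n-j)$. For $\alpha>0$: $\Lambda_H^\alpha$ is the set of $f:\mathbb{Z}\to\mathbb{R}$ with $\frac{f}{1+|\cdot|^\alpha}\in\ell^\infty(\mathbb{Z})$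 for which there is $C_\alpha>0$ with $\|\partial_t^ke^{t\Delta_d}f\|_\infty\le C_\alpha t^{-k+\alpha/2}$ for all $t>0$, where $k=[\alpha/2]+1$. $\Lambda_P^\alpha$ is the set of $f:\mathbb{Z}\to\mathbb{C}$ with $\sum_{j\in\mathbb{Z}}\frac{|f(j)|}{1+|j|^2}<\infty$ for which there is $\widetilde C_\alpha>0$ with $\|\partial_y^le^{-y\sqrt{-\Delta_d}}f\|_\infty\le\widetilde C_\alpha y^{-l+\alpha}$ for all $y>0$, where $l=[\alpha]+1$. *)

theory Defs
  imports "HOL-Analysis.Analysis"
begin

text \<open>The supremum norm takes values in \<^typ>\<open>ennreal\<close>, so that it is meaningful for unbounded
  functions and finiteness expresses membership in the space of bounded functions.\<close>

definition sup_norm :: "(int \<Rightarrow> 'a::real_normed_vector) \<Rightarrow> ennreal" where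
  "sup_norm f = (SUP n. ennreal (norm (f n)))"

definition delta_right :: "(int \<Rightarrow> real) \<Rightarrow> int \<Rightarrow> real" where
  "delta_right f n = f n - f (n + 1)"

definition delta_left :: "(int \<Rightarrow> real) \<Rightarrow> int \<Rightarrow> real" where
  "delta_left f n = f n - f (n - 1)"

definition delta :: "nat \<Rightarrow> nat \<Rightarrow> (int \<Rightarrow> real) \<Rightarrow> int \<Rightarrow> real" where
  "delta l s f = (delta_right ^^ l) ((delta_left ^^ s) f)"

text \<open>For a positive non-integer \<open>\<alpha>\<close>, the decomposition \<open>\<alpha> = k + \<beta>\<close> with a natural number \<open>k\<close> and
  \<open>0 < \<beta> < 1\<close> is given by \<open>k = \<lfloor>\<alpha>\<rfloor>\<close> and \<open>\<beta> = frac \<alpha>\<close>. The definition is only meant for such \<open>\<alpha>\<close>.\<close>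

definition holder_space :: "real \<Rightarrow> (int \<Rightarrow> real) set" where
  "holder_space \<alpha> = {f. \<forall>l s. l + s = nat \<lfloor>\<alpha>\<rfloor> \<longrightarrow>
     (SUP (n, m) \<in> {(n, m). n \<noteq> m}.
        ennreal (\<bar>delta l s f n - delta l s f m\<bar> / real_of_int \<bar>n - m\<bar> powr frac \<alpha>)) < \<infinity>}"

definition zygmund_1 :: "(int \<Rightarrow> real) set" where
  "zygmund_1 = {f. sup_norm (\<lambda>n. f n / (1 + real_of_int \<bar>n\<bar>)) < \<infinity> \<and>
     (SUP n \<in> - {0}. sup_norm (\<lambda>m. f (m + n) + f (m - n) - 2 * f m)
        / ennreal (real_of_int \<bar>n\<bar>)) < \<infinity>}"

text \<open>Only meant for \<open>\<alpha> \<ge> 1\<close>.\<close>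

definition zygmund :: "nat \<Rightarrow> (int \<Rightarrow> real) set" where
  "zygmund \<alpha> = (if \<alpha> = 1 then zygmund_1 else
     {f. sup_norm (\<lambda>n. f n / (1 + real_of_int \<bar>n\<bar> ^ \<alpha>)) < \<infinity> \<and>
         (\<forall>l s. l + s = \<alpha> - 1 \<longrightarrow> delta l s f \<in> zygmund_1)})"

text \<open>The modified Bessel function of the first kind, with the convention \<open>I\<^sub>-\<^sub>n = I\<^sub>n\<close> built in.\<close>

definition bessel_I :: "int \<Rightarrow> real \<Rightarrow> real" where
  "bessel_I n t = (\<Sum>m. 1 / (fact m * Gamma (real (m + nat \<bar>n\<bar> + 1))) * (t / 2) ^ (2 * m + nat \<bar>n\<bar>))"

definition heat_kernel :: "real \<Rightarrow> int \<Rightarrow> real" where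
  "heat_kernel t n = exp (- 2 * t) * bessel_I n (2 * t)"

definition heat_semigroup :: "real \<Rightarrow> (int \<Rightarrow> real) \<Rightarrow> int \<Rightarrow> real" where
  "heat_semigroup t f n = (\<Sum>\<^sub>\<infinity>j. heat_kernel t (n - j) * f j)"

definition poisson_kernel :: "real \<Rightarrow> int \<Rightarrow> real" where
  "poisson_kernel y j = y / (2 * sqrt pi) *
     (LINT t:{0<..}|lborel. exp (- (y\<^sup>2) / (4 * t)) / t powr (3 / 2) * heat_kernel t j)"

definition poisson_semigroup :: "real \<Rightarrow> (int \<Rightarrow> complex) \<Rightarrow> int \<Rightarrow> complex" where
  "poisson_semigroup y f n = (\<Sum>\<^sub>\<infinity>j. complex_of_real (poisson_kernel y j) * f (n - j))"

text \<open>The \<open>k\<close>-th derivative of a function of a real variable. In the two definitions below the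
  growth or summability condition on \<open>f\<close> makes the semigroup smooth on the positive half-line, so
  all derivatives that occur there exist.\<close>

definition nth_derivative :: "nat \<Rightarrow> (real \<Rightarrow> 'a::real_normed_vector) \<Rightarrow> real \<Rightarrow> 'a" where
  "nth_derivative k g = ((\<lambda>h t. vector_derivative h (at t)) ^^ k) g"

definition Lambda_H :: "real \<Rightarrow> (int \<Rightarrow> real) set" where
  "Lambda_H \<alpha> = {f. sup_norm (\<lambda>n. f n / (1 + real_of_int \<bar>n\<bar> powr \<alpha>)) < \<infinity> \<and>
     (\<exists>C>0. \<forall>t>0. let k = nat \<lfloor>\<alpha> / 2\<rfloor> + 1 in
        sup_norm (\<lambda>n. nth_derivative k (\<lambda>t. heat_semigroup t f n) t)
          \<le> ennreal (C * t powr (- real k + \<alpha> / 2)))}"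

definition poisson_summable :: "(int \<Rightarrow> 'a::real_normed_vector) \<Rightarrow> bool" where
  "poisson_summable f \<longleftrightarrow> (\<lambda>j. norm (f j) / (1 + (real_of_int \<bar>j\<bar>)\<^sup>2)) summable_on UNIV"

definition Lambda_P :: "real \<Rightarrow> (int \<Rightarrow> complex) set" where
  "Lambda_P \<alpha> = {f. poisson_summable f \<and>
     (\<exists>C>0. \<forall>y>0. let l = nat \<lfloor>\<alpha>\<rfloor> + 1 in
        sup_norm (\<lambda>n. nth_derivative l (\<lambda>y. poisson_semigroup y f n) y)
          \<le> ennreal (C * y powr (- real l + \<alpha>)))}"

end

theory Submission
  imports Defs "HOL-Probability.Distributions"
begin

text \<open>
  The discrete Laplacian \<open>\<Delta>\<close> is a three-point operator, and on functions of at most exponential growth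
  the exponential series of such an operator converges pointwise. The heat semigroup is such an
  exponential, so its derivatives, its semigroup law and its commutation rules are facts about power
  series. With \<open>S\<close> the unit shift, \<open>\<Delta> = (S - 1) + (S\<^sup>-\<^sup>1 - 1)\<close>, and the exponential of either summand
  is the average against a Poisson distribution. A difference of Poisson weights is the weight itself times
  a centred factor of variance \<open>1 / t\<close>, so Cauchy and Schwarz give \<open>|\<delta> e\<^sup>t\<^sup>\<Delta> f|\<^sup>2 \<le> e\<^sup>t\<^sup>\<Delta>(f\<^sup>2) / t\<close>
  (\<open>heat_gradient\<close>), where \<open>\<delta>\<close> is the right difference. This single inequality contains both the smoothing
  of bounded functions and, because \<open>cosh (n / \<surd>t)\<close> is an eigenfunction of \<open>\<Delta>\<close>, the vanishing of high
  differences of \<open>e\<^sup>t\<^sup>\<Delta> f\<close> as \<open>t \<rightarrow> \<infinity>\<close> when \<open>f\<close> has polynomial growth.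

  Write \<open>\<alpha> = k + \<beta>\<close> with \<open>0 < \<beta> \<le> 1\<close>. The Hoelder and the Zygmund condition say that \<open>g = \<delta>\<^sup>k f\<close> has first or
  second differences of order \<open>\<beta>\<close>. Both are linked to the decay
  \<open>|\<delta>\<^sup>i e\<^sup>t\<^sup>\<Delta> f| \<le> C t\<^bsup>(\<alpha> - i) / 2\<^esup>\<close>, a condition that, for \<open>f\<close> of growth order \<open>\<alpha>\<close>, is the same for all \<open>i > \<alpha>\<close>
  (\<open>heat_decay_all_orders\<close>). In one direction, \<open>g\<close> is compared with its average at scale \<open>\<surd>t\<close>
  (\<open>heat_decay_of_second_difference\<close>); in the other, the decay of the time derivative bounds \<open>g - e\<^sup>t\<^sup>\<Delta> g\<close>,
  and \<open>t = n\<^sup>2\<close> is the right time for differences with step \<open>n\<close> (\<open>decaying_heat\<close>).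

  The Poisson kernel has the cosine coefficients of \<open>exp (- 2 y sin (x / 2))\<close>; expanding in \<open>y\<close> gives
  the kernels of the powers of \<open>\<surd>(-\<Delta>)\<close>, all dominated by \<open>1 / (1 + j\<^sup>2)\<close>. Hence the Poisson extension
  \<open>u\<close> of a summable \<open>f\<close> is an everywhere convergent power series in \<open>y\<close> with \<open>\<partial>\<^sub>y\<^sup>2 u = - \<Delta> u\<close>.
  An even \<open>y\<close>-derivative of \<open>u\<close> is therefore the average, over the subordinating density, of a heat
  evolution, so heat decay gives Poisson decay; an odd derivative is integrated from infinity, where \<open>u\<close> is
  \<open>o(y)\<close> (\<open>heat_decay_imp_poisson_decay\<close>). Conversely, \<open>e\<^sup>t\<^sup>\<Delta> u\<close> is expanded from \<open>y = \<surd>t\<close> down to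
  \<open>y = 0\<close> by Taylor's formula; at \<open>y = \<surd>t\<close> the missing derivatives are supplied by the
  smoothing of \<open>e\<^sup>t\<^sup>\<Delta>\<close>, since \<open>\<Delta> = - \<partial>\<^sub>y\<^sup>2\<close> (\<open>poisson_decay_imp_heat_decay\<close>). The growth condition in the heat class
  is recovered from summability: for small \<open>\<alpha>\<close> a large value of \<open>f\<close> would force, through small second
  differences, large values on a whole annulus (\<open>second_difference_mass\<close>).
\<close>

section \<open>Exponential generating series and double series\<close>

lemma double_sum_dominated:
  fixes a :: "'a \<Rightarrow> 'b \<Rightarrow> real"
  assumes bound: "\<And>k i. \<bar>a k i\<bar> \<le> x k * y i" and x: "x summable_on UNIV" and y: "y summable_on UNIV"
    and x0: "\<And>k. 0 \<le> x k" and y0: "\<And>k. 0 \<le> y k"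
  shows "(\<lambda>(k, i). a k i) summable_on UNIV"
    and "((\<lambda>k. \<Sum>\<^sub>\<infinity>i. a k i) has_sum (\<Sum>\<^sub>\<infinity>(k, i). a k i)) UNIV"
    and "((\<lambda>i. \<Sum>\<^sub>\<infinity>k. a k i) has_sum (\<Sum>\<^sub>\<infinity>(k, i). a k i)) UNIV"
    and "(\<lambda>i. a k i) summable_on UNIV"
    and "(\<lambda>k. a k i) summable_on UNIV"
proof -
  have "(\<lambda>(k, i). x k * y i) summable_on UNIV \<times> UNIV"
  proof (rule summable_on_SigmaI)
    show "((\<lambda>i. case (k, i) of (k, i) \<Rightarrow> x k * y i) has_sum x k * infsum y UNIV) UNIV" for k
      using y by (auto intro: has_sum_cmult_right)
    show "(\<lambda>k. x k * infsum y UNIV) summable_on UNIV"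
      using x by (rule summable_on_cmult_left)
  qed (use x0 y0 in auto)
  then have "(\<lambda>z. norm (case z of (k, i) \<Rightarrow> x k * y i)) summable_on UNIV"
    unfolding UNIV_Times_UNIV by (rule summable_on_cong[THEN iffD1, rotated]) (use x0 y0 in auto)
  then have "(\<lambda>z. norm (case z of (k, i) \<Rightarrow> a k i)) summable_on UNIV"
    by (rule Infinite_Sum.abs_summable_on_comparison_test[of "\<lambda>(k, i). x k * y i"])
       (use bound x0 y0 in auto)
  then show sm: "(\<lambda>(k, i). a k i) summable_on UNIV"
    by (rule Infinite_Sum.abs_summable_summable)
  then have hs: "((\<lambda>(k, i). a k i) has_sum (\<Sum>\<^sub>\<infinity>(k, i). a k i)) (Sigma UNIV (\<lambda>_. UNIV))"
    by (simp add: summable_iff_has_sum_infsum)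
  have hs': "((\<lambda>(i, k). a k i) has_sum (\<Sum>\<^sub>\<infinity>(k, i). a k i)) (Sigma UNIV (\<lambda>_. UNIV))"
    using hs by (subst has_sum_reindex_bij_witness[of _ prod.swap prod.swap]) (auto split: prod.splits)
  show i1: "(\<lambda>i. a k i) summable_on UNIV" for k
    using summable_on_SigmaD1[where f = a and A = UNIV and B = "\<lambda>_. UNIV", OF has_sum_imp_summable[OF hs] UNIV_I] .
  show i2: "(\<lambda>k. a k i) summable_on UNIV" for i
    using summable_on_SigmaD1[where f = "\<lambda>i k. a k i" and A = UNIV and B = "\<lambda>_. UNIV", OF has_sum_imp_summable[OF hs'] UNIV_I] .
  show "((\<lambda>k. \<Sum>\<^sub>\<infinity>i. a k i) has_sum (\<Sum>\<^sub>\<infinity>(k, i). a k i)) UNIV"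
    by (rule has_sum_SigmaD[OF hs]) (use i1 in auto)
  show "((\<lambda>i. \<Sum>\<^sub>\<infinity>k. a k i) has_sum (\<Sum>\<^sub>\<infinity>(k, i). a k i)) UNIV"
    by (rule has_sum_SigmaD[OF hs']) (use i2 in auto)
qed

text \<open>The last claim sums along antidiagonals, the order in which products of exponential
  series arise.\<close>
lemma double_series_dominated:
  fixes a :: "nat \<Rightarrow> nat \<Rightarrow> real"
  assumes bound: "\<And>k i. \<bar>a k i\<bar> \<le> x k * y i" and x: "summable x" and y: "summable y"
    and x0: "\<And>k. 0 \<le> x k" and y0: "\<And>k. 0 \<le> y k"
  shows "(\<lambda>(k, i). a k i) summable_on UNIV"
    and "(\<lambda>k. \<Sum>i. a k i) sums (\<Sum>\<^sub>\<infinity>(k, i). a k i)"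
    and "(\<lambda>i. \<Sum>k. a k i) sums (\<Sum>\<^sub>\<infinity>(k, i). a k i)"
    and "(\<lambda>N. \<Sum>k\<le>N. a k (N - k)) sums (\<Sum>\<^sub>\<infinity>(k, i). a k i)"
proof -
  have xs: "x summable_on UNIV" and ys: "y summable_on UNIV"
    using x y x0 y0 by (simp_all add: summable_on_UNIV_nonneg_real_iff)
  note ds = double_sum_dominated[OF bound xs ys x0 y0]
  show "(\<lambda>(k, i). a k i) summable_on UNIV" by (rule ds(1))
  have "(\<Sum>\<^sub>\<infinity>i. a k i) = (\<Sum>i. a k i)" for k
    using has_sum_imp_sums[OF has_sum_infsum[OF ds(4)[of k]]] by (simp add: sums_iff)
  then show "(\<lambda>k. \<Sum>i. a k i) sums (\<Sum>\<^sub>\<infinity>(k, i). a k i)"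
    using has_sum_imp_sums[OF ds(2)] by simp
  have "(\<Sum>\<^sub>\<infinity>k. a k i) = (\<Sum>k. a k i)" for i
    using has_sum_imp_sums[OF has_sum_infsum[OF ds(5)[of i]]] by (simp add: sums_iff)
  then show "(\<lambda>i. \<Sum>k. a k i) sums (\<Sum>\<^sub>\<infinity>(k, i). a k i)"
    using has_sum_imp_sums[OF ds(3)] by simp
  have "((\<lambda>(k, i). a k i) has_sum (\<Sum>\<^sub>\<infinity>(k, i). a k i)) UNIV"
    using ds(1) by simp
  then have "((\<lambda>(N, k). a k (N - k)) has_sum (\<Sum>\<^sub>\<infinity>(k, i). a k i)) (Sigma UNIV (\<lambda>N. {..N}))"
    by (subst has_sum_reindex_bij_witness[of _ "\<lambda>(k, i). (k + i, k)" "\<lambda>(N, k). (k, N - k)"])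
      (auto split: prod.splits)
  then have "((\<lambda>N. \<Sum>k\<le>N. a k (N - k)) has_sum (\<Sum>\<^sub>\<infinity>(k, i). a k i)) UNIV"
    by (rule has_sum_SigmaD) auto
  then show "(\<lambda>N. \<Sum>k\<le>N. a k (N - k)) sums (\<Sum>\<^sub>\<infinity>(k, i). a k i)"
    by (rule has_sum_imp_sums)
qed

text \<open>At each point of \<open>\<int>\<close>, both semigroups are functions of this form in
  their time variable.\<close>
definition egf :: "(nat \<Rightarrow> real) \<Rightarrow> real \<Rightarrow> real" where
  "egf c t = (\<Sum>k. t ^ k / fact k * c k)"

lemma summable_exp_real: "summable (\<lambda>k. x ^ k / fact k)" for x :: real
  using summable_exp[of x] by (simp add: field_simps)

lemma egf_summable:
  fixes C M :: real
  assumes "\<And>k. \<bar>c k\<bar> \<le> C * M ^ k"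
  shows "summable (\<lambda>k. \<bar>t ^ k / fact k * c k\<bar>)"
proof (rule summable_comparison_test'[of "\<lambda>k. C * ((\<bar>t\<bar> * M) ^ k / fact k) :: real" 0])
  show "summable (\<lambda>k. C * ((\<bar>t\<bar> * M) ^ k / fact k) :: real)"
    by (intro summable_mult summable_exp_real)
  fix k
  have "\<bar>t\<bar> ^ k * \<bar>c k\<bar> \<le> \<bar>t\<bar> ^ k * (C * M ^ k)"
    by (intro mult_left_mono assms) auto
  then have "\<bar>t\<bar> ^ k * \<bar>c k\<bar> / fact k \<le> \<bar>t\<bar> ^ k * (C * M ^ k) / fact k"
    by (intro divide_right_mono) auto
  then show "norm \<bar>t ^ k / fact k * c k\<bar> \<le> C * ((\<bar>t\<bar> * M) ^ k / fact k)"
    by (simp add: abs_mult power_abs power_mult_distrib mult_ac)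
qed

lemma egf_sums:
  fixes C M :: real
  assumes "\<And>k. \<bar>c k\<bar> \<le> C * M ^ k"
  shows "(\<lambda>k. t ^ k / fact k * c k) sums egf c t"
  unfolding egf_def by (rule summable_sums, rule summable_rabs_cancel, rule egf_summable[OF assms])

lemma egf_0 [simp]: "egf c 0 = c 0"
proof -
  have "egf c 0 = (\<Sum>k. c k / fact k * 0 ^ k)" unfolding egf_def by (rule arg_cong[of _ _ suminf]) (auto simp: fun_eq_iff)
  also have "\<dots> = c 0 / fact 0" by (rule powser_zero)
  finally show ?thesis by simp
qed

lemma egf_has_derivative:
  fixes C M :: real
  assumes "\<And>k. \<bar>c k\<bar> \<le> C * M ^ k"
  shows "(egf c has_real_derivative egf (\<lambda>k. c (Suc k)) t) (at t)"
proof -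
  have sm: "summable (\<lambda>n. c n / fact n * x ^ n)" for x
    using summable_rabs_cancel[OF egf_summable[OF assms, of x]] by (simp add: field_simps)
  have "DERIV (\<lambda>x. \<Sum>n. (c n / fact n) * x ^ n) t :> (\<Sum>n. diffs (\<lambda>n. c n / fact n) n * t ^ n)"
    by (rule termdiffs_strong_converges_everywhere[OF sm])
  moreover have "diffs (\<lambda>n. c n / fact n) n * t ^ n = t ^ n / fact n * c (Suc n)" for n
    by (simp add: diffs_def del: of_nat_Suc)
  ultimately show ?thesis by (simp add: egf_def[abs_def] mult_ac)
qed

lemma egf_iterated_has_derivative:
  fixes C M :: real
  assumes "\<And>k. \<bar>c k\<bar> \<le> C * M ^ k"
  shows "(egf (\<lambda>k. c (k + m)) has_real_derivative egf (\<lambda>k. c (k + Suc m)) t) (at t)"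
proof -
  have "\<bar>c (k + m)\<bar> \<le> (C * M ^ m) * M ^ k" for k
    using assms[of "k + m"] by (simp add: power_add mult_ac)
  from egf_has_derivative[OF this] show ?thesis by simp
qed

section \<open>Exponentials of three-point operators\<close>

text \<open>The Laplacian, the one-sided differences and the shifts are all of this form; such
  operators commute and add.\<close>
definition tri :: "real \<Rightarrow> real \<Rightarrow> real \<Rightarrow> (int \<Rightarrow> real) \<Rightarrow> int \<Rightarrow> real" where
  "tri p q r f n = p * f (n - 1) + q * f n + r * f (n + 1)"

text \<open>A unit shift multiplies such a bound by a constant, so powers of three-point operators
  grow at most geometrically on these functions. The rate is left free to make the class closed
  under products.\<close>
definition exp_growth :: "(int \<Rightarrow> real) \<Rightarrow> bool" where
  "exp_growth f \<longleftrightarrow> (\<exists>C c. 0 \<le> C \<and> 0 \<le> c \<and> (\<forall>n. \<bar>f n\<bar> \<le> C * exp (c * \<bar>real_of_int n\<bar>)))"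

text \<open>Time is absorbed into the coefficients: the exponential of \<open>t X\<close> scales all
  three of them by \<open>t\<close>. In this way the semigroup law and the splitting of the
  Laplacian into commuting halves are both instances of \<open>exp_tri_add\<close>.\<close>
definition exp_tri :: "real \<Rightarrow> real \<Rightarrow> real \<Rightarrow> (int \<Rightarrow> real) \<Rightarrow> int \<Rightarrow> real" where
  "exp_tri p q r f n = (\<Sum>k. (tri p q r ^^ k) f n / fact k)"

lemma tri_linear: "tri p q r (\<lambda>n. x * f n + y * g n) = (\<lambda>n. x * tri p q r f n + y * tri p q r g n)"
  by (auto simp: tri_def algebra_simps)

lemma tri_pow_linear:
  "(tri p q r ^^ k) (\<lambda>n. x * f n + y * g n) = (\<lambda>n. x * (tri p q r ^^ k) f n + y * (tri p q r ^^ k) g n)"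
  by (induction k) (simp_all add: tri_linear)

lemma tri_pow_divide: "(tri p q r ^^ k) (\<lambda>n. f n / x) = (\<lambda>n. (tri p q r ^^ k) f n / x)"
  using tri_pow_linear[of k p q r "1 / x" f 0 f] by simp

lemma tri_commute: "tri p q r (tri p' q' r' f) = tri p' q' r' (tri p q r f)"
  by (auto simp: tri_def algebra_simps)

lemma tri_pow_commute1: "tri p q r ((tri p' q' r' ^^ k) f) = (tri p' q' r' ^^ k) (tri p q r f)"
  by (induction k) (simp_all add: tri_commute[of p q r p' q' r'])

lemma tri_pow_commute:
  "(tri p q r ^^ j) ((tri p' q' r' ^^ k) f) = (tri p' q' r' ^^ k) ((tri p q r ^^ j) f)"
  by (induction j) (simp_all add: tri_pow_commute1)

lemma tri_bound:
  assumes "\<And>n. \<bar>f n\<bar> \<le> C * exp (c * \<bar>real_of_int n\<bar>)" "0 \<le> C" "0 \<le> c"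
  shows "\<bar>tri p q r f n\<bar> \<le> ((\<bar>p\<bar> + \<bar>q\<bar> + \<bar>r\<bar>) * exp c * C) * exp (c * \<bar>real_of_int n\<bar>)"
proof -
  let ?E = "C * (exp c * exp (c * \<bar>real_of_int n\<bar>))"
  have nb: "\<bar>f m\<bar> \<le> ?E" if "\<bar>m - n\<bar> \<le> 1" for m
  proof -
    have "\<bar>real_of_int m\<bar> \<le> 1 + \<bar>real_of_int n\<bar>" using that by linarith
    then have "c * \<bar>real_of_int m\<bar> \<le> c * (1 + \<bar>real_of_int n\<bar>)" using assms(3) by (rule mult_left_mono)
    then have "c * \<bar>real_of_int m\<bar> \<le> c + c * \<bar>real_of_int n\<bar>" by (simp add: algebra_simps)
    then have "exp (c * \<bar>real_of_int m\<bar>) \<le> exp c * exp (c * \<bar>real_of_int n\<bar>)"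
      by (simp flip: exp_add)
    from mult_left_mono[OF this assms(2)] assms(1)[of m] show ?thesis by linarith
  qed
  have "\<bar>tri p q r f n\<bar> \<le> \<bar>p\<bar> * \<bar>f (n - 1)\<bar> + \<bar>q\<bar> * \<bar>f n\<bar> + \<bar>r\<bar> * \<bar>f (n + 1)\<bar>"
    unfolding tri_def by (simp flip: abs_mult)
  also have "\<dots> \<le> \<bar>p\<bar> * ?E + \<bar>q\<bar> * ?E + \<bar>r\<bar> * ?E"
    by (intro add_mono mult_left_mono nb) auto
  finally show ?thesis by (simp add: algebra_simps)
qed

lemma tri_pow_bound:
  assumes "\<And>n. \<bar>f n\<bar> \<le> C * exp (c * \<bar>real_of_int n\<bar>)" "0 \<le> C" "0 \<le> c"
  shows "\<bar>(tri p q r ^^ k) f n\<bar> \<le> (C * exp (c * \<bar>real_of_int n\<bar>)) * ((\<bar>p\<bar> + \<bar>q\<bar> + \<bar>r\<bar>) * exp c) ^ k"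
proof -
  let ?M = "(\<bar>p\<bar> + \<bar>q\<bar> + \<bar>r\<bar>) * exp c"
  have "\<bar>(tri p q r ^^ k) f n\<bar> \<le> (?M ^ k * C) * exp (c * \<bar>real_of_int n\<bar>)" for n
  proof (induction k arbitrary: n)
    case 0 then show ?case using assms(1) by simp
  next
    case (Suc k)
    have "\<bar>tri p q r ((tri p q r ^^ k) f) n\<bar> \<le> (?M * (?M ^ k * C)) * exp (c * \<bar>real_of_int n\<bar>)"
      by (rule tri_bound[OF Suc.IH]) (use assms in auto)
    then show ?case by (simp add: mult_ac)
  qed
  then show ?thesis by (simp add: mult_ac)
qed

lemma exp_growthI:
  assumes "\<And>n. \<bar>f n\<bar> \<le> C * exp (c * \<bar>real_of_int n\<bar>)" "0 \<le> C" "0 \<le> c"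
  shows "exp_growth f"
  using assms unfolding exp_growth_def by blast

lemma exp_growth_tri:
  assumes "exp_growth f"
  shows "exp_growth (tri p q r f)"
proof -
  from assms have "exp_growth f" by simp_all
  then obtain C c where *: "\<And>n. \<bar>f n\<bar> \<le> C * exp (c * \<bar>real_of_int n\<bar>)" "0 \<le> C" "0 \<le> c"
    unfolding exp_growth_def by blast
  show ?thesis
    by (rule exp_growthI[of _ "(\<bar>p\<bar> + \<bar>q\<bar> + \<bar>r\<bar>) * exp c * C" c], rule tri_bound[OF *]) (use * in auto)
qed

lemma exp_growth_tri_pow: "exp_growth f \<Longrightarrow> exp_growth ((tri p q r ^^ k) f)"
  by (induction k) (simp_all add: exp_growth_tri)

lemma exp_growth_bounded: "(\<And>n. \<bar>f n\<bar> \<le> B) \<Longrightarrow> exp_growth f"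
  by (rule exp_growthI[of f B 0]) (auto intro: order_trans[OF abs_ge_zero])

lemma exp_growth_mult:
  assumes "exp_growth f" "exp_growth g"
  shows "exp_growth (\<lambda>n. f n * g n)"
proof -
  from assms have "exp_growth f" "exp_growth g" by simp_all
  then obtain C c D d where *: "\<And>n. \<bar>f n\<bar> \<le> C * exp (c * \<bar>real_of_int n\<bar>)" "0 \<le> C" "0 \<le> c"
     "\<And>n. \<bar>g n\<bar> \<le> D * exp (d * \<bar>real_of_int n\<bar>)" "0 \<le> D" "0 \<le> d"
    unfolding exp_growth_def by blast
  show ?thesis
  proof (rule exp_growthI)
    fix n
    have "\<bar>f n * g n\<bar> \<le> (C * exp (c * \<bar>real_of_int n\<bar>)) * (D * exp (d * \<bar>real_of_int n\<bar>))"
      unfolding abs_mult by (intro mult_mono *) (use * in auto)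
    then show "\<bar>f n * g n\<bar> \<le> (C * D) * exp ((c + d) * \<bar>real_of_int n\<bar>)"
      by (simp add: distrib_right distrib_left exp_add mult_ac)
  qed (use * in auto)
qed

lemma exp_growth_add:
  assumes "exp_growth f" "exp_growth g"
  shows "exp_growth (\<lambda>n. f n + g n)"
proof -
  from assms have "exp_growth f" "exp_growth g" by simp_all
  then obtain C c D d where *: "\<And>n. \<bar>f n\<bar> \<le> C * exp (c * \<bar>real_of_int n\<bar>)" "0 \<le> C" "0 \<le> c"
     "\<And>n. \<bar>g n\<bar> \<le> D * exp (d * \<bar>real_of_int n\<bar>)" "0 \<le> D" "0 \<le> d"
    unfolding exp_growth_def by blast
  show ?thesis
  proof (rule exp_growthI)
    fix n
    have "C * exp (c * \<bar>real_of_int n\<bar>) \<le> C * exp ((c + d) * \<bar>real_of_int n\<bar>)"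
      "D * exp (d * \<bar>real_of_int n\<bar>) \<le> D * exp ((c + d) * \<bar>real_of_int n\<bar>)"
      by (use * in \<open>auto intro!: mult_left_mono mult_right_mono\<close>)
    with *(1)[of n] *(4)[of n] abs_triangle_ineq[of "f n" "g n"]
    show "\<bar>f n + g n\<bar> \<le> (C + D) * exp ((c + d) * \<bar>real_of_int n\<bar>)"
      unfolding distrib_right by linarith
  qed (use * in auto)
qed

lemma exp_growth_const: "exp_growth (\<lambda>n. x)"
  by (rule exp_growth_bounded[of _ "\<bar>x\<bar>"]) auto

lemma exp_growth_cmult: "exp_growth f \<Longrightarrow> exp_growth (\<lambda>n. x * f n)"
  by (rule exp_growth_mult[OF exp_growth_const])

lemma exp_growth_diff: "exp_growth f \<Longrightarrow> exp_growth g \<Longrightarrow> exp_growth (\<lambda>n. f n - g n)"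
  using exp_growth_add[OF _ exp_growth_cmult[of g "- 1"], of f] by simp

lemma exp_growth_power2: "exp_growth f \<Longrightarrow> exp_growth (\<lambda>n. (f n)\<^sup>2)"
  using exp_growth_mult[of f f] by (simp add: power2_eq_square)

lemma exp_tri_coeff_bound:
  assumes "exp_growth f"
  shows "\<exists>C M. \<forall>k. \<bar>(tri p q r ^^ k) f n\<bar> \<le> C * M ^ k"
proof -
  from assms obtain C c where *: "\<And>n. \<bar>f n\<bar> \<le> C * exp (c * \<bar>real_of_int n\<bar>)" "0 \<le> C" "0 \<le> c"
    unfolding exp_growth_def by blast
  show ?thesis using tri_pow_bound[OF *] by blast
qed

lemma exp_tri_egf: "exp_tri p q r f n = egf (\<lambda>k. (tri p q r ^^ k) f n) 1"
  by (simp add: exp_tri_def egf_def)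

lemma exp_tri_sums:
  assumes "exp_growth f"
  shows "(\<lambda>k. (tri p q r ^^ k) f n / fact k) sums exp_tri p q r f n"
proof -
  obtain C M where "\<And>k. \<bar>(tri p q r ^^ k) f n\<bar> \<le> C * M ^ k"
    using exp_tri_coeff_bound[OF assms] by metis
  from egf_sums[OF this, of 1] show ?thesis by (simp add: exp_tri_egf)
qed

lemma exp_tri_linear:
  assumes "exp_growth f" "exp_growth g"
  shows "exp_tri p q r (\<lambda>n. x * f n + y * g n) n = x * exp_tri p q r f n + y * exp_tri p q r g n"
proof -
  have "(\<lambda>k. x * ((tri p q r ^^ k) f n / fact k) + y * ((tri p q r ^^ k) g n / fact k)) sums
      (x * exp_tri p q r f n + y * exp_tri p q r g n)"
    by (intro sums_add sums_mult exp_tri_sums assms)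
  then have "(\<lambda>k. (tri p q r ^^ k) (\<lambda>n. x * f n + y * g n) n / fact k) sums
      (x * exp_tri p q r f n + y * exp_tri p q r g n)"
    by (simp add: tri_pow_linear add_divide_distrib)
  then show ?thesis unfolding exp_tri_def by (rule sums_unique[symmetric])
qed

lemma exp_tri_bound:
  assumes "\<And>n. \<bar>f n\<bar> \<le> C * exp (c * \<bar>real_of_int n\<bar>)" "0 \<le> C" "0 \<le> c"
  shows "\<bar>exp_tri p q r f n\<bar> \<le> (C * exp ((\<bar>p\<bar> + \<bar>q\<bar> + \<bar>r\<bar>) * exp c)) * exp (c * \<bar>real_of_int n\<bar>)"
proof -
  let ?M = "(\<bar>p\<bar> + \<bar>q\<bar> + \<bar>r\<bar>) * exp c" and ?B = "C * exp (c * \<bar>real_of_int n\<bar>)"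
  have eg: "exp_growth f" by (rule exp_growthI[OF assms])
  have s: "(\<lambda>k. ?B * (?M ^ k / fact k)) sums (?B * exp ?M)"
    using exp_converges[of ?M] by (intro sums_mult) (simp add: field_simps)
  have le: "\<bar>(tri p q r ^^ k) f n / fact k\<bar> \<le> ?B * (?M ^ k / fact k)" for k
    using tri_pow_bound[OF assms, of k p q r n] by (simp add: divide_right_mono)
  have "exp_tri p q r f n \<le> ?B * exp ?M"
    by (rule sums_le[OF _ exp_tri_sums[OF eg] s]) (rule order_trans[OF abs_ge_self le])
  moreover have "- exp_tri p q r f n \<le> ?B * exp ?M"
    by (rule sums_le[OF _ sums_minus[OF exp_tri_sums[OF eg]] s]) (rule order_trans[OF abs_ge_minus_self le])
  ultimately have "\<bar>exp_tri p q r f n\<bar> \<le> ?B * exp ?M" by linarith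
  then show ?thesis by (simp add: mult_ac)
qed

lemma exp_growth_exp_tri:
  assumes "exp_growth f"
  shows "exp_growth (exp_tri p q r f)"
proof -
  from assms have "exp_growth f" by simp_all
  then obtain C c where *: "\<And>n. \<bar>f n\<bar> \<le> C * exp (c * \<bar>real_of_int n\<bar>)" "0 \<le> C" "0 \<le> c"
    unfolding exp_growth_def by blast
  show ?thesis
    by (rule exp_growthI[of _ "C * exp ((\<bar>p\<bar> + \<bar>q\<bar> + \<bar>r\<bar>) * exp c)" c], rule exp_tri_bound[OF *]) (use * in auto)
qed

lemma tri_pow_sums:
  assumes "\<And>n. (\<lambda>i. g i n) sums s n"
  shows "(\<lambda>i. (tri p q r ^^ k) (g i) n) sums (tri p q r ^^ k) s n"
proof (induction k arbitrary: n)
  case (Suc k)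
  show ?case unfolding funpow.simps o_def unfolding tri_def[of _ _ _ "(tri p q r ^^ k) _"]
    by (intro sums_add sums_mult Suc.IH)
qed (use assms in simp)

text \<open>Exponentials commute with dominated series of functions; this is needed for the heat
  evolution of a Poisson extension.\<close>
lemma exp_tri_suminf:
  assumes g: "\<And>i n. \<bar>g i n\<bar> \<le> b i * (C * exp (c * \<bar>real_of_int n\<bar>))" and "0 \<le> C" "0 \<le> c"
    and b: "summable b" "\<And>i. 0 \<le> b i"
  shows "(\<lambda>i. exp_tri p q r (g i) n) sums exp_tri p q r (\<lambda>n. \<Sum>i. g i n) n"
proof -
  let ?M = "(\<bar>p\<bar> + \<bar>q\<bar> + \<bar>r\<bar>) * exp c" and ?B = "C * exp (c * \<bar>real_of_int n\<bar>)"
  have s: "(\<lambda>i. g i n) sums (\<Sum>i. g i n)" for n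
    by (rule summable_sums, rule summable_comparison_test'[of "\<lambda>i. b i * (C * exp (c * \<bar>real_of_int n\<bar>))" 0])
       (use g in \<open>auto intro: summable_mult2 b\<close>)
  have "\<bar>(tri p q r ^^ k) (g i) n\<bar> \<le> ((b i * C) * exp (c * \<bar>real_of_int n\<bar>)) * ?M ^ k" for i k
    by (rule tri_pow_bound) (use assms in \<open>auto simp: mult_ac\<close>)
  then have dom: "\<bar>(tri p q r ^^ k) (g i) n / fact k\<bar> \<le> (?B * (?M ^ k / fact k)) * b i" for i k
    by (simp add: divide_right_mono mult_ac)
  have sx: "summable (\<lambda>k. ?B * (?M ^ k / fact k))"
    by (intro summable_mult summable_exp_real)
  have px: "0 \<le> ?B * (?M ^ k / fact k)" for k using assms by auto
  have "(\<Sum>i. (tri p q r ^^ k) (g i) n / fact k) = (tri p q r ^^ k) (\<lambda>n. \<Sum>i. g i n) n / fact k" for k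
    by (intro sums_unique[symmetric] sums_divide tri_pow_sums s)
  then have "exp_tri p q r (\<lambda>n. \<Sum>i. g i n) n = (\<Sum>\<^sub>\<infinity>(k, i). (tri p q r ^^ k) (g i) n / fact k)"
    using double_series_dominated(2)[OF dom sx b(1) px b(2)] unfolding exp_tri_def
    by (simp add: sums_iff)
  then show ?thesis
    using double_series_dominated(3)[OF dom sx b(1) px b(2)] unfolding exp_tri_def by simp
qed

text \<open>The binomial theorem for commuting operators.\<close>
lemma tri_add_pow:
  "(tri (p + p') (q + q') (r + r') ^^ N) f n / fact N =
    (\<Sum>k\<le>N. (tri p q r ^^ k) ((tri p' q' r' ^^ (N - k)) f) n / (fact k * fact (N - k)))"
proof -
  let ?X = "tri p q r" and ?Y = "tri p' q' r'" and ?Z = "tri (p + p') (q + q') (r + r')"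
  have Z: "?Z g n = ?X g n + ?Y g n" for g n by (simp add: tri_def algebra_simps)
  have lin: "tri a b c (\<lambda>n. \<Sum>k\<in>A. w k * F k n) n = (\<Sum>k\<in>A. w k * tri a b c (F k) n)"
    for a b c w n and A :: "nat set" and F :: "nat \<Rightarrow> int \<Rightarrow> real"
    by (simp add: tri_def sum_distrib_left sum.distrib algebra_simps)
  have "(?Z ^^ N) f = (\<lambda>n. \<Sum>k\<le>N. real (N choose k) * (?X ^^ k) ((?Y ^^ (N - k)) f) n)"
  proof (induction N)
    case (Suc N)
    let ?F = "\<lambda>k. (?X ^^ k) ((?Y ^^ (Suc N - k)) f)"
    have "(?Z ^^ Suc N) f n = (\<Sum>k\<le>Suc N. real (Suc N choose k) * ?F k n)" for n
    proof -
      have "(?Z ^^ Suc N) f n = (\<Sum>k\<le>N. real (N choose k) * ?X ((?X ^^ k) ((?Y ^^ (N - k)) f)) n)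
          + (\<Sum>k\<le>N. real (N choose k) * ?Y ((?X ^^ k) ((?Y ^^ (N - k)) f)) n)"
        by (simp only: funpow.simps o_def Suc.IH Z lin distrib_left sum.distrib)
      also have "(\<Sum>k\<le>N. real (N choose k) * ?X ((?X ^^ k) ((?Y ^^ (N - k)) f)) n)
          = (\<Sum>k\<le>N. real (N choose k) * ?F (Suc k) n)" by simp
      also have "(\<Sum>k\<le>N. real (N choose k) * ?Y ((?X ^^ k) ((?Y ^^ (N - k)) f)) n)
          = (\<Sum>k\<le>N. real (N choose k) * ?F k n)"
        by (intro sum.cong refl) (simp add: tri_pow_commute1 Suc_diff_le)
      also have "(\<Sum>k\<le>N. real (N choose k) * ?F k n) = (\<Sum>k\<le>Suc N. real (N choose k) * ?F k n)"
        by simp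
      also have "\<dots> = ?F 0 n + (\<Sum>k\<le>N. real (N choose Suc k) * ?F (Suc k) n)"
        by (subst sum.atMost_Suc_shift) simp
      also have "(\<Sum>k\<le>N. real (N choose k) * ?F (Suc k) n) + (?F 0 n + (\<Sum>k\<le>N. real (N choose Suc k) * ?F (Suc k) n))
         = ?F 0 n + (\<Sum>k\<le>N. real (Suc N choose Suc k) * ?F (Suc k) n)"
        by (simp add: sum.distrib[symmetric] algebra_simps)
      also have "\<dots> = (\<Sum>k\<le>Suc N. real (Suc N choose k) * ?F k n)"
        by (subst sum.atMost_Suc_shift) simp
      finally show ?thesis .
    qed
    then show ?case by blast
  qed simp
  then show ?thesis
    by (simp add: sum_divide_distrib binomial_fact field_simps)
qed

text \<open>By the binomial theorem, both sides are the same double series, summed along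
  antidiagonals on the left and iteratedly on the right.\<close>
lemma exp_tri_add:
  assumes "exp_growth f"
  shows "exp_tri (p + p') (q + q') (r + r') f n = exp_tri p q r (exp_tri p' q' r' f) n"
proof -
  let ?X = "tri p q r" and ?Y = "tri p' q' r'"
  from assms obtain C c where *: "\<And>n. \<bar>f n\<bar> \<le> C * exp (c * \<bar>real_of_int n\<bar>)" "0 \<le> C" "0 \<le> c"
    unfolding exp_growth_def by blast
  let ?M = "(\<bar>p\<bar> + \<bar>q\<bar> + \<bar>r\<bar>) * exp c" and ?M' = "(\<bar>p'\<bar> + \<bar>q'\<bar> + \<bar>r'\<bar>) * exp c"
  let ?a = "\<lambda>k i. (?X ^^ k) ((?Y ^^ i) f) n / (fact k * fact i)"
  have bY: "\<bar>(?Y ^^ i) f n\<bar> \<le> (C * ?M' ^ i) * exp (c * \<bar>real_of_int n\<bar>)" for i n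
    using tri_pow_bound[OF *, of i p' q' r' n] by (simp add: mult_ac)
  have "\<bar>(?X ^^ k) ((?Y ^^ i) f) n\<bar> \<le> ((C * ?M' ^ i) * exp (c * \<bar>real_of_int n\<bar>)) * ?M ^ k" for k i
    by (rule tri_pow_bound[OF bY]) (use * in auto)
  then have "\<bar>(?X ^^ k) ((?Y ^^ i) f) n\<bar> \<le> C * exp (c * \<bar>real_of_int n\<bar>) * ?M ^ k * ?M' ^ i" for k i
    by (simp only: mult_ac)
  from divide_right_mono[OF this]
  have dom: "\<bar>?a k i\<bar> \<le> (C * exp (c * \<bar>real_of_int n\<bar>) * (?M ^ k / fact k)) * (?M' ^ i / fact i)" for k i
    unfolding abs_divide by (simp add: mult.assoc)
  have s: "summable (\<lambda>k. C * exp (c * \<bar>real_of_int n\<bar>) * (?M ^ k / fact k))" "summable (\<lambda>i. ?M' ^ i / fact i)"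
    by (intro summable_mult summable_exp_real)+
  have p: "0 \<le> C * exp (c * \<bar>real_of_int n\<bar>) * (?M ^ k / fact k)" "0 \<le> ?M' ^ k / fact k" for k
    using * by auto
  have "(\<lambda>N. \<Sum>k\<le>N. ?a k (N - k)) sums (\<Sum>\<^sub>\<infinity>(k, i). ?a k i)"
    by (rule double_series_dominated(4)[OF dom s p])
  then have 1: "exp_tri (p + p') (q + q') (r + r') f n = (\<Sum>\<^sub>\<infinity>(k, i). ?a k i)"
    unfolding exp_tri_def tri_add_pow by (rule sums_unique[symmetric])
  have "(\<lambda>i. (?X ^^ k) (\<lambda>n. (?Y ^^ i) f n / fact i) n) sums (?X ^^ k) (exp_tri p' q' r' f) n" for k
    by (intro tri_pow_sums exp_tri_sums assms)
  moreover have "(?X ^^ k) (\<lambda>n. (?Y ^^ i) f n / fact i) n = (?X ^^ k) ((?Y ^^ i) f) n / fact i" for k i n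
    by (simp add: tri_pow_divide)
  ultimately have "(\<lambda>i. ?a k i) sums ((?X ^^ k) (exp_tri p' q' r' f) n / fact k)" for k
    using sums_divide[of "\<lambda>i. (?X ^^ k) ((?Y ^^ i) f) n / fact i" _ "fact k"] by (simp add: field_simps)
  then have "(\<lambda>k. (?X ^^ k) (exp_tri p' q' r' f) n / fact k) sums (\<Sum>\<^sub>\<infinity>(k, i). ?a k i)"
    using double_series_dominated(2)[OF dom s p] by (simp add: sums_iff)
  then show ?thesis using 1 unfolding exp_tri_def by (simp add: sums_iff)
qed

lemma exp_tri_tri_pow:
  assumes "exp_growth f"
  shows "(tri a b c ^^ j) (exp_tri p q r f) n = exp_tri p q r ((tri a b c ^^ j) f) n"
proof -
  have "(\<lambda>k. (tri a b c ^^ j) (\<lambda>n. (tri p q r ^^ k) f n / fact k) n) sums (tri a b c ^^ j) (exp_tri p q r f) n"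
    by (intro tri_pow_sums exp_tri_sums assms)
  moreover have "(tri a b c ^^ j) (\<lambda>n. (tri p q r ^^ k) f n / fact k) n = (tri p q r ^^ k) ((tri a b c ^^ j) f) n / fact k" for k
    unfolding tri_pow_divide by (simp add: tri_pow_commute[of j a b c k p q r f])
  ultimately have "(\<lambda>k. (tri p q r ^^ k) ((tri a b c ^^ j) f) n / fact k) sums (tri a b c ^^ j) (exp_tri p q r f) n"
    by simp
  then show ?thesis unfolding exp_tri_def[of p q r "(tri a b c ^^ j) f"] by (rule sums_unique)
qed

lemma exp_tri_scalar: "exp_tri 0 q 0 f n = exp q * f n"
proof -
  have "(tri 0 q 0 ^^ k) f = (\<lambda>n. q ^ k * f n)" for k
    by (induction k) (auto simp: tri_def fun_eq_iff)
  then have "exp_tri 0 q 0 f n = (\<Sum>k. q ^ k / fact k * f n)" by (simp add: exp_tri_def)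
  also have "\<dots> = (\<Sum>k. q ^ k / fact k) * f n" by (rule suminf_mult2[OF summable_exp_real, symmetric])
  also have "(\<Sum>k. q ^ k / fact k) = exp q" by (simp add: exp_def field_simps)
  finally show ?thesis .
qed

lemma exp_tri_zero [simp]: "exp_tri 0 0 0 f n = f n"
  by (simp add: exp_tri_scalar)

lemma exp_tri_factor_exp: "exp_growth f \<Longrightarrow> exp_tri p q r f n = exp q * exp_tri p 0 r f n"
  using exp_tri_add[of f 0 p q 0 0 r n] by (simp add: exp_tri_scalar)

text \<open>Applied to constants, which are preserved by the heat flow, and to hyperbolic cosines,
  which are its growth weights.\<close>
lemma exp_tri_eigen:
  assumes "\<And>n. tri p q r f n = x * f n"
  shows "exp_tri p q r f n = exp x * f n"
proof -
  have "(tri p q r ^^ k) f = (\<lambda>n. x ^ k * f n)" for k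
  proof (induction k)
    case (Suc k)
    have "tri p q r (\<lambda>n. x ^ k * f n) = (\<lambda>n. x ^ k * tri p q r f n)"
      using tri_linear[of p q r "x ^ k" f 0 f] by simp
    with Suc show ?case by (simp add: assms mult_ac)
  qed simp
  then have "exp_tri p q r f n = (\<Sum>k. x ^ k / fact k * f n)" by (simp add: exp_tri_def)
  also have "\<dots> = (\<Sum>k. x ^ k / fact k) * f n" by (rule suminf_mult2[OF summable_exp_real, symmetric])
  also have "(\<Sum>k. x ^ k / fact k) = exp x" by (simp add: exp_def field_simps)
  finally show ?thesis .
qed

lemma exp_tri_const: "exp_tri p q r (\<lambda>_. x) n = exp (p + q + r) * x"
  by (rule exp_tri_eigen) (simp add: tri_def algebra_simps)

text \<open>The diagonal coefficient, negative for the heat semigroup, only contributes the positive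
  factor \<open>exp q\<close>; without it all terms of the series are nonnegative.\<close>
lemma exp_tri_nonneg:
  assumes f: "exp_growth f" "\<And>n. 0 \<le> f n" and pr: "0 \<le> p" "0 \<le> r"
  shows "0 \<le> exp_tri p q r f n"
proof -
  have "0 \<le> (tri p 0 r ^^ k) f n" for k n
    using f(2) pr by (induction k arbitrary: n) (auto simp: tri_def)
  then have "0 \<le> exp_tri p 0 r f n"
    unfolding exp_tri_def by (intro suminf_nonneg sums_summable[OF exp_tri_sums] f) auto
  then show ?thesis by (simp add: exp_tri_factor_exp[OF f(1), of p q])
qed

lemma exp_tri_diff:
  assumes "exp_growth f" "exp_growth g"
  shows "exp_tri p q r (\<lambda>n. f n - g n) n = exp_tri p q r f n - exp_tri p q r g n"
  using exp_tri_linear[OF assms, of p q r 1 "-1" n] by simp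

lemma exp_tri_mono:
  assumes "exp_growth f" "exp_growth g" "\<And>n. f n \<le> g n" "0 \<le> p" "0 \<le> r"
  shows "exp_tri p q r f n \<le> exp_tri p q r g n"
  using exp_tri_nonneg[OF exp_growth_diff[OF assms(2,1)], of p r q n] exp_tri_diff[OF assms(2,1)] assms
  by simp

text \<open>Positivity applied to \<open>(f - l c)\<^sup>2\<close> with the optimal
  \<open>l\<close>.\<close>
lemma exp_tri_cauchy_schwarz:
  assumes f: "exp_growth f" and c: "exp_growth c" and pr: "0 \<le> p" "0 \<le> r"
    and pos: "0 < exp_tri p q r (\<lambda>m. (c m)\<^sup>2) n"
  shows "(exp_tri p q r (\<lambda>m. c m * f m) n)\<^sup>2 \<le>
    exp_tri p q r (\<lambda>m. (c m)\<^sup>2) n * exp_tri p q r (\<lambda>m. (f m)\<^sup>2) n"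
proof -
  let ?E = "\<lambda>g. exp_tri p q r g n"
  let ?X = "?E (\<lambda>m. c m * f m)" and ?A = "?E (\<lambda>m. (c m)\<^sup>2)" and ?B = "?E (\<lambda>m. (f m)\<^sup>2)"
  define l where "l = ?X / ?A"
  have cf: "exp_growth (\<lambda>m. c m * f m)" by (rule exp_growth_mult[OF c f])
  have "0 \<le> ?E (\<lambda>m. (f m - l * c m)\<^sup>2)"
    by (intro exp_tri_nonneg exp_growth_power2 exp_growth_diff exp_growth_cmult f c pr) auto
  also have "(\<lambda>m. (f m - l * c m)\<^sup>2) = (\<lambda>m. 1 * ((f m)\<^sup>2) + 1 * ((- 2 * l) * (c m * f m) + l\<^sup>2 * (c m)\<^sup>2))"
    by (auto simp: power2_eq_square algebra_simps)
  also have "?E \<dots> = ?B - 2 * l * ?X + l\<^sup>2 * ?A"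
    by (subst exp_tri_linear, intro exp_growth_power2 f, intro exp_growth_add exp_growth_cmult cf exp_growth_power2 c,
        subst exp_tri_linear, rule cf, intro exp_growth_power2 c) simp
  also have "\<dots> = ?B - ?X\<^sup>2 / ?A" using pos by (simp add: l_def field_simps power2_eq_square)
  finally show ?thesis using pos by (simp add: field_simps)
qed

section \<open>The heat semigroup as an exponential\<close>

abbreviation lap :: "(int \<Rightarrow> real) \<Rightarrow> int \<Rightarrow> real" where
  "lap \<equiv> tri 1 (- 2) 1"

definition heat :: "real \<Rightarrow> (int \<Rightarrow> real) \<Rightarrow> int \<Rightarrow> real" where
  "heat t f = exp_tri t (- 2 * t) t f"

lemma tri_pow_scale: "(tri (t * p) (t * q) (t * r) ^^ k) f n = t ^ k * (tri p q r ^^ k) f n"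
proof (induction k arbitrary: n)
  case (Suc k)
  then show ?case by (simp add: tri_def algebra_simps)
qed simp

lemma heat_egf: "heat t f n = egf (\<lambda>k. (lap ^^ k) f n) t"
proof -
  have "(tri t (- 2 * t) t ^^ k) f n = t ^ k * (lap ^^ k) f n" for k
    using tri_pow_scale[of k t 1 "- 2" 1 f n] by (simp add: mult.commute)
  then show ?thesis by (simp add: heat_def exp_tri_def egf_def)
qed

lemma heat_0 [simp]: "heat 0 f n = f n"
  by (simp add: heat_def)

lemma heat_add: "exp_growth f \<Longrightarrow> heat (s + t) f n = heat s (heat t f) n"
  using exp_tri_add[of f s t "- 2 * s" "- 2 * t" s t n] by (simp add: heat_def)

lemma heat_factor: "exp_growth f \<Longrightarrow> heat t f n = exp_tri t (- t) 0 (exp_tri 0 (- t) t f) n"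
  using exp_tri_add[of f t 0 "- t" "- t" 0 t n] by (simp add: heat_def)

lemma exp_growth_heat: "exp_growth f \<Longrightarrow> exp_growth (heat t f)"
  unfolding heat_def by (rule exp_growth_exp_tri)

lemma heat_tri_pow: "exp_growth f \<Longrightarrow> (tri a b c ^^ j) (heat t f) n = heat t ((tri a b c ^^ j) f) n"
  unfolding heat_def by (rule exp_tri_tri_pow)

lemma heat_has_derivative:
  assumes "exp_growth f"
  shows "((\<lambda>t. heat t f n) has_real_derivative heat t (lap f) n) (at t)"
proof -
  obtain C M where "\<And>k. \<bar>(lap ^^ k) f n\<bar> \<le> C * M ^ k"
    using exp_tri_coeff_bound[OF assms] by metis
  from egf_has_derivative[OF this] show ?thesis
    by (simp add: heat_egf[abs_def] funpow_Suc_right del: funpow.simps)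
qed

lemma heat_mono:
  assumes "exp_growth f" "exp_growth g" "\<And>n. f n \<le> g n" "0 \<le> t"
  shows "heat t f n \<le> heat t g n"
  unfolding heat_def using assms by (intro exp_tri_mono) auto

lemma heat_const [simp]: "heat t (\<lambda>_. x) n = x"
  by (simp add: heat_def exp_tri_const)

lemma heat_diff: "exp_growth f \<Longrightarrow> exp_growth g \<Longrightarrow> heat t (\<lambda>n. f n - g n) n = heat t f n - heat t g n"
  unfolding heat_def by (rule exp_tri_diff)

lemma exp_tri_right_sums:
  assumes "exp_growth f"
  shows "(\<lambda>a. exp (- t) * t ^ a / fact a * f (n + int a)) sums exp_tri 0 (- t) t f n"
proof -
  have p: "(tri 0 0 t ^^ a) f n = t ^ a * f (n + int a)" for a n
    by (induction a arbitrary: n) (simp_all add: tri_def add_ac)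
  have "(\<lambda>a. exp (- t) * ((tri 0 0 t ^^ a) f n / fact a)) sums (exp (- t) * exp_tri 0 0 t f n)"
    by (intro sums_mult exp_tri_sums assms)
  then show ?thesis by (simp add: p exp_tri_factor_exp[OF assms, of 0 "- t" t n] mult_ac)
qed

lemma exp_tri_left_sums:
  assumes "exp_growth f"
  shows "(\<lambda>a. exp (- t) * t ^ a / fact a * f (n - int a)) sums exp_tri t (- t) 0 f n"
proof -
  have p: "(tri t 0 0 ^^ a) f n = t ^ a * f (n - int a)" for a n
    by (induction a arbitrary: n) (simp_all add: tri_def diff_diff_eq add_ac)
  have "(\<lambda>a. exp (- t) * ((tri t 0 0 ^^ a) f n / fact a)) sums (exp (- t) * exp_tri t 0 0 f n)"
    by (intro sums_mult exp_tri_sums assms)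
  then show ?thesis by (simp add: p exp_tri_factor_exp[OF assms, of t "- t" 0 n] mult_ac)
qed

text \<open>The Laplacian is the sum of \<open>S - 1\<close> and \<open>S\<^sup>-\<^sup>1 -
  1\<close>, whose exponentials are averages against Poisson weights. So the heat kernel is the
  distribution of a difference of two independent Poisson variables.\<close>
lemma heat_double_sum:
  assumes f: "exp_growth f" and t: "0 \<le> t"
  shows "((\<lambda>(a, b). exp (- 2 * t) * (t ^ a / fact a) * (t ^ b / fact b) * f (n - int a + int b))
    has_sum heat t f n) UNIV"
proof -
  let ?A = "\<lambda>a b. exp (- 2 * t) * (t ^ a / fact a) * (t ^ b / fact b) * f (n - int a + int b)"
  from f obtain C c where *: "\<And>n. \<bar>f n\<bar> \<le> C * exp (c * \<bar>real_of_int n\<bar>)" "0 \<le> C" "0 \<le> c"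
    unfolding exp_growth_def by blast
  define B where "B = exp (- 2 * t) * C * exp (c * \<bar>real_of_int n\<bar>)"
  have dom: "\<bar>?A a b\<bar> \<le> (B * ((t * exp c) ^ a / fact a)) * ((t * exp c) ^ b / fact b)" for a b
  proof -
    have "\<bar>real_of_int (n - int a + int b)\<bar> \<le> \<bar>real_of_int n\<bar> + real a + real b" by simp
    from mult_left_mono[OF this *(3)]
    have "exp (c * \<bar>real_of_int (n - int a + int b)\<bar>) \<le> exp (c * (\<bar>real_of_int n\<bar> + real a + real b))"
      by simp
    also have "\<dots> = exp (c * \<bar>real_of_int n\<bar>) * exp c ^ a * exp c ^ b"
      by (simp add: distrib_left exp_add exp_of_nat_mult[symmetric] mult.commute)
    finally have "\<bar>f (n - int a + int b)\<bar> \<le> C * (exp (c * \<bar>real_of_int n\<bar>) * exp c ^ a * exp c ^ b)"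
      using *(1)[of "n - int a + int b"] mult_left_mono[OF _ *(2)] by (meson order_trans)
    then have "exp (- 2 * t) * (t ^ a / fact a) * (t ^ b / fact b) * \<bar>f (n - int a + int b)\<bar>
      \<le> exp (- 2 * t) * (t ^ a / fact a) * (t ^ b / fact b) * (C * (exp (c * \<bar>real_of_int n\<bar>) * exp c ^ a * exp c ^ b))"
      by (intro mult_left_mono) (use t in auto)
    then show ?thesis using t by (simp add: abs_mult B_def power_mult_distrib mult_ac)
  qed
  have "summable (\<lambda>a. B * ((t * exp c) ^ a / fact a))" "summable (\<lambda>b. (t * exp c) ^ b / fact b)"
    by (intro summable_mult summable_exp_real)+
  note ds = double_series_dominated[OF dom this]
  have p: "0 \<le> B * ((t * exp c) ^ a / fact a)" "0 \<le> (t * exp c) ^ a / fact a" for a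
    using * t by (auto simp: B_def)
  have "(\<lambda>b. exp (- t) * t ^ b / fact b * f (n - int a + int b)) sums exp_tri 0 (- t) t f (n - int a)" for a
    by (rule exp_tri_right_sums[OF f])
  from sums_mult[OF this]
  have "(\<lambda>b. exp (- t) * t ^ a / fact a * (exp (- t) * t ^ b / fact b * f (n - int a + int b))) sums
    (exp (- t) * t ^ a / fact a * exp_tri 0 (- t) t f (n - int a))" for a .
  moreover have "exp (- t) * t ^ a / fact a * (exp (- t) * t ^ b / fact b * f (n - int a + int b)) = ?A a b" for a b
  proof -
    have "exp (- 2 * t) = exp (- t) * exp (- t)" by (simp flip: exp_add)
    then show ?thesis by simp
  qed
  ultimately have "(\<lambda>b. ?A a b) sums (exp (- t) * t ^ a / fact a * exp_tri 0 (- t) t f (n - int a))" for a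
    by (simp only:)
  then have "(\<Sum>b. ?A a b) = exp (- t) * t ^ a / fact a * exp_tri 0 (- t) t f (n - int a)" for a
    by (simp add: sums_iff)
  moreover have "(\<lambda>a. exp (- t) * t ^ a / fact a * exp_tri 0 (- t) t f (n - int a)) sums heat t f n"
    unfolding heat_factor[OF f] by (intro exp_tri_left_sums exp_growth_exp_tri f)
  ultimately have "(\<lambda>a. \<Sum>b. ?A a b) sums heat t f n"
    by (simp only:)
  then have "(\<Sum>\<^sub>\<infinity>(a, b). ?A a b) = heat t f n"
    using ds(2)[OF p] by (simp add: sums_iff)
  moreover have "(\<lambda>(a, b). ?A a b) summable_on UNIV"
    by (rule ds(1)[OF p])
  ultimately show ?thesis by (simp add: summable_iff_has_sum_infsum)
qed

text \<open>Grouping the pairs \<open>(a, b)\<close> by their difference turns the double Poisson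
  sum into the Bessel series; the smaller of the two is the summation index there.\<close>
lemma heat_kernel_has_sum:
  assumes f: "exp_growth f" and t: "0 \<le> t"
  shows "((\<lambda>j. heat_kernel t (n - j) * f j) has_sum heat t f n) UNIV"
proof -
  let ?T = "\<lambda>j m. exp (- 2 * t) * (t ^ (m + nat (n - j)) / fact (m + nat (n - j))) *
    (t ^ (m + nat (j - n)) / fact (m + nat (j - n))) * f j"
  have hs: "((\<lambda>(j, m). ?T j m) has_sum heat t f n) (UNIV \<times> UNIV)"
  proof -
    have "((\<lambda>(j, m). ?T j m) has_sum heat t f n) (UNIV \<times> UNIV) \<longleftrightarrow>
      ((\<lambda>(a, b). exp (- 2 * t) * (t ^ a / fact a) * (t ^ b / fact b) * f (n - int a + int b)) has_sum heat t f n) UNIV"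
      by (rule has_sum_reindex_bij_witness[of _ "\<lambda>(a, b). (n - int a + int b, min a b)" "\<lambda>(j, m). (m + nat (n - j), m + nat (j - n))"])
         (auto simp: min_def)
    then show ?thesis using heat_double_sum[OF f t] by simp
  qed
  have T: "?T j m = 1 / (fact m * Gamma (real (m + nat \<bar>n - j\<bar> + 1))) * (2 * t / 2) ^ (2 * m + nat \<bar>n - j\<bar>)
     * (exp (- 2 * t) * f j)" for j m
  proof -
    let ?k = "nat \<bar>n - j\<bar>"
    have "?T j m = exp (- 2 * t) * (t ^ (m + ?k) / fact (m + ?k)) * (t ^ m / fact m) * f j"
    proof (cases "j \<le> n")
      case False
      then have "nat (n - j) = 0" "?k = nat (j - n)" by auto
      then show ?thesis by (simp only: add_0_right) (simp only: mult_ac)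
    qed simp
    moreover have "Gamma (real (m + ?k + 1)) = fact (m + ?k)"
      using Gamma_fact[of "m + ?k", where 'a = real] by (simp add: add_ac)
    moreover have "(2 * t / 2) ^ (2 * m + ?k) = t ^ (m + ?k) * t ^ m"
      by (simp add: power_add power_mult power2_eq_square power_mult_distrib)
    ultimately show ?thesis by (simp only: times_divide_eq_left times_divide_eq_right divide_divide_eq_left mult_1 mult_ac)
  qed
  have inner: "((\<lambda>m. ?T j m) has_sum heat_kernel t (n - j) * f j) UNIV" for j
  proof (cases "f j = 0")
    case False
    have "(\<lambda>m. ?T j m) summable_on UNIV"
      using summable_on_SigmaD1[where f = ?T and A = UNIV and B = "\<lambda>_. UNIV", OF has_sum_imp_summable[OF hs] UNIV_I] .
    then have hsj: "((\<lambda>m. ?T j m) has_sum infsum (\<lambda>m. ?T j m) UNIV) UNIV" by simp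
    then have "(\<lambda>m. ?T j m) sums infsum (\<lambda>m. ?T j m) UNIV" by (rule has_sum_imp_sums)
    from sums_divide[OF this, of "exp (- 2 * t) * f j"] False
    have "bessel_I (n - j) (2 * t) = infsum (\<lambda>m. ?T j m) UNIV / (exp (- 2 * t) * f j)"
      unfolding T bessel_I_def by (simp add: sums_iff)
    then have "infsum (\<lambda>m. ?T j m) UNIV = heat_kernel t (n - j) * f j"
      using False by (simp add: heat_kernel_def)
    then show ?thesis using hsj by simp
  qed simp
  show ?thesis by (rule has_sum_SigmaD[OF hs]) (use inner in auto)
qed

lemma heat_semigroup_eq: "exp_growth f \<Longrightarrow> 0 \<le> t \<Longrightarrow> heat_semigroup t f n = heat t f n"
  unfolding heat_semigroup_def by (rule infsumI) (rule heat_kernel_has_sum)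

abbreviation point_mass :: "int \<Rightarrow> real" where
  "point_mass j \<equiv> (if j = 0 then 1 else 0)"

lemma heat_kernel_eq_heat: "0 \<le> t \<Longrightarrow> heat_kernel t n = heat t point_mass n"
proof -
  assume t: "0 \<le> t"
  have "exp_growth point_mass" by (rule exp_growth_bounded[of _ 1]) auto
  from heat_kernel_has_sum[OF this t, of n]
  have "((\<lambda>j. heat_kernel t (n - j) * point_mass j) has_sum heat t point_mass n) UNIV" .
  moreover have "((\<lambda>j. heat_kernel t (n - j) * point_mass j) has_sum heat_kernel t n) UNIV"
    using has_sum_finite_neutralI[of "{0}" UNIV "\<lambda>j. heat_kernel t (n - j) * point_mass j" "heat_kernel t n"] by simp
  ultimately show ?thesis using has_sum_unique by blast
qed

lemma heat_kernel_bounds: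
  assumes "0 \<le> t"
  shows "0 \<le> heat_kernel t n" "heat_kernel t n \<le> 1"
proof -
  have eg: "exp_growth point_mass" by (rule exp_growth_bounded[of _ 1]) auto
  show "0 \<le> heat_kernel t n" "heat_kernel t n \<le> 1"
    using heat_mono[OF exp_growth_const eg, of 0 t n] heat_mono[OF eg exp_growth_const, of 1 t n] assms
    by (auto simp: heat_kernel_eq_heat)
qed

section \<open>Smoothing by the heat semigroup\<close>

lemma delta_right_eq_tri: "delta_right = tri 0 1 (- 1)"
  by (simp add: fun_eq_iff delta_right_def tri_def)

lemma delta_right_pow_heat: "exp_growth f \<Longrightarrow> (delta_right ^^ j) (heat t f) n = heat t ((delta_right ^^ j) f) n"
  unfolding delta_right_eq_tri by (rule heat_tri_pow)

lemma exp_growth_delta_right_pow: "exp_growth f \<Longrightarrow> exp_growth ((delta_right ^^ j) f)"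
  unfolding delta_right_eq_tri by (rule exp_growth_tri_pow)

lemma exp_growth_affine: "exp_growth (\<lambda>m. x + y * real_of_int m)"
proof (rule exp_growthI[of _ "\<bar>x\<bar> + \<bar>y\<bar>" 1])
  fix n
  have "\<bar>real_of_int n\<bar> \<le> exp (1 * \<bar>real_of_int n\<bar>)" "1 \<le> exp (1 * \<bar>real_of_int n\<bar>)"
    using exp_ge_add_one_self[of "\<bar>real_of_int n\<bar>"] by (simp_all, linarith)
  then have "\<bar>x\<bar> * 1 + \<bar>y\<bar> * \<bar>real_of_int n\<bar> \<le> \<bar>x\<bar> * exp (1 * \<bar>real_of_int n\<bar>) + \<bar>y\<bar> * exp (1 * \<bar>real_of_int n\<bar>)"
    by (intro add_mono mult_left_mono) auto
  then show "\<bar>x + y * real_of_int n\<bar> \<le> (\<bar>x\<bar> + \<bar>y\<bar>) * exp (1 * \<bar>real_of_int n\<bar>)"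
    using abs_triangle_ineq[of x "y * real_of_int n"] by (simp add: abs_mult distrib_right)
qed auto

text \<open>The Poisson weights \<open>p\<^sub>a = e\<^sup>-\<^sup>t t\<^sup>a / a!\<close> satisfy
  \<open>p\<^sub>a - p\<^sub>a\<^sub>-\<^sub>1 = (1 - a / t) p\<^sub>a\<close>, so a difference of
  the average is an average with a centred factor.\<close>
lemma delta_right_poisson_average:
  assumes f: "exp_growth f" and t: "0 < t"
  shows "delta_right (exp_tri 0 (- t) t f) n =
    exp_tri 0 (- t) t (\<lambda>m. (1 - (real_of_int m - real_of_int n) / t) * f m) n"
proof -
  define p where "p a = exp (- t) * t ^ a / fact a" for a
  \<comment> \<open>The recursion behind the identity for the weight differences; the shifted sum starts at \<open>a = 1\<close>, but its term at \<open>a = 0\<close> vanishes.\<close>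
  have p_Suc: "p (Suc a) * (real (Suc a) / t) = p a" for a
    using t by (simp add: p_def field_simps del: of_nat_Suc)
  have aff: "(\<lambda>m. 1 - (real_of_int m - real_of_int n) / t) = (\<lambda>m. (1 + real_of_int n / t) + (- 1 / t) * real_of_int m)"
    using t by (auto simp: field_simps)
  have eg: "exp_growth (\<lambda>m. (1 - (real_of_int m - real_of_int n) / t) * f m)"
    by (rule exp_growth_mult[OF _ f], subst aff, rule exp_growth_affine)
  have 1: "(\<lambda>a. p a * f (n + int a)) sums exp_tri 0 (- t) t f n"
    using exp_tri_right_sums[OF f] by (simp add: p_def)
  have "(\<lambda>a. p a * f (n + 1 + int a)) sums exp_tri 0 (- t) t f (n + 1)"
    using exp_tri_right_sums[OF f] by (simp add: p_def)
  then have "(\<lambda>a. p (Suc a) * (real (Suc a) / t) * f (n + int (Suc a))) sums exp_tri 0 (- t) t f (n + 1)"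
    unfolding p_Suc by (simp add: add_ac)
  then have 2: "(\<lambda>a. p a * (real a / t) * f (n + int a)) sums exp_tri 0 (- t) t f (n + 1)"
    using sums_Suc_iff[of "\<lambda>a. p a * (real a / t) * f (n + int a)"] by simp
  have "(\<lambda>a. p a * f (n + int a) - p a * (real a / t) * f (n + int a)) sums delta_right (exp_tri 0 (- t) t f) n"
    unfolding delta_right_def by (rule sums_diff[OF 1 2])
  moreover have "(\<lambda>a. p a * ((1 - real_of_int (n + int a - n) / t) * f (n + int a))) sums
      exp_tri 0 (- t) t (\<lambda>m. (1 - (real_of_int m - real_of_int n) / t) * f m) n"
    using exp_tri_right_sums[OF eg, of t n] by (simp add: p_def)
  ultimately show ?thesis
    by (simp add: algebra_simps sums_iff)
qed

text \<open>The factor is a quadratic polynomial, so the exponential series stops after its third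
  term.\<close>
lemma poisson_variance:
  assumes t: "0 < t"
  shows "exp_tri 0 (- t) t (\<lambda>m. (1 - (real_of_int m - real_of_int n) / t)\<^sup>2) n = 1 / t"
proof -
  let ?X = "tri 0 (- t) t" and ?g = "\<lambda>m. (1 - (real_of_int m - real_of_int n) / t)\<^sup>2"
  have 1: "?X ?g = (\<lambda>m. 1 / t - 2 * (1 - (real_of_int m - real_of_int n) / t))"
    using t by (auto simp: tri_def field_simps power2_eq_square)
  have 2: "?X (\<lambda>m. 1 / t - 2 * (1 - (real_of_int m - real_of_int n) / t)) = (\<lambda>m. 2)"
    using t by (auto simp: tri_def field_simps)
  have 3: "?X (\<lambda>m. 2) = (\<lambda>m. 0)" "?X (\<lambda>m. 0) = (\<lambda>m. 0)" by (auto simp: tri_def)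
  have z: "(?X ^^ (k + 3)) ?g = (\<lambda>m. 0)" for k
  proof (induction k)
    case 0
    show ?case by (simp only: numeral_3_eq_3 add_0 funpow.simps o_def id_def 1 2 3)
  qed (simp only: add_Suc funpow.simps o_def 3)
  have "exp_tri 0 (- t) t ?g n = (\<Sum>k<3. (?X ^^ k) ?g n / fact k)"
    unfolding exp_tri_def
  proof (rule suminf_finite)
    fix k :: nat assume "k \<notin> {..<3}"
    then obtain i where "k = i + 3" using le_Suc_ex by (metis add.commute lessThan_iff not_less)
    with z[of i] show "(?X ^^ k) ?g n / fact k = 0" by simp
  qed simp
  also have "\<dots> = ?g n + ?X ?g n + ?X (?X ?g) n / 2"
    by (simp add: eval_nat_numeral)
  also have "\<dots> = 1 / t" unfolding 1 2 by simp
  finally show ?thesis .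
qed

lemma exp_growth_one_minus: "exp_growth (\<lambda>m. 1 - (real_of_int m - real_of_int n) / t)"
proof -
  have "(\<lambda>m. 1 - (real_of_int m - real_of_int n) / t) = (\<lambda>m. (1 + real_of_int n / t) + (- 1 / t) * real_of_int m)"
    by (auto simp: diff_divide_distrib)
  then show ?thesis by (simp only: exp_growth_affine)
qed

lemma exp_tri_jensen:
  assumes f: "exp_growth f" and "0 \<le> p" "0 \<le> r" "p + q + r = 0"
  shows "(exp_tri p q r f n)\<^sup>2 \<le> exp_tri p q r (\<lambda>m. (f m)\<^sup>2) n"
  using exp_tri_cauchy_schwarz[OF f exp_growth_const[of 1], of p r q n] assms
  by (simp add: exp_tri_const)

text \<open>The difference acts on the right-moving half of the semigroup, where it becomes a factor
  of variance \<open>1 / t\<close>; Jensen's inequality absorbs the other half. Having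
  \<open>f\<^sup>2\<close> under the semigroup, rather than a bound of \<open>f\<close>, makes the
  inequality useful for functions of polynomial growth.\<close>
lemma heat_gradient:
  assumes f: "exp_growth f" and t: "0 < t"
  shows "(delta_right (heat t f) n)\<^sup>2 \<le> heat t (\<lambda>m. (f m)\<^sup>2) n / t"
proof -
  define h where "h = exp_tri 0 (- t) t f"
  have egd: "exp_growth (delta_right h)"
    unfolding h_def delta_right_eq_tri by (intro exp_growth_tri exp_growth_exp_tri f)
  have heat_h: "heat t f = exp_tri t (- t) 0 h"
    by (rule ext) (simp add: heat_factor[OF f] h_def)
  have grad: "(delta_right h m)\<^sup>2 \<le> exp_tri 0 (- t) t (\<lambda>m. (f m)\<^sup>2) m / t" for m
    using exp_tri_cauchy_schwarz[OF f exp_growth_one_minus[of m t], of 0 t "- t" m] t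
    unfolding h_def delta_right_poisson_average[OF f t] by (simp add: poisson_variance)
  have eg2: "exp_growth (\<lambda>m. (f m)\<^sup>2)" by (rule exp_growth_power2[OF f])
  have "delta_right (heat t f) n = exp_tri t (- t) 0 (delta_right h) n"
    using exp_tri_tri_pow[of h 1 0 1 "- 1" t "- t" 0 n] exp_growth_exp_tri[OF f]
    by (simp add: heat_h delta_right_eq_tri h_def)
  then have "(delta_right (heat t f) n)\<^sup>2 \<le> exp_tri t (- t) 0 (\<lambda>m. (delta_right h m)\<^sup>2) n"
    using exp_tri_jensen[OF egd, of t 0 "- t" n] t by simp
  also have "\<dots> \<le> exp_tri t (- t) 0 (\<lambda>m. (1 / t) * exp_tri 0 (- t) t (\<lambda>m. (f m)\<^sup>2) m) n"
    by (intro exp_tri_mono exp_growth_power2 egd exp_growth_cmult exp_growth_exp_tri eg2)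
       (use grad t in auto)
  also have "\<dots> = heat t (\<lambda>m. (f m)\<^sup>2) n / t"
    using exp_tri_linear[OF exp_growth_exp_tri[OF eg2, of 0 "- t" t] exp_growth_const[of 0], of t "- t" 0 "1 / t" 0 n]
      heat_factor[OF eg2, of t n] by simp
  finally show ?thesis .
qed

text \<open>The time is split into \<open>i\<close> equal parts, one for each difference.\<close>
lemma heat_gradient_pow_aux:
  assumes f: "exp_growth f" and s: "0 < s"
  shows "((delta_right ^^ i) (heat (real i * s) f) n)\<^sup>2 \<le> heat (real i * s) (\<lambda>m. (f m)\<^sup>2) n / s ^ i"
proof (induction i arbitrary: n)
  case (Suc i)
  let ?g = "(delta_right ^^ i) (heat (real i * s) f)"
  have eg: "exp_growth ?g" by (intro exp_growth_delta_right_pow exp_growth_heat f)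
  have eg2: "exp_growth (\<lambda>m. (f m)\<^sup>2)" by (rule exp_growth_power2[OF f])
  have "heat (real (Suc i) * s) f = heat s (heat (real i * s) f)"
    using heat_add[OF f, of s "real i * s"] by (auto simp: algebra_simps)
  then have "(delta_right ^^ Suc i) (heat (real (Suc i) * s) f) n = delta_right (heat s ?g) n"
    using ext[of "(delta_right ^^ i) (heat s (heat (real i * s) f))", OF delta_right_pow_heat[OF exp_growth_heat[OF f]]] by simp
  then have "((delta_right ^^ Suc i) (heat (real (Suc i) * s) f) n)\<^sup>2 \<le> heat s (\<lambda>m. (?g m)\<^sup>2) n / s"
    using heat_gradient[OF eg s] by simp
  also have "\<dots> \<le> heat s (\<lambda>m. (1 / s ^ i) * heat (real i * s) (\<lambda>m. (f m)\<^sup>2) m) n / s"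
    by (intro divide_right_mono heat_mono exp_growth_power2 eg exp_growth_cmult exp_growth_heat eg2)
       (use Suc s in auto)
  also have "\<dots> = heat (real (Suc i) * s) (\<lambda>m. (f m)\<^sup>2) n / s ^ Suc i"
    using exp_tri_linear[OF exp_growth_heat[OF eg2, of "real i * s"] exp_growth_const[of 0], of s "- 2 * s" s "1 / s ^ i" 0 n]
      heat_add[OF eg2, of s "real i * s" n] s by (simp add: heat_def algebra_simps)
  finally show ?case .
qed simp

lemma heat_gradient_pow:
  assumes f: "exp_growth f" and t: "0 < t"
  shows "((delta_right ^^ i) (heat t f) n)\<^sup>2 \<le> (real i / t) ^ i * heat t (\<lambda>m. (f m)\<^sup>2) n"
proof (cases "i = 0")
  case True
  then show ?thesis
    using exp_tri_jensen[OF f, of t t "- 2 * t" n] t by (simp add: heat_def)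
next
  case False
  then show ?thesis
    using heat_gradient_pow_aux[OF f, of "t / real i" i n] t by (simp add: field_simps power_divide)
qed

lemma heat_smoothing:
  assumes f: "\<And>n. \<bar>f n\<bar> \<le> B" and t: "0 < t"
  shows "\<bar>(delta_right ^^ i) (heat t f) n\<bar> \<le> sqrt (real i ^ i) * B * t powr (- real i / 2)"
proof -
  have B: "0 \<le> B" using f[of 0] by linarith
  have eg: "exp_growth f" by (rule exp_growth_bounded[OF f])
  have "heat t (\<lambda>m. (f m)\<^sup>2) n \<le> heat t (\<lambda>_. B\<^sup>2) n"
    using f t by (intro heat_mono exp_growth_power2 eg exp_growth_const) (auto simp: abs_le_square_iff[symmetric] B)
  then have "((delta_right ^^ i) (heat t f) n)\<^sup>2 \<le> (real i / t) ^ i * B\<^sup>2"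
    using heat_gradient_pow[OF eg t, of i n] t mult_left_mono[of _ "B\<^sup>2" "(real i / t) ^ i"]
    by (fastforce intro: order_trans)
  also have "\<dots> = (sqrt (real i ^ i) * B * t powr (- real i / 2))\<^sup>2"
  proof -
    have "(t powr (- real i / 2))\<^sup>2 = t powr (- real i)"
      using t by (simp add: power2_eq_square flip: powr_add)
    also have "\<dots> = 1 / t ^ i" using t by (simp add: powr_minus powr_realpow divide_inverse)
    finally show ?thesis by (simp add: power_mult_distrib power_divide)
  qed
  finally show ?thesis using B by (subst (asm) abs_le_square_iff[symmetric]) (auto simp: abs_mult)
qed

section \<open>Functions of polynomial growth\<close>

definition growth_order :: "real \<Rightarrow> (int \<Rightarrow> real) \<Rightarrow> bool" where
  "growth_order a f \<longleftrightarrow> (\<exists>C. \<forall>n. \<bar>f n\<bar> \<le> C * (1 + \<bar>real_of_int n\<bar> powr a))"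

text \<open>The constant is the one from \<open>ln (x / p) \<le> x / p - 1\<close>.\<close>
lemma powr_le_exp:
  fixes x p :: real
  assumes "0 \<le> x" "0 < p"
  shows "x powr p \<le> exp (p * ln p) * exp x"
proof (cases "x = 0")
  case False
  then have x: "0 < x" using assms by simp
  have "ln (x / p) \<le> x / p - 1" using x assms by (intro ln_le_minus_one) simp
  then have "p * (ln x - ln p) \<le> p * (x / p - 1)" using x assms by (simp add: ln_div)
  then have "p * ln x \<le> p * ln p + x" using assms by (simp add: algebra_simps)
  then show ?thesis using x by (simp add: powr_def flip: exp_add)
qed (simp add: assms)

lemma growth_order_exp_growth:
  assumes "growth_order a f" "0 < a"
  shows "exp_growth f"
proof -
  obtain C where C: "\<And>n. \<bar>f n\<bar> \<le> C * (1 + \<bar>real_of_int n\<bar> powr a)"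
    using assms(1) unfolding growth_order_def by blast
  have C0: "0 \<le> C" using C[of 0] assms(2) by simp
  show ?thesis
  proof (rule exp_growthI)
    fix n
    have "1 + \<bar>real_of_int n\<bar> powr a \<le> exp \<bar>real_of_int n\<bar> + exp (a * ln a) * exp \<bar>real_of_int n\<bar>"
      by (intro add_mono powr_le_exp assms) auto
    from mult_left_mono[OF this C0] C[of n]
    show "\<bar>f n\<bar> \<le> (C * (1 + exp (a * ln a))) * exp (1 * \<bar>real_of_int n\<bar>)"
      by (simp add: algebra_simps)
  qed (use C0 in \<open>auto intro!: mult_nonneg_nonneg add_nonneg_nonneg\<close>)
qed

lemma cosh_le_one_plus_square:
  fixes s :: real
  assumes "0 \<le> s" "s \<le> 1"
  shows "cosh s \<le> 1 + s\<^sup>2"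
proof -
  have "exp s \<le> 1 + s + s\<^sup>2" using assms by (rule exp_bound)
  moreover have "exp (- s) \<le> 1 - s + s\<^sup>2"
  proof -
    have "exp (- s) \<le> 1 / (1 + s)"
      using exp_ge_add_one_self[of s] assms by (simp add: exp_minus field_simps)
    also have "1 \<le> (1 - s + s\<^sup>2) * (1 + s)"
      using assms by (simp add: algebra_simps power2_eq_square)
    then have "1 / (1 + s) \<le> 1 - s + s\<^sup>2"
      using assms by (simp add: pos_divide_le_eq)
    finally show ?thesis .
  qed
  ultimately show ?thesis by (simp add: cosh_def)
qed

lemma exp_growth_cosh: "exp_growth (\<lambda>n. cosh (s * real_of_int n))"
proof (rule exp_growthI[of _ 1 "\<bar>s\<bar>"])
  fix n
  let ?y = "s * real_of_int n"
  have "?y \<le> \<bar>s\<bar> * \<bar>real_of_int n\<bar>" "- ?y \<le> \<bar>s\<bar> * \<bar>real_of_int n\<bar>"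
    by (simp_all flip: abs_mult)
  then have "exp ?y \<le> exp (\<bar>s\<bar> * \<bar>real_of_int n\<bar>)" "exp (- ?y) \<le> exp (\<bar>s\<bar> * \<bar>real_of_int n\<bar>)"
    by (simp_all only: exp_le_cancel_iff)
  then have "(exp ?y + exp (- ?y)) / 2 \<le> exp (\<bar>s\<bar> * \<bar>real_of_int n\<bar>)"
    by argo
  then have "cosh ?y \<le> exp (\<bar>s\<bar> * \<bar>real_of_int n\<bar>)" by (simp add: cosh_def)
  then show "\<bar>cosh ?y\<bar> \<le> 1 * exp (\<bar>s\<bar> * \<bar>real_of_int n\<bar>)"
    using cosh_real_nonneg[of ?y] by (metis abs_of_nonneg mult_1)
qed auto

text \<open>This is the weight adapted to the scale \<open>\<surd>t\<close>: it is an eigenfunction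
  of the Laplacian with an eigenvalue of order \<open>1 / t\<close>, so it changes only by a
  constant up to time \<open>t\<close>.\<close>
lemma heat_cosh_le:
  assumes t: "1 \<le> t"
  shows "heat t (\<lambda>n. cosh (real_of_int n / sqrt t)) n \<le> exp 2 * cosh (real_of_int n / sqrt t)"
proof -
  define s where "s = 1 / sqrt t"
  have s: "0 \<le> s" "s \<le> 1" and s2: "s\<^sup>2 = 1 / t" using t by (simp_all add: s_def power_divide)
  have eig: "tri t (- 2 * t) t (\<lambda>n. cosh (real_of_int n * s)) n
      = (t * (2 * cosh s - 2)) * cosh (real_of_int n * s)" for n
    by (simp add: tri_def left_diff_distrib distrib_right cosh_add cosh_diff algebra_simps)
  have "heat t (\<lambda>n. cosh (real_of_int n * s)) n = exp (t * (2 * cosh s - 2)) * cosh (real_of_int n * s)"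
    unfolding heat_def by (rule exp_tri_eigen[OF eig])
  also have "t * (2 * cosh s - 2) \<le> t * (2 * s\<^sup>2)"
    using cosh_le_one_plus_square[OF s] t by (intro mult_left_mono) auto
  then have "exp (t * (2 * cosh s - 2)) * cosh (real_of_int n * s) \<le> exp 2 * cosh (real_of_int n * s)"
    using t by (intro mult_right_mono) (auto simp: s2)
  finally show ?thesis by (simp add: s_def)
qed

text \<open>The square of \<open>f\<close> is at most a multiple of \<open>t\<^sup>a cosh (n /
  \<surd>t)\<close>, which the heat flow preserves up to a constant; the gradient estimate gains
  \<open>t\<^sup>-\<^sup>i\<close>.\<close>
lemma heat_difference_growth:
  assumes f: "growth_order a f" and a: "0 < a"
  shows "\<exists>K. \<forall>t\<ge>1. \<forall>n. ((delta_right ^^ i) (heat t f) n)\<^sup>2 \<le> K * t powr (a - real i) * cosh (real_of_int n / sqrt t)"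
proof -
  obtain C where C: "\<And>n. \<bar>f n\<bar> \<le> C * (1 + \<bar>real_of_int n\<bar> powr a)"
    using f unfolding growth_order_def by blast
  define E where "E = exp (2 * a * ln (2 * a))"
  define L where "L = C\<^sup>2 * (2 + 4 * E)"
  have L0: "0 \<le> L" by (simp add: L_def E_def)
  have eg: "exp_growth f" by (rule growth_order_exp_growth[OF f a])
  show ?thesis
  proof (intro exI[of _ "real i ^ i * L * exp 2"] allI impI)
    fix t :: real and n :: int assume t: "1 \<le> t"
    have sq: "(f m)\<^sup>2 \<le> (L * t powr a) * cosh (real_of_int m / sqrt t)" for m
    proof -
      let ?x = "\<bar>real_of_int m\<bar>" and ?c = "cosh (real_of_int m / sqrt t)"
      have "?x powr (2 * a) = (sqrt t powr (2 * a)) * (?x / sqrt t) powr (2 * a)"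
        using t by (simp add: powr_divide)
      also have "sqrt t powr (2 * a) = t powr a"
        using t by (simp add: powr_half_sqrt[symmetric] powr_powr)
      finally have x1: "?x powr (2 * a) = t powr a * (?x / sqrt t) powr (2 * a)" .
      have "(?x / sqrt t) powr (2 * a) \<le> E * exp (?x / sqrt t)"
        unfolding E_def using t a by (intro powr_le_exp) auto
      also have "\<dots> \<le> E * (2 * ?c)"
        by (intro mult_left_mono, cases "0 \<le> m") (simp_all add: cosh_def E_def)
      finally have x: "?x powr (2 * a) \<le> t powr a * (E * (2 * ?c))"
        unfolding x1 by (intro mult_left_mono) auto
      have one: "1 \<le> t powr a * ?c"
        using mult_mono[of 1 "t powr a" 1 ?c] t a cosh_real_ge_1[of "real_of_int m / sqrt t"]
        by (simp add: ge_one_powr_ge_zero)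
      have "(f m)\<^sup>2 \<le> (C * (1 + ?x powr a))\<^sup>2" using C[of m] by (metis abs_ge_zero power2_abs power_mono)
      also have "\<dots> \<le> C\<^sup>2 * (2 * (1 + ?x powr (2 * a)))"
      proof -
        have "(1 + y)\<^sup>2 \<le> 2 * (1 + y\<^sup>2)" for y :: real
          using sum_squares_ge_zero[of "1 - y" 0] by (simp add: power2_eq_square algebra_simps)
        moreover have "(?x powr a)\<^sup>2 = ?x powr (2 * a)" by (simp add: power2_eq_square flip: powr_add)
        ultimately show ?thesis unfolding power_mult_distrib by (metis mult_left_mono zero_le_power2)
      qed
      also have "\<dots> \<le> C\<^sup>2 * (2 * (t powr a * ?c + t powr a * (E * (2 * ?c))))"
        by (intro mult_left_mono add_mono x one) auto
      finally show ?thesis by (simp add: L_def algebra_simps)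
    qed
    have "heat t (\<lambda>m. (f m)\<^sup>2) n \<le> heat t (\<lambda>m. (L * t powr a) * cosh (real_of_int m / sqrt t)) n"
      using t sq exp_growth_cosh[of "1 / sqrt t"]
      by (intro heat_mono exp_growth_power2 eg exp_growth_cmult) auto
    also have "\<dots> = (L * t powr a) * heat t (\<lambda>m. cosh (real_of_int m / sqrt t)) n"
      using exp_tri_linear[OF exp_growth_cosh[of "1 / sqrt t"] exp_growth_const[of 0], of t "- 2 * t" t "L * t powr a" 0 n]
      by (simp add: heat_def)
    also have "\<dots> \<le> (L * t powr a) * (exp 2 * cosh (real_of_int n / sqrt t))"
      using L0 by (intro mult_left_mono heat_cosh_le t) auto
    finally have "(real i / t) ^ i * heat t (\<lambda>m. (f m)\<^sup>2) n \<le>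
        (real i / t) ^ i * ((L * t powr a) * (exp 2 * cosh (real_of_int n / sqrt t)))"
      using t by (intro mult_left_mono) auto
    also have "\<dots> = real i ^ i * L * exp 2 * t powr (a - real i) * cosh (real_of_int n / sqrt t)"
      using t by (simp add: powr_diff powr_realpow power_divide)
    finally show "((delta_right ^^ i) (heat t f) n)\<^sup>2 \<le> real i ^ i * L * exp 2 * t powr (a - real i) * cosh (real_of_int n / sqrt t)"
      using heat_gradient_pow[OF eg, of t i n] t by linarith
  qed
qed

text \<open>Here the growth condition is indispensable: the \<open>i\<close>-th difference of a
  polynomial of degree \<open>i\<close> is a constant, and the heat flow does not move it.\<close>
lemma heat_difference_tendsto_0:
  assumes f: "growth_order a f" and a: "0 < a" "a < real i"
  shows "((\<lambda>t. (delta_right ^^ i) (heat t f) n) \<longlongrightarrow> 0) at_top"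
proof -
  obtain K where K: "\<And>t n. 1 \<le> t \<Longrightarrow> ((delta_right ^^ i) (heat t f) n)\<^sup>2 \<le> K * t powr (a - real i) * cosh (real_of_int n / sqrt t)"
    using heat_difference_growth[OF f a(1)] by blast
  have K0: "0 \<le> K" using order_trans[OF zero_le_power2 K[of 1 0]] by simp
  have bd: "\<forall>\<^sub>F t in at_top. ((delta_right ^^ i) (heat t f) n)\<^sup>2 \<le> K * cosh (real_of_int n) * t powr (- (real i - a))"
    using eventually_ge_at_top[of 1]
  proof eventually_elim
    case (elim t)
    have "\<bar>real_of_int n / sqrt t\<bar> \<le> \<bar>real_of_int n\<bar>"
      using elim by (simp add: divide_le_eq mult_le_cancel_left1)
    then have "cosh (real_of_int n / sqrt t) \<le> cosh (real_of_int n)"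
      using cosh_real_nonneg_le_iff[of "\<bar>real_of_int n / sqrt t\<bar>" "\<bar>real_of_int n\<bar>"]
      by (simp only: cosh_real_abs abs_ge_zero)
    then have "K * t powr (a - real i) * cosh (real_of_int n / sqrt t) \<le> K * t powr (a - real i) * cosh (real_of_int n)"
      using K0 by (intro mult_left_mono) auto
    with K[OF elim, of n] show ?case by (simp add: mult_ac)
  qed
  have "((\<lambda>t. K * cosh (real_of_int n) * t powr (- (real i - a))) \<longlongrightarrow> K * cosh (real_of_int n) * 0) at_top"
    by (intro tendsto_mult_left tendsto_neg_powr filterlim_ident) (use a in auto)
  then have "((\<lambda>t. ((delta_right ^^ i) (heat t f) n)\<^sup>2) \<longlongrightarrow> 0) at_top"
    by (intro tendsto_sandwich[OF _ bd tendsto_const]) (auto intro: always_eventually)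
  then have "((\<lambda>t. sqrt (((delta_right ^^ i) (heat t f) n)\<^sup>2)) \<longlongrightarrow> sqrt 0) at_top"
    by (rule tendsto_real_sqrt)
  then show ?thesis by (simp add: tendsto_rabs_zero_iff)
qed

section \<open>Recovering a function from a power bound on its derivative\<close>

lemma upper_bound_from_derivative_at_top:
  fixes \<phi> \<phi>' :: "real \<Rightarrow> real"
  assumes d: "\<And>t. 0 < t \<Longrightarrow> (\<phi> has_real_derivative \<phi>' t) (at t)"
    and b: "\<And>t. 0 < t \<Longrightarrow> - (C * t powr (- e)) \<le> \<phi>' t"
    and e: "1 < e" and lim: "(\<phi> \<longlongrightarrow> 0) at_top" and t: "0 < t"
  shows "\<phi> t \<le> C / (e - 1) * t powr (1 - e)"
proof -
  define \<psi> where "\<psi> s = \<phi> s - C / (e - 1) * s powr (1 - e)" for s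
  have dx: "(\<psi> has_real_derivative \<phi>' s + C * s powr (- e)) (at s)" if "0 < s" for s
  proof -
    have "(\<psi> has_real_derivative \<phi>' s - C / (e - 1) * ((1 - e) * s powr (1 - e - 1))) (at s)"
      unfolding \<psi>_def by (intro DERIV_diff DERIV_cmult d that has_real_derivative_powr)
    moreover have "C / (e - 1) * (1 - e) = - C" using e by (simp add: field_simps)
    then have "C / (e - 1) * ((1 - e) * s powr (1 - e - 1)) = - (C * s powr (- e))"
      unfolding mult.assoc[symmetric] by simp
    ultimately show ?thesis by simp
  qed
  have inc: "\<psi> t \<le> \<psi> s" if "t \<le> s" for s
  proof (rule DERIV_nonneg_imp_nondecreasing[OF that])
    fix x assume "t \<le> x"
    then have "0 < x" using t by simp
    then show "\<exists>y. DERIV \<psi> x :> y \<and> 0 \<le> y"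
      using b[of x] dx by (intro exI[of _ "\<phi>' x + C * x powr (- e)"]) simp
  qed
  have "(\<psi> \<longlongrightarrow> 0 - C / (e - 1) * 0) at_top"
    unfolding \<psi>_def using e tendsto_neg_powr[of "1 - e" "\<lambda>s. s" at_top]
    by (intro tendsto_intros lim) (auto simp: filterlim_ident)
  then have "(\<psi> \<longlongrightarrow> 0) at_top" by simp
  then have "\<psi> t \<le> 0"
    by (rule tendsto_lowerbound) (use inc in \<open>auto intro: eventually_mono[OF eventually_ge_at_top[of t]]\<close>)
  then show ?thesis by (simp add: \<psi>_def)
qed

text \<open>Integration from infinity; the constant is that of the integral of
  \<open>t\<^sup>-\<^sup>e\<close>.\<close>
lemma decay_from_derivative:
  fixes \<phi> \<phi>' :: "real \<Rightarrow> real"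
  assumes d: "\<And>t. 0 < t \<Longrightarrow> (\<phi> has_real_derivative \<phi>' t) (at t)"
    and b: "\<And>t. 0 < t \<Longrightarrow> \<bar>\<phi>' t\<bar> \<le> C * t powr (- e)"
    and e: "1 < e" and lim: "(\<phi> \<longlongrightarrow> 0) at_top" and t: "0 < t"
  shows "\<bar>\<phi> t\<bar> \<le> C / (e - 1) * t powr (1 - e)"
proof -
  have "\<phi> t \<le> C / (e - 1) * t powr (1 - e)"
    by (rule upper_bound_from_derivative_at_top[OF d _ e lim t]) (use b in \<open>auto simp: abs_le_iff minus_le_iff\<close>)
  moreover have "- \<phi> t \<le> C / (e - 1) * t powr (1 - e)"
    by (rule upper_bound_from_derivative_at_top[of "\<lambda>t. - \<phi> t" "\<lambda>t. - \<phi>' t", OF DERIV_minus[OF d] _ e _ t])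
       (use b tendsto_minus[OF lim] in \<open>auto simp: abs_le_iff\<close>)
  ultimately show ?thesis by linarith
qed

lemma upper_bound_from_derivative_at_0:
  fixes \<phi> \<phi>' :: "real \<Rightarrow> real"
  assumes d: "\<And>t. 0 < t \<Longrightarrow> (\<phi> has_real_derivative \<phi>' t) (at t)"
    and b: "\<And>t. 0 < t \<Longrightarrow> \<phi>' t \<le> C * t powr (e - 1)"
    and e: "0 < e" and lim: "isCont \<phi> 0" and t: "0 < t"
  shows "\<phi> t - \<phi> 0 \<le> C / e * t powr e"
proof -
  define \<psi> where "\<psi> s = \<phi> s - C / e * s powr e" for s
  have dx: "(\<psi> has_real_derivative \<phi>' s - C * s powr (e - 1)) (at s)" if "0 < s" for s
    unfolding \<psi>_def using that e
    by (auto intro!: derivative_eq_intros d simp: field_simps)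
  have dec: "\<psi> t \<le> \<psi> s" if "0 < s" "s \<le> t" for s
  proof (rule DERIV_nonpos_imp_nonincreasing[OF that(2)])
    fix x assume "s \<le> x"
    then have "0 < x" using that by simp
    then show "\<exists>y. DERIV \<psi> x :> y \<and> y \<le> 0" using b[of x] dx by (intro exI[of _ "\<phi>' x - C * x powr (e - 1)"]) simp
  qed
  have "(\<psi> \<longlongrightarrow> \<phi> 0 - C / e * 0) (at_right 0)"
    unfolding \<psi>_def
  proof (intro tendsto_intros)
    show "(\<phi> \<longlongrightarrow> \<phi> 0) (at_right 0)"
      using lim unfolding isCont_def by (rule filterlim_mono) (auto simp: at_within_le_at)
    show "((\<lambda>s::real. s powr e) \<longlongrightarrow> 0) (at_right 0)"
      by (rule tendsto_zero_powrI[OF tendsto_ident_at tendsto_const _ e])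
         (rule eventually_mono[OF eventually_at_right_less less_imp_le])
  qed
  then have "\<psi> t \<le> \<phi> 0"
    using tendsto_lowerbound[of \<psi> "\<phi> 0" "at_right 0" "\<psi> t"] dec eventually_at_right_less[of "0::real"]
      eventually_at_rightI[of 0 t "\<lambda>s. \<psi> t \<le> \<psi> s"] t by force
  then show ?thesis by (simp add: \<psi>_def)
qed

text \<open>Integration from \<open>0\<close>. The derivative may blow up there, so only continuity
  is available at the left end.\<close>
lemma growth_from_derivative:
  fixes \<phi> \<phi>' :: "real \<Rightarrow> real"
  assumes d: "\<And>t. 0 < t \<Longrightarrow> (\<phi> has_real_derivative \<phi>' t) (at t)"
    and b: "\<And>t. 0 < t \<Longrightarrow> \<bar>\<phi>' t\<bar> \<le> C * t powr (e - 1)"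
    and e: "0 < e" and lim: "isCont \<phi> 0" and t: "0 < t"
  shows "\<bar>\<phi> t - \<phi> 0\<bar> \<le> C / e * t powr e"
proof -
  have "\<phi> t - \<phi> 0 \<le> C / e * t powr e"
    by (rule upper_bound_from_derivative_at_0[OF d _ e lim t]) (use b in \<open>auto simp: abs_le_iff\<close>)
  moreover have "- \<phi> t - - \<phi> 0 \<le> C / e * t powr e"
    by (rule upper_bound_from_derivative_at_0[of "\<lambda>t. - \<phi> t" "\<lambda>t. - \<phi>' t", OF DERIV_minus[OF d] _ e _ t])
       (use b lim in \<open>auto simp: abs_le_iff\<close>)
  ultimately show ?thesis by linarith
qed

section \<open>Decay of the differences of the heat semigroup\<close>

text \<open>Two differences count as one time derivative, which explains the exponent. If \<open>f\<close> has growth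
  order \<open>a\<close>, the condition is the same for all \<open>i > a\<close>, by \<open>heat_decay_all_orders\<close>.\<close>
definition heat_decay :: "real \<Rightarrow> nat \<Rightarrow> (int \<Rightarrow> real) \<Rightarrow> bool" where
  "heat_decay a i f \<longleftrightarrow> (\<exists>C. \<forall>t>0. \<forall>n. \<bar>(delta_right ^^ i) (heat t f) n\<bar> \<le> C * t powr ((a - real i) / 2))"

lemma lap_eq_delta: "lap g n = (delta_right ^^ 2) g (n - 1)"
  by (simp add: delta_right_eq_tri tri_def eval_nat_numeral algebra_simps)

text \<open>This turns time derivatives of the heat semigroup into differences of even
  order.\<close>
lemma lap_pow_eq_delta: "(lap ^^ K) f n = (delta_right ^^ (2 * K)) f (n - int K)"
proof (induction K arbitrary: n)
  case (Suc K)
  have "(lap ^^ K) f = (\<lambda>m. (delta_right ^^ (2 * K)) f (m - int K))"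
    by (rule ext) (rule Suc)
  then have "(lap ^^ Suc K) f n = lap (\<lambda>m. (delta_right ^^ (2 * K)) f (m - int K)) n"
    by (simp only: funpow.simps o_def)
  also have "\<dots> = lap ((delta_right ^^ (2 * K)) f) (n - int K)" by (simp add: tri_def algebra_simps)
  also have "\<dots> = (delta_right ^^ (2 * Suc K)) f (n - int (Suc K))"
    by (simp add: lap_eq_delta eval_nat_numeral algebra_simps)
  finally show ?case .
qed simp

lemma heat_eq_ext: "exp_growth f \<Longrightarrow> heat (s + t) f = heat s (heat t f)"
  by (rule ext) (rule heat_add)

lemma delta_right_pow_heat_ext:
  "exp_growth f \<Longrightarrow> (delta_right ^^ j) (heat t f) = heat t ((delta_right ^^ j) f)"
  by (rule ext) (rule delta_right_pow_heat)

text \<open>One half of the time gives the decay, the other half smooths.\<close>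
lemma heat_decay_Suc:
  assumes f: "exp_growth f" and dec: "heat_decay a i f"
  shows "heat_decay a (Suc i) f"
proof -
  obtain C where C: "\<And>t n. 0 < t \<Longrightarrow> \<bar>(delta_right ^^ i) (heat t f) n\<bar> \<le> C * t powr ((a - real i) / 2)"
    using dec unfolding heat_decay_def by blast
  show ?thesis unfolding heat_decay_def
  proof (intro exI[of _ "C * (1 / 2) powr ((a - real (Suc i)) / 2)"] allI impI)
    fix t :: real and n assume t: "0 < t"
    let ?g = "(delta_right ^^ i) (heat (t / 2) f)"
    have "(delta_right ^^ Suc i) (heat t f) n = delta_right ((delta_right ^^ i) (heat (t / 2) (heat (t / 2) f))) n"
      using heat_eq_ext[OF f, of "t / 2" "t / 2"] by simp
    also have "\<dots> = (delta_right ^^ 1) (heat (t / 2) ?g) n"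
      by (simp add: delta_right_pow_heat_ext[OF exp_growth_heat[OF f]])
    finally have "\<bar>(delta_right ^^ Suc i) (heat t f) n\<bar> \<le> sqrt (real 1 ^ 1) * (C * (t / 2) powr ((a - real i) / 2)) * (t / 2) powr (- real 1 / 2)"
      using heat_smoothing[of ?g "C * (t / 2) powr ((a - real i) / 2)" "t / 2" 1 n] C[of "t / 2"] t by simp
    also have "\<dots> = C * (t / 2) powr ((a - real (Suc i)) / 2)"
    proof -
      have "(a - real i) / 2 + - real 1 / 2 = (a - real (Suc i)) / 2" by (simp add: field_simps)
      then show ?thesis by (simp only: mult.assoc powr_add[symmetric]) simp
    qed
    also have "\<dots> = C * (1 / 2) powr ((a - real (Suc i)) / 2) * t powr ((a - real (Suc i)) / 2)"
      using t by (simp add: powr_divide)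
    finally show "\<bar>(delta_right ^^ Suc i) (heat t f) n\<bar> \<le> C * (1 / 2) powr ((a - real (Suc i)) / 2) * t powr ((a - real (Suc i)) / 2)" .
  qed
qed

lemma heat_difference_has_derivative:
  assumes f: "exp_growth f"
  shows "((\<lambda>t. (delta_right ^^ i) (heat t f) n) has_real_derivative (delta_right ^^ (i + 2)) (heat t f) (n - 1)) (at t)"
proof -
  have eg: "exp_growth ((delta_right ^^ i) f)" by (rule exp_growth_delta_right_pow[OF f])
  have "((\<lambda>t. heat t ((delta_right ^^ i) f) n) has_real_derivative heat t (lap ((delta_right ^^ i) f)) n) (at t)"
    by (rule heat_has_derivative[OF eg])
  moreover have "heat t (lap ((delta_right ^^ i) f)) n = lap ((delta_right ^^ i) (heat t f)) n"
    using heat_tri_pow[OF eg, of 1 1 "- 2" 1 t n] by (simp add: delta_right_pow_heat_ext[OF f])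
  moreover have "lap ((delta_right ^^ i) (heat t f)) n = (delta_right ^^ (i + 2)) (heat t f) (n - 1)"
    unfolding lap_eq_delta by (simp add: eval_nat_numeral)
  ultimately show ?thesis by (simp add: delta_right_pow_heat_ext[OF f])
qed

text \<open>The time derivative is a difference of order \<open>i + 2\<close>, which decays like a
  power below \<open>-1\<close>; it is integrated from infinity.\<close>
lemma heat_decay_descend:
  assumes f: "growth_order a f" and a: "0 < a" "a < real i" and dec: "heat_decay a (i + 2) f"
  shows "heat_decay a i f"
proof -
  have eg: "exp_growth f" by (rule growth_order_exp_growth[OF f a(1)])
  obtain C where C: "\<And>t n. 0 < t \<Longrightarrow> \<bar>(delta_right ^^ (i + 2)) (heat t f) n\<bar> \<le> C * t powr ((a - real (i + 2)) / 2)"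
    using dec unfolding heat_decay_def by blast
  define e where "e = (real (i + 2) - a) / 2"
  have e: "1 < e" using a by (simp add: e_def)
  have "\<bar>(delta_right ^^ i) (heat t f) n\<bar> \<le> C / (e - 1) * t powr (1 - e)" if "0 < t" for t n
  proof (rule decay_from_derivative[OF heat_difference_has_derivative[OF eg] _ e heat_difference_tendsto_0[OF f a] that])
    fix t :: real assume "0 < t"
    from C[OF this, of "n - 1"] show "\<bar>(delta_right ^^ (i + 2)) (heat t f) (n - 1)\<bar> \<le> C * t powr (- e)"
      by (simp add: e_def minus_divide_left)
  qed
  moreover have "1 - e = (a - real i) / 2" by (simp add: e_def field_simps)
  ultimately show ?thesis unfolding heat_decay_def by (intro exI[of _ "C / (e - 1)"]) simp
qed

text \<open>Orders can be raised by one and lowered by two, so every order above \<open>a\<close> is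
  reached from one with the right parity.\<close>
lemma heat_decay_all_orders:
  assumes f: "growth_order a f" and a: "0 < a" "a < real i" and dec: "heat_decay a j f"
  shows "heat_decay a i f"
proof -
  have eg: "exp_growth f" by (rule growth_order_exp_growth[OF f a(1)])
  have up: "heat_decay a (j + m) f" for m
    by (induction m) (auto intro: dec heat_decay_Suc[OF eg])
  have down: "heat_decay a (i + 2 * m) f \<Longrightarrow> heat_decay a i f" for m
  proof (induction m)
    case (Suc m)
    have "heat_decay a (i + 2 * m) f"
      by (rule heat_decay_descend[OF f a(1)]) (use a Suc.prems in auto)
    then show ?case by (rule Suc.IH)
  qed simp
  have "heat_decay a (i + 2 * j) f" using up[of "i + j"] by (simp add: add_ac mult_2)
  then show ?thesis by (rule down)
qed

section \<open>From heat decay to differences of the function\<close>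

lemma lipschitz_of_delta_bound:
  assumes "\<And>n. \<bar>delta_right h n\<bar> \<le> B"
  shows "\<bar>h n - h m\<bar> \<le> \<bar>real_of_int (n - m)\<bar> * B"
proof -
  have *: "\<bar>h (m + int k) - h m\<bar> \<le> real k * B" for m k
  proof (induction k)
    case (Suc k)
    have "\<bar>h (m + int (Suc k)) - h (m + int k)\<bar> \<le> B"
      using assms[of "m + int k"] by (simp add: delta_right_def abs_minus_commute add_ac)
    with Suc show ?case by (simp add: algebra_simps)
  qed simp
  show ?thesis
  proof (cases "m \<le> n")
    case True
    then show ?thesis using *[of m "nat (n - m)"] by simp
  next
    case False
    then show ?thesis using *[of n "nat (m - n)"] by (simp add: abs_minus_commute)
  qed
qed

lemma second_difference_of_delta2_bound:
  assumes "\<And>n. \<bar>(delta_right ^^ 2) h n\<bar> \<le> B"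
  shows "\<bar>h (m + n) + h (m - n) - 2 * h m\<bar> \<le> (real_of_int n)\<^sup>2 * B"
proof -
  define e where "e i = h (i + n) - h i" for i
  have "\<bar>delta_right h (i + n) - delta_right h i\<bar> \<le> \<bar>real_of_int (i + n - i)\<bar> * B" for i
    by (rule lipschitz_of_delta_bound) (use assms in \<open>simp add: eval_nat_numeral\<close>)
  note Dh = this
  have "\<bar>delta_right e i\<bar> \<le> \<bar>real_of_int n\<bar> * B" for i
  proof -
    have "delta_right e i = delta_right h (i + n) - delta_right h i"
      by (simp add: e_def delta_right_def add_ac)
    with Dh[of i] show ?thesis by simp
  qed
  from lipschitz_of_delta_bound[OF this, of m "m - n"]
  show ?thesis by (simp add: e_def algebra_simps power2_eq_square flip: abs_mult)
qed

text \<open>The order \<open>a = k + b\<close> is split so that the exponent \<open>b\<close> is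
  carried by differences of \<open>g\<close>, the \<open>k\<close>-th difference of
  \<open>f\<close>. The time derivative of the heat flow of \<open>g\<close> is a difference of
  \<open>f\<close> of order \<open>k + 2\<close>, and by integration over \<open>[0, t]\<close> the
  flow stays within \<open>t\<^bsup>b / 2\<^esup>\<close> of \<open>g\<close>.\<close>
locale decaying_heat =
  fixes a b :: real and k :: nat and f :: "int \<Rightarrow> real"
  assumes a: "a = real k + b" and b: "0 < b"
    and f: "exp_growth f" and dec: "heat_decay a (k + 2) f"
begin

definition g where "g = (delta_right ^^ k) f"

lemma dist_heat: "\<exists>C\<ge>0. \<forall>t>0. \<forall>n. \<bar>heat t g n - g n\<bar> \<le> C * t powr (b / 2)"
proof -
  obtain C where C: "\<And>t n. 0 < t \<Longrightarrow> \<bar>(delta_right ^^ (k + 2)) (heat t f) n\<bar> \<le> C * t powr ((a - real (k + 2)) / 2)"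
    using dec unfolding heat_decay_def by blast
  have C0: "0 \<le> C" using order_trans[OF abs_ge_zero C[of 1 0]] by simp
  have e: "(a - real (k + 2)) / 2 = b / 2 - 1" by (simp add: a field_simps)
  have "\<bar>heat t g n - heat 0 g n\<bar> \<le> C / (b / 2) * t powr (b / 2)" if "0 < t" for t n
  proof (rule growth_from_derivative[OF _ _ _ _ that])
    show "((\<lambda>t. heat t g n) has_real_derivative (delta_right ^^ (k + 2)) (heat t f) (n - 1)) (at t)" for t
      using heat_difference_has_derivative[OF f, of k n t] by (simp add: g_def delta_right_pow_heat_ext[OF f])
    then show "isCont (\<lambda>t. heat t g n) 0" by (rule DERIV_isCont)
    show "\<bar>(delta_right ^^ (k + 2)) (heat t f) (n - 1)\<bar> \<le> C * t powr (b / 2 - 1)" if "0 < t" for t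
      using C[OF that] unfolding e .
  qed (use b in simp)
  then show ?thesis using C0 b by (intro exI[of _ "C / (b / 2)"]) auto
qed

text \<open>For step \<open>n\<close>, replace \<open>g\<close> by its heat flow at time
  \<open>n\<^sup>2\<close>: the error and the second difference of the flow are then both of order
  \<open>|n|\<^sup>b\<close>.\<close>
lemma second_difference: "\<exists>C\<ge>0. \<forall>m n. \<bar>g (m + n) + g (m - n) - 2 * g m\<bar> \<le> C * \<bar>real_of_int n\<bar> powr b"
proof -
  obtain C where C: "0 \<le> C" "\<And>t n. 0 < t \<Longrightarrow> \<bar>heat t g n - g n\<bar> \<le> C * t powr (b / 2)"
    using dist_heat by blast
  obtain D where D: "\<And>t n. 0 < t \<Longrightarrow> \<bar>(delta_right ^^ (k + 2)) (heat t f) n\<bar> \<le> D * t powr ((a - real (k + 2)) / 2)"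
    using dec unfolding heat_decay_def by blast
  have D0: "0 \<le> D" using order_trans[OF abs_ge_zero D[of 1 0]] by simp
  show ?thesis
  proof (intro exI[of _ "4 * C + D"] conjI allI)
    fix m n
    show "\<bar>g (m + n) + g (m - n) - 2 * g m\<bar> \<le> (4 * C + D) * \<bar>real_of_int n\<bar> powr b"
    proof (cases "n = 0")
      case False
      define x where "x = \<bar>real_of_int n\<bar>"
      define t where "t = x\<^sup>2"
      have x: "0 < x" and t: "0 < t" using False by (simp_all add: t_def x_def)
      have tp: "t powr y = x powr (2 * y)" for y
        using x by (simp add: t_def power2_eq_square powr_mult flip: powr_add)
      let ?h = "heat t g"
      have "\<bar>(delta_right ^^ 2) ?h i\<bar> \<le> D * t powr ((b - 2) / 2)" for i
        using D[OF t, of i] by (simp add: g_def a eval_nat_numeral flip: delta_right_pow_heat_ext[OF f])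
      from second_difference_of_delta2_bound[OF this, of m n]
      have "\<bar>?h (m + n) + ?h (m - n) - 2 * ?h m\<bar> \<le> t * (D * t powr ((b - 2) / 2))"
        by (simp add: t_def x_def)
      also have "\<dots> = D * t powr (b / 2)"
        using t by (simp add: diff_divide_distrib powr_diff)
      finally have "\<bar>g (m + n) + g (m - n) - 2 * g m\<bar> \<le> (4 * C + D) * t powr (b / 2)"
        using C(2)[OF t, of "m + n"] C(2)[OF t, of "m - n"] C(2)[OF t, of m]
        by (simp add: algebra_simps abs_le_iff)
      then show ?thesis by (simp add: tp x_def)
    qed simp
  qed (use C D0 in simp)
qed

lemma first_difference:
  assumes "heat_decay a (k + 1) f"
  shows "\<exists>C\<ge>0. \<forall>n m. \<bar>g n - g m\<bar> \<le> C * \<bar>real_of_int (n - m)\<bar> powr b"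
proof -
  obtain C where C: "0 \<le> C" "\<And>t n. 0 < t \<Longrightarrow> \<bar>heat t g n - g n\<bar> \<le> C * t powr (b / 2)"
    using dist_heat by blast
  obtain D where D: "\<And>t n. 0 < t \<Longrightarrow> \<bar>(delta_right ^^ (k + 1)) (heat t f) n\<bar> \<le> D * t powr ((a - real (k + 1)) / 2)"
    using assms unfolding heat_decay_def by blast
  have D0: "0 \<le> D" using order_trans[OF abs_ge_zero D[of 1 0]] by simp
  show ?thesis
  proof (intro exI[of _ "2 * C + D"] conjI allI)
    fix n m
    show "\<bar>g n - g m\<bar> \<le> (2 * C + D) * \<bar>real_of_int (n - m)\<bar> powr b"
    proof (cases "n = m")
      case False
      define x where "x = \<bar>real_of_int n - real_of_int m\<bar>"
      define t where "t = x\<^sup>2"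
      have x: "0 < x" and t: "0 < t" using False by (simp_all add: t_def x_def)
      have tp: "t powr y = x powr (2 * y)" for y
        using x by (simp add: t_def power2_eq_square powr_mult flip: powr_add)
      let ?h = "heat t g"
      have "\<bar>delta_right ?h i\<bar> \<le> D * t powr ((b - 1) / 2)" for i
        using D[OF t, of i] by (simp add: g_def a flip: delta_right_pow_heat_ext[OF f])
      from lipschitz_of_delta_bound[OF this, of n m]
      have "\<bar>?h n - ?h m\<bar> \<le> x * (D * x powr (b - 1))"
        by (simp add: x_def[symmetric] tp diff_divide_distrib)
      also have "\<dots> = D * t powr (b / 2)"
        using x by (simp add: powr_diff tp)
      finally have "\<bar>g n - g m\<bar> \<le> (2 * C + D) * t powr (b / 2)"
        using C(2)[OF t, of n] C(2)[OF t, of m]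
        by (simp add: algebra_simps abs_le_iff)
      then show ?thesis by (simp add: tp x_def)
    qed simp
  qed (use C D0 in simp)
qed

text \<open>At time \<open>n\<^sup>2\<close> the weight \<open>cosh (n / \<surd>t)\<close> in the
  growth estimate of the flow is bounded.\<close>
lemma growth_differences:
  assumes "growth_order a f"
  shows "growth_order b g"
proof -
  obtain C where C: "0 \<le> C" "\<And>t n. 0 < t \<Longrightarrow> \<bar>heat t g n - g n\<bar> \<le> C * t powr (b / 2)"
    using dist_heat by blast
  have a0: "0 < a" using a b by simp
  obtain K where K: "\<And>t n. 1 \<le> t \<Longrightarrow> ((delta_right ^^ k) (heat t f) n)\<^sup>2 \<le> K * t powr (a - real k) * cosh (real_of_int n / sqrt t)"
    using heat_difference_growth[OF assms a0, of k] by blast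
  have K0: "0 \<le> K" using order_trans[OF zero_le_power2 K[of 1 0]] by simp
  show ?thesis unfolding growth_order_def
  proof (intro exI[of _ "C + sqrt (K * cosh 1)"] allI)
    fix n
    define x where "x = max 1 \<bar>real_of_int n\<bar>"
    define t where "t = x\<^sup>2"
    have x: "1 \<le> x" by (simp add: x_def)
    have t: "1 \<le> t" "sqrt t = x" using x by (simp_all add: t_def)
    have tp: "t powr y = x powr (2 * y)" for y
      using x by (simp add: t_def power2_eq_square powr_mult flip: powr_add)
    have "\<bar>real_of_int n / sqrt t\<bar> \<le> 1" unfolding t(2) using x by (simp add: x_def divide_le_eq)
    then have "cosh (real_of_int n / sqrt t) \<le> cosh 1"
      using cosh_real_nonneg_le_iff[of "\<bar>real_of_int n / sqrt t\<bar>" 1]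
      by (simp only: cosh_real_abs abs_ge_zero zero_le_one)
    then have "K * t powr b * cosh (real_of_int n / sqrt t) \<le> K * t powr b * cosh 1"
      using K0 by (intro mult_left_mono) auto
    then have "(heat t g n)\<^sup>2 \<le> K * t powr b * cosh 1"
      using K[OF t(1), of n] by (simp add: a g_def delta_right_pow_heat_ext[OF f])
    also have "\<dots> = (sqrt (K * cosh 1) * x powr b)\<^sup>2"
      using K0 by (simp add: power_mult_distrib tp) (simp add: power2_eq_square flip: powr_add)
    finally have "\<bar>heat t g n\<bar> \<le> sqrt (K * cosh 1) * x powr b"
      using K0 by (subst (asm) abs_le_square_iff[symmetric]) (auto simp: abs_mult)
    moreover have "\<bar>heat t g n - g n\<bar> \<le> C * x powr b" using C(2)[of t n] t by (simp add: tp)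
    ultimately have "\<bar>g n\<bar> \<le> (C + sqrt (K * cosh 1)) * x powr b" by (simp add: algebra_simps abs_le_iff)
    also have "\<dots> \<le> (C + sqrt (K * cosh 1)) * (1 + \<bar>real_of_int n\<bar> powr b)"
      by (intro mult_left_mono) (use C K0 in \<open>auto simp: x_def max_def\<close>)
    finally show "\<bar>g n\<bar> \<le> (C + sqrt (K * cosh 1)) * (1 + \<bar>real_of_int n\<bar> powr b)" .
  qed
qed

end

section \<open>From differences of the function to heat decay\<close>

text \<open>The convolution with the Fejer kernel of width \<open>R\<close>. The kernel is
  symmetric, so the distance to \<open>g\<close> involves only second differences; and being a
  product of two one-sided averages, it telescopes under two differences.\<close>
definition tent_average :: "nat \<Rightarrow> (int \<Rightarrow> real) \<Rightarrow> int \<Rightarrow> real" where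
  "tent_average R g n = (\<Sum>a<R. \<Sum>b<R. g (n + int a - int b)) / (real R)\<^sup>2"

lemma tent_average_close:
  assumes g: "\<And>m n. \<bar>g (m + n) + g (m - n) - 2 * g m\<bar> \<le> C * \<bar>real_of_int n\<bar> powr b"
    and C: "0 \<le> C" and b: "0 < b" and R: "0 < R"
  shows "\<bar>tent_average R g n - g n\<bar> \<le> C * real R powr b"
proof -
  let ?S = "\<Sum>a<R. \<Sum>b<R. g (n + int a - int b)"
  let ?d = "\<lambda>a b. g (n + (int a - int b)) + g (n - (int a - int b)) - 2 * g n"
  have "?S = (\<Sum>b<R. \<Sum>a<R. g (n + int a - int b))" by (rule sum.swap)
  then have "2 * ?S - 2 * ((real R)\<^sup>2 * g n) = (\<Sum>a<R. \<Sum>b<R. ?d a b)"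
    by (simp add: sum.distrib sum_subtractf power2_eq_square algebra_simps)
  also have "\<bar>\<dots>\<bar> \<le> (\<Sum>i<R. \<bar>\<Sum>j<R. ?d i j\<bar>)" by (rule sum_abs)
  also have "\<dots> \<le> (\<Sum>i<R. \<Sum>j<R. \<bar>?d i j\<bar>)" by (intro sum_mono sum_abs)
  also have "\<dots> \<le> (\<Sum>i<R. \<Sum>j<R. C * real R powr b)"
  proof (intro sum_mono)
    fix i j assume "i \<in> {..<R}" "j \<in> {..<R}"
    then have "\<bar>real_of_int (int i - int j)\<bar> powr b \<le> real R powr b"
      using b by (intro powr_mono2) auto
    from mult_left_mono[OF this C] g[of n "int i - int j"]
    show "\<bar>?d i j\<bar> \<le> C * real R powr b" by linarith
  qed
  finally have "\<bar>2 * ?S - 2 * ((real R)\<^sup>2 * g n)\<bar> \<le> (real R)\<^sup>2 * (C * real R powr b)"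
    by (simp add: power2_eq_square)
  also have "\<dots> \<le> (real R)\<^sup>2 * (2 * (C * real R powr b))"
    using C by (intro mult_left_mono) auto
  finally have "\<bar>?S - (real R)\<^sup>2 * g n\<bar> \<le> (real R)\<^sup>2 * (C * real R powr b)" by (simp add: abs_le_iff)
  then have "\<bar>?S - (real R)\<^sup>2 * g n\<bar> / (real R)\<^sup>2 \<le> C * real R powr b"
    using R by (simp add: divide_le_eq mult_ac)
  moreover have "tent_average R g n - g n = (?S - (real R)\<^sup>2 * g n) / (real R)\<^sup>2"
    using R by (simp add: tent_average_def diff_divide_distrib)
  ultimately show ?thesis by (simp add: abs_divide)
qed

lemma delta2_tent_average:
  "(delta_right ^^ 2) (tent_average R g) n =
    (g (n + 1 + int R) + g (n + 1 - int R) - 2 * g (n + 1)) / (real R)\<^sup>2"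
proof -
  define k where "k x = g x - g (x + int R)" for x
  have 1: "delta_right (tent_average R g) = (\<lambda>n. (\<Sum>b<R. k (n - int b)) / (real R)\<^sup>2)"
  proof
    fix n
    have "(\<Sum>a<R. g (n + int a - int b) - g (n + 1 + int a - int b)) = k (n - int b)" for b
      using sum_lessThan_telescope'[of "\<lambda>a. g (n + int a - int b)" R] by (simp add: k_def algebra_simps)
    then have "(\<Sum>b<R. k (n - int b)) = (\<Sum>b<R. \<Sum>a<R. g (n + int a - int b) - g (n + 1 + int a - int b))"
      by simp
    also have "\<dots> = (\<Sum>a<R. \<Sum>b<R. g (n + int a - int b) - g (n + 1 + int a - int b))"
      by (rule sum.swap)
    finally show "delta_right (tent_average R g) n = (\<Sum>b<R. k (n - int b)) / (real R)\<^sup>2"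
      by (simp add: delta_right_def tent_average_def diff_divide_distrib sum_subtractf)
  qed
  have "(delta_right ^^ 2) (tent_average R g) n = (\<Sum>b<R. k (n - int b) - k (n + 1 - int b)) / (real R)\<^sup>2"
    by (simp add: eval_nat_numeral 1 delta_right_def[of "\<lambda>n. _ n / _"] sum_subtractf diff_divide_distrib)
  also have "(\<Sum>b<R. k (n - int b) - k (n + 1 - int b)) = k (n + 1 - int R) - k (n + 1)"
    using sum_lessThan_telescope[of "\<lambda>b. k (n + 1 - int b)" R] by (simp add: algebra_simps)
  also have "\<dots> = g (n + 1 + int R) + g (n + 1 - int R) - 2 * g (n + 1)"
    by (simp add: k_def)
  finally show ?thesis .
qed

text \<open>With \<open>R\<close> about \<open>\<surd>t\<close>, the error \<open>g - tent_average R
  g\<close> is bounded by \<open>R\<^sup>b\<close> and is smoothed by the heat flow, while the tent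
  average already has second differences of order \<open>R\<^bsup>b - 2\<^esup>\<close>. For
  \<open>t \<le> 1\<close> the second differences of \<open>g\<close> itself are good
  enough.\<close>
lemma heat_decay_of_second_difference:
  assumes g: "\<And>m n. \<bar>g (m + n) + g (m - n) - 2 * g m\<bar> \<le> C * \<bar>real_of_int n\<bar> powr b"
    and b: "0 < b" "b \<le> 2" and eg: "exp_growth g"
  shows "heat_decay b 2 g"
proof -
  have C: "0 \<le> C" using order_trans[OF abs_ge_zero g[of 0 1]] by simp
  have D2: "\<bar>(delta_right ^^ 2) g n\<bar> \<le> C" for n
    using g[of "n + 1" 1] by (simp add: eval_nat_numeral delta_right_def algebra_simps)
  show ?thesis unfolding heat_decay_def
  proof (intro exI[of _ "9 * C"] allI impI)
    fix t :: real and n assume t: "0 < t"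
    show "\<bar>(delta_right ^^ 2) (heat t g) n\<bar> \<le> 9 * C * t powr ((b - real 2) / 2)"
    proof (cases "t \<le> 1")
      case True
      have "\<bar>(delta_right ^^ 2) (heat t g) n\<bar> \<le> C"
        using heat_smoothing[of "(delta_right ^^ 2) g" C t 0 n] D2 t
        by (simp add: delta_right_pow_heat[OF eg])
      also have "C = C * 1" by simp
      also have "\<dots> \<le> C * t powr ((b - real 2) / 2)"
        using powr_mono'[of "(b - real 2) / 2" 0 t] True t b C by (intro mult_left_mono) auto
      also have "\<dots> \<le> 9 * C * t powr ((b - real 2) / 2)"
        using C by (intro mult_right_mono) auto
      finally show ?thesis .
    next
      case False
      define R where "R = nat \<lceil>sqrt t\<rceil>"
      have st: "1 \<le> sqrt t" using False by simp
      have R: "sqrt t \<le> real R" "real R \<le> 2 * sqrt t" "0 < R"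
      proof -
        have "real R = of_int \<lceil>sqrt t\<rceil>" using st by (simp add: R_def)
        then show "sqrt t \<le> real R" "real R \<le> 2 * sqrt t" "0 < R"
          using st ceiling_correct[of "sqrt t"] by linarith+
      qed
      let ?h = "tent_average R g"
      have c: "\<bar>g m - ?h m\<bar> \<le> C * real R powr b" for m
        using tent_average_close[OF g C b(1) R(3), of m] by (simp add: abs_minus_commute)
      have egd: "exp_growth (\<lambda>m. g m - ?h m)" by (rule exp_growth_bounded[OF c])
      have egh: "exp_growth ?h" using exp_growth_diff[OF eg egd] by simp
      have h2: "\<bar>(delta_right ^^ 2) ?h m\<bar> \<le> C * real R powr (b - 2)" for m
        using g[of "m + 1" "int R"] R(3)
        by (simp add: delta2_tent_average abs_divide powr_diff divide_right_mono)
      have sp: "sqrt t powr x = t powr (x / 2)" for x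
        using t by (simp add: powr_half_sqrt[symmetric] powr_powr)
      have "(delta_right ^^ 2) (heat t g) n
        = (delta_right ^^ 2) (heat t (\<lambda>m. g m - ?h m)) n + heat t ((delta_right ^^ 2) ?h) n"
        using tri_pow_linear[of 2 0 1 "- 1" 1 g "- 1" ?h] exp_growth_delta_right_pow[OF eg] exp_growth_delta_right_pow[OF egh]
        by (simp add: delta_right_pow_heat[OF eg] delta_right_pow_heat[OF egd] heat_diff flip: delta_right_eq_tri)
      also have "\<bar>\<dots>\<bar> \<le> 2 * (C * real R powr b) * t powr (- 1) + C * real R powr (b - 2)"
        using heat_smoothing[of "\<lambda>m. g m - ?h m" "C * real R powr b" t 2 n, OF c t]
          heat_smoothing[of "(delta_right ^^ 2) ?h" "C * real R powr (b - 2)" t 0 n, OF h2 t]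
        using t by (intro order_trans[OF abs_triangle_ineq add_mono]) (simp_all)
      also have "\<dots> \<le> 2 * (C * (4 * t powr (b / 2))) * t powr (- 1) + C * t powr ((b - 2) / 2)"
      proof (intro add_mono mult_left_mono mult_right_mono)
        have "real R powr b \<le> (2 * sqrt t) powr b" using R b by (intro powr_mono2) auto
        also have "\<dots> = 2 powr b * t powr (b / 2)" using t by (simp add: powr_mult sp)
        also have "2 powr b \<le> 2 powr (2::real)" using b by (intro powr_mono) auto
        finally show "real R powr b \<le> 4 * t powr (b / 2)" by (simp add: mult_right_mono)
        have "real R powr (b - 2) \<le> sqrt t powr (b - 2)"
          using R b t by (intro powr_mono2') auto
        then show "real R powr (b - 2) \<le> t powr ((b - 2) / 2)" by (simp add: sp)
      qed (use C in auto)
      also have "t powr (b / 2) * t powr (- 1) = t powr ((b - 2) / 2)"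
        unfolding powr_add[symmetric] by (simp add: diff_divide_distrib)
      then have "2 * (C * (4 * t powr (b / 2))) * t powr (- 1) + C * t powr ((b - 2) / 2) = 9 * C * t powr ((b - real 2) / 2)"
        by (simp only: mult.assoc of_nat_numeral)
      finally show ?thesis .
    qed
  qed
qed

section \<open>Growth from growth of differences\<close>

lemma difference_bound_segment:
  assumes "\<And>i. m \<le> i \<Longrightarrow> i < m + int k \<Longrightarrow> \<bar>delta_right h i\<bar> \<le> B"
  shows "\<bar>h (m + int k) - h m\<bar> \<le> real k * B"
  using assms
proof (induction k)
  case (Suc k)
  have "\<bar>h (m + int (Suc k)) - h (m + int k)\<bar> \<le> B"
    using Suc.prems[of "m + int k"] by (simp add: delta_right_def abs_minus_commute add_ac)
  moreover have "\<bar>h (m + int k) - h m\<bar> \<le> real k * B"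
    by (rule Suc.IH) (use Suc.prems in auto)
  ultimately show ?case by (simp add: algebra_simps)
qed simp

lemma growth_order_of_delta:
  assumes "growth_order b (delta_right h)" and b: "0 \<le> b"
  shows "growth_order (b + 1) h"
proof -
  obtain C where C: "\<And>n. \<bar>delta_right h n\<bar> \<le> C * (1 + \<bar>real_of_int n\<bar> powr b)"
    using assms(1) unfolding growth_order_def by blast
  have C0: "0 \<le> C" 
  proof -
    have "0 \<le> C * (1 + 0 powr b)" using order_trans[OF abs_ge_zero C[of 0]] by simp
    then show ?thesis by (simp split: if_splits add: zero_le_mult_iff)
  qed
  show ?thesis unfolding growth_order_def
  proof (intro exI[of _ "\<bar>h 0\<bar> + 2 * C"] allI)
    fix n
    let ?x = "\<bar>real_of_int n\<bar>"
    have B: "\<bar>delta_right h i\<bar> \<le> C * (1 + ?x powr b)" if "\<bar>i\<bar> \<le> \<bar>n\<bar>" for i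
    proof -
      have "\<bar>real_of_int i\<bar> powr b \<le> ?x powr b" using that b by (intro powr_mono2) linarith+
      then have "C * (1 + \<bar>real_of_int i\<bar> powr b) \<le> C * (1 + ?x powr b)" using C0 by (intro mult_left_mono) auto
      with C[of i] show ?thesis by linarith
    qed
    have "\<bar>h n - h 0\<bar> \<le> ?x * (C * (1 + ?x powr b))"
    proof (cases "0 \<le> n")
      case True
      then show ?thesis using difference_bound_segment[of 0 "nat n" h "C * (1 + ?x powr b)"] B by simp
    next
      case False
      then show ?thesis using difference_bound_segment[of n "nat (- n)" h "C * (1 + ?x powr b)"] B
        by (simp add: abs_minus_commute)
    qed
    moreover have "?x * (1 + ?x powr b) \<le> 2 * (1 + ?x powr (b + 1))"
    proof (cases "n = 0")
      case False
      then have x: "1 \<le> ?x" by linarith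
      then have "?x powr 1 \<le> ?x powr (b + 1)" using b by (intro powr_mono) auto
      moreover have "?x * ?x powr b = ?x powr (b + 1)" using x by (simp add: powr_add)
      ultimately show ?thesis using x by (simp add: distrib_left)
    qed simp
    from mult_left_mono[OF this C0] have "?x * (C * (1 + ?x powr b)) \<le> 2 * C * (1 + ?x powr (b + 1))"
      by (simp add: mult_ac)
    moreover have "\<bar>h 0\<bar> * 1 \<le> \<bar>h 0\<bar> * (1 + ?x powr (b + 1))" by (intro mult_left_mono) auto
    ultimately show "\<bar>h n\<bar> \<le> (\<bar>h 0\<bar> + 2 * C) * (1 + ?x powr (b + 1))"
      by (simp only: distrib_right) linarith
  qed
qed

lemma growth_order_of_delta_pow:
  assumes "growth_order b ((delta_right ^^ k) h)" and b: "0 \<le> b"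
  shows "growth_order (real k + b) h"
  using assms(1)
proof (induction k arbitrary: h)
  case (Suc k)
  have "growth_order (real k + b) (delta_right h)"
    by (rule Suc.IH) (use Suc.prems in \<open>simp only: funpow_Suc_right o_def\<close>)
  from growth_order_of_delta[OF this] b show ?case by (simp add: add_ac)
qed simp

section \<open>Hoelder and Zygmund conditions through heat decay\<close>

definition second_difference_order :: "real \<Rightarrow> (int \<Rightarrow> real) \<Rightarrow> bool" where
  "second_difference_order b g \<longleftrightarrow> (\<exists>C. \<forall>m n. \<bar>g (m + n) + g (m - n) - 2 * g m\<bar> \<le> C * \<bar>real_of_int n\<bar> powr b)"

definition holder_order :: "real \<Rightarrow> (int \<Rightarrow> real) \<Rightarrow> bool" where
  "holder_order b g \<longleftrightarrow> (\<exists>C. \<forall>n m. \<bar>g n - g m\<bar> \<le> C * \<bar>real_of_int (n - m)\<bar> powr b)"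

lemma heat_decay_of_second_difference_order:
  assumes f: "exp_growth f" and b: "0 < b" "b \<le> 2" and g: "second_difference_order b ((delta_right ^^ k) f)"
  shows "heat_decay (real k + b) (k + 2) f"
proof -
  have eg: "exp_growth ((delta_right ^^ k) f)" by (rule exp_growth_delta_right_pow[OF f])
  have "heat_decay b 2 ((delta_right ^^ k) f)"
    using g unfolding second_difference_order_def
    by (auto intro: heat_decay_of_second_difference[OF _ b eg])
  then obtain C where C: "\<And>t n. 0 < t \<Longrightarrow> \<bar>(delta_right ^^ 2) (heat t ((delta_right ^^ k) f)) n\<bar> \<le> C * t powr ((b - real 2) / 2)"
    unfolding heat_decay_def by blast
  have "(delta_right ^^ (k + 2)) (heat t f) n = (delta_right ^^ 2) (heat t ((delta_right ^^ k) f)) n" for t n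
    by (simp add: eval_nat_numeral flip: delta_right_pow_heat_ext[OF f])
  with C show ?thesis unfolding heat_decay_def by auto
qed

text \<open>One direction smooths the tent average decomposition, the other follows the heat flow
  back to time \<open>0\<close>.\<close>
lemma second_difference_order_iff_heat_decay:
  assumes f: "growth_order (real k + b) f" and b: "0 < b" "b < 2" and j: "real k + b < real j"
  shows "second_difference_order b ((delta_right ^^ k) f) \<longleftrightarrow> heat_decay (real k + b) j f"
proof
  have a: "0 < real k + b" "real k + b < real (k + 2)" using b by simp_all
  have eg: "exp_growth f" by (rule growth_order_exp_growth[OF f a(1)])
  show "heat_decay (real k + b) j f" if "second_difference_order b ((delta_right ^^ k) f)"
    by (rule heat_decay_all_orders[OF f a(1) j heat_decay_of_second_difference_order[OF eg b(1) _ that]])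
       (use b in simp)
  assume "heat_decay (real k + b) j f"
  then have dec: "heat_decay (real k + b) (k + 2) f" by (rule heat_decay_all_orders[OF f a])
  interpret decaying_heat "real k + b" b k f by unfold_locales (use b eg dec in auto)
  show "second_difference_order b ((delta_right ^^ k) f)"
    using second_difference unfolding second_difference_order_def g_def by blast
qed

lemma growth_order_of_holder_order:
  assumes "holder_order b g"
  shows "growth_order b g"
proof -
  obtain C where C: "\<And>n m. \<bar>g n - g m\<bar> \<le> C * \<bar>real_of_int (n - m)\<bar> powr b"
    using assms unfolding holder_order_def by blast
  show ?thesis unfolding growth_order_def
  proof (intro exI[of _ "\<bar>g 0\<bar> + \<bar>C\<bar>"] allI)
    fix n
    let ?y = "\<bar>real_of_int n\<bar> powr b"
    have "\<bar>g n - g 0\<bar> \<le> C * ?y" using C[of n 0] by simp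
    moreover have "C * ?y \<le> \<bar>C\<bar> * ?y" by (intro mult_right_mono) auto
    moreover have "0 \<le> \<bar>g 0\<bar> * ?y" by simp
    ultimately show "\<bar>g n\<bar> \<le> (\<bar>g 0\<bar> + \<bar>C\<bar>) * (1 + ?y)"
      unfolding distrib_left distrib_right mult_1_right by linarith
  qed
qed

text \<open>A Hoelder bound trivially bounds second differences, so only the converse needs first
  differences of the flow; these are available at order \<open>k + 1\<close> because \<open>b <
  1\<close>.\<close>
lemma holder_order_iff_heat_decay:
  assumes b: "0 < b" "b < 1" and j: "real k + b < real j"
  shows "holder_order b ((delta_right ^^ k) f) \<longleftrightarrow> growth_order (real k + b) f \<and> heat_decay (real k + b) j f"
proof safe
  assume h: "holder_order b ((delta_right ^^ k) f)"
  show gr: "growth_order (real k + b) f"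
    by (rule growth_order_of_delta_pow[OF growth_order_of_holder_order[OF h]]) (use b in simp)
  obtain C where C: "\<And>n m. \<bar>(delta_right ^^ k) f n - (delta_right ^^ k) f m\<bar> \<le> C * \<bar>real_of_int (n - m)\<bar> powr b"
    using h unfolding holder_order_def by blast
  have "second_difference_order b ((delta_right ^^ k) f)"
    unfolding second_difference_order_def
  proof (intro exI[of _ "2 * C"] allI)
    fix m n
    show "\<bar>(delta_right ^^ k) f (m + n) + (delta_right ^^ k) f (m - n) - 2 * (delta_right ^^ k) f m\<bar> \<le> 2 * C * \<bar>real_of_int n\<bar> powr b"
      using C[of "m + n" m] C[of "m - n" m] by simp
  qed
  then show "heat_decay (real k + b) j f"
    using second_difference_order_iff_heat_decay[OF gr b(1) _ j] b by simp
next
  assume gr: "growth_order (real k + b) f" and dec: "heat_decay (real k + b) j f"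
  have al: "0 < real k + b" "real k + b < real (k + 2)" "real k + b < real (k + 1)" using b by simp_all
  have eg: "exp_growth f" by (rule growth_order_exp_growth[OF gr al(1)])
  interpret decaying_heat "real k + b" b k f
    by unfold_locales (use b eg heat_decay_all_orders[OF gr al(1,2) dec] in auto)
  show "holder_order b ((delta_right ^^ k) f)"
    using first_difference[OF heat_decay_all_orders[OF gr al(1,3) dec]]
    unfolding holder_order_def g_def by blast
qed

text \<open>The growth of the \<open>k\<close>-th difference belongs to the Zygmund class only; on
  the side of the heat flow it is a consequence of the decay.\<close>
lemma zygmund_order_iff_heat_decay:
  assumes j: "real k + 1 < real j"
  shows "growth_order (real k + 1) f \<and> growth_order 1 ((delta_right ^^ k) f) \<and> second_difference_order 1 ((delta_right ^^ k) f)
    \<longleftrightarrow> growth_order (real k + 1) f \<and> heat_decay (real k + 1) j f"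
proof (cases "growth_order (real k + 1) f")
  case gr: True
  have eq: "second_difference_order 1 ((delta_right ^^ k) f) \<longleftrightarrow> heat_decay (real k + 1) j f"
    by (rule second_difference_order_iff_heat_decay[OF gr _ _ j]) auto
  have a: "0 < real k + 1" "real k + 1 < real (k + 2)" by simp_all
  have eg: "exp_growth f" by (rule growth_order_exp_growth[OF gr a(1)])
  have "growth_order 1 ((delta_right ^^ k) f)" if "heat_decay (real k + 1) j f"
  proof -
    interpret decaying_heat "real k + 1" 1 k f
      by unfold_locales (use eg heat_decay_all_orders[OF gr a that] in auto)
    show ?thesis using growth_differences[OF gr] by (simp add: g_def)
  qed
  then show ?thesis using eq by blast
qed simp

section \<open>The defining conditions of the spaces\<close>

lemma SUP_ennreal_le_iff:
  assumes "0 \<le> c"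
  shows "(SUP x\<in>A. ennreal (h x)) \<le> ennreal c \<longleftrightarrow> (\<forall>x\<in>A. h x \<le> c)"
  using assms by (auto simp: SUP_le_iff ennreal_le_iff)

lemma SUP_ennreal_finite_iff:
  "(SUP x\<in>A. ennreal (h x)) < \<infinity> \<longleftrightarrow> (\<exists>c\<ge>0. \<forall>x\<in>A. h x \<le> c)"
proof
  assume fin: "(SUP x\<in>A. ennreal (h x)) < \<infinity>"
  then have "(SUP x\<in>A. ennreal (h x)) \<le> ennreal (enn2real (SUP x\<in>A. ennreal (h x)))" by simp
  then show "\<exists>c\<ge>0. \<forall>x\<in>A. h x \<le> c"
    unfolding SUP_ennreal_le_iff[OF enn2real_nonneg] using enn2real_nonneg by blast
next
  assume "\<exists>c\<ge>0. \<forall>x\<in>A. h x \<le> c"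
  then obtain c where c: "0 \<le> c" "\<forall>x\<in>A. h x \<le> c" by blast
  then have "(SUP x\<in>A. ennreal (h x)) \<le> ennreal c" by (simp add: SUP_ennreal_le_iff)
  then show "(SUP x\<in>A. ennreal (h x)) < \<infinity>" by (simp add: order_le_less_trans)
qed

lemma sup_norm_le_iff: "0 \<le> c \<Longrightarrow> sup_norm h \<le> ennreal c \<longleftrightarrow> (\<forall>n. norm (h n) \<le> c)"
  unfolding sup_norm_def by (simp add: SUP_ennreal_le_iff)

lemma sup_norm_finite_iff: "sup_norm h < \<infinity> \<longleftrightarrow> (\<exists>c\<ge>0. \<forall>n. norm (h n) \<le> c)"
  unfolding sup_norm_def by (subst SUP_ennreal_finite_iff) simp

lemma sup_norm_growth_iff:
  "sup_norm (\<lambda>n. f n / (1 + \<bar>real_of_int n\<bar> powr a)) < \<infinity> \<longleftrightarrow> growth_order a f"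
proof -
  have pos: "0 < 1 + \<bar>real_of_int n\<bar> powr a" for n by (rule add_pos_nonneg) auto
  have "norm (f n / (1 + \<bar>real_of_int n\<bar> powr a)) \<le> c \<longleftrightarrow> \<bar>f n\<bar> \<le> c * (1 + \<bar>real_of_int n\<bar> powr a)" for n c
    using pos[of n] by (simp add: abs_of_pos pos_divide_le_eq)
  moreover have "0 \<le> c" if "\<And>n. \<bar>f n\<bar> \<le> c * (1 + \<bar>real_of_int n\<bar> powr a)" for c
    using order_trans[OF abs_ge_zero that[of 0]] pos[of 0] by (simp only: zero_le_mult_iff) linarith
  ultimately show ?thesis unfolding sup_norm_finite_iff growth_order_def by meson
qed

text \<open>Mixed differences of the same total order agree up to sign and shift, so all conditions
  below can be stated with right differences.\<close>
lemma delta_eq: "delta l s f = (\<lambda>n. (- 1) ^ s * (delta_right ^^ (l + s)) f (n - int s))"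
proof -
  have left: "(delta_left ^^ s) f = (\<lambda>n. (- 1) ^ s * (delta_right ^^ s) f (n - int s))" for s
  proof (induction s)
    case (Suc s)
    show ?case
      by (rule ext) (simp only: funpow.simps o_def Suc,
        simp add: delta_left_def delta_right_def[of "(delta_right ^^ s) f"] algebra_simps)
  qed simp
  have right: "(delta_right ^^ l) (\<lambda>n. c * h (n - int s)) = (\<lambda>n. c * (delta_right ^^ l) h (n - int s))" for c h
    by (induction l) (simp_all add: delta_right_def algebra_simps)
  show ?thesis unfolding delta_def left right by (simp add: funpow_add)
qed

lemma holder_space_iff:
  "f \<in> holder_space a \<longleftrightarrow> holder_order (frac a) ((delta_right ^^ nat \<lfloor>a\<rfloor>) f)"
proof -
  have eq1: "(SUP (n, m) \<in> {(n, m). n \<noteq> m}. ennreal (\<bar>delta l s f n - delta l s f m\<bar> / real_of_int \<bar>n - m\<bar> powr frac a)) < \<infinity>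
      \<longleftrightarrow> holder_order (frac a) (delta l s f)" for l s
  proof -
    have iff: "\<bar>delta l s f n - delta l s f m\<bar> / real_of_int \<bar>n - m\<bar> powr frac a \<le> c \<longleftrightarrow>
        \<bar>delta l s f n - delta l s f m\<bar> \<le> c * \<bar>real_of_int (n - m)\<bar> powr frac a" if "n \<noteq> m" for n m c
      using that by (simp add: divide_le_eq)
    have "(SUP (n, m) \<in> {(n, m). n \<noteq> m}. ennreal (\<bar>delta l s f n - delta l s f m\<bar> / real_of_int \<bar>n - m\<bar> powr frac a)) < \<infinity>
      \<longleftrightarrow> (\<exists>c\<ge>0. \<forall>n m. n \<noteq> m \<longrightarrow> \<bar>delta l s f n - delta l s f m\<bar> \<le> c * \<bar>real_of_int (n - m)\<bar> powr frac a)"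
      unfolding case_prod_unfold SUP_ennreal_finite_iff using iff by (auto simp: Ball_def)
    also have "\<dots> \<longleftrightarrow> holder_order (frac a) (delta l s f)"
      unfolding holder_order_def
    proof safe
      fix c assume "\<forall>n m. \<bar>delta l s f n - delta l s f m\<bar> \<le> c * \<bar>real_of_int (n - m)\<bar> powr frac a"
      then show "\<exists>c\<ge>0. \<forall>n m. n \<noteq> m \<longrightarrow> \<bar>delta l s f n - delta l s f m\<bar> \<le> c * \<bar>real_of_int (n - m)\<bar> powr frac a"
      proof (intro exI[of _ "\<bar>c\<bar>"] conjI allI impI)
        fix n m :: int
        have "c * \<bar>real_of_int (n - m)\<bar> powr frac a \<le> \<bar>c\<bar> * \<bar>real_of_int (n - m)\<bar> powr frac a"
          by (intro mult_right_mono) auto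
        with \<open>\<forall>n m. _\<close> show "\<bar>delta l s f n - delta l s f m\<bar> \<le> \<bar>c\<bar> * \<bar>real_of_int (n - m)\<bar> powr frac a"
          by (meson order_trans)
      qed simp
    next
      fix c :: real assume c: "\<forall>n m. n \<noteq> m \<longrightarrow> \<bar>delta l s f n - delta l s f m\<bar> \<le> c * \<bar>real_of_int (n - m)\<bar> powr frac a"
      show "\<exists>C. \<forall>n m. \<bar>delta l s f n - delta l s f m\<bar> \<le> C * \<bar>real_of_int (n - m)\<bar> powr frac a"
      proof (intro exI allI)
        fix n m show "\<bar>delta l s f n - delta l s f m\<bar> \<le> c * \<bar>real_of_int (n - m)\<bar> powr frac a"
          using c by (cases "n = m") auto
      qed
    qed
    finally show ?thesis .
  qed
  have eq2: "holder_order c (delta l s f) \<longleftrightarrow> holder_order c ((delta_right ^^ (l + s)) f)" for c l s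
  proof -
    let ?h = "(delta_right ^^ (l + s)) f"
    have "\<bar>delta l s f n - delta l s f m\<bar> = \<bar>?h (n - int s) - ?h (m - int s)\<bar>" for n m
      unfolding delta_eq by (simp add: abs_mult flip: right_diff_distrib)
    moreover have "(\<forall>n m. \<bar>?h (n - int s) - ?h (m - int s)\<bar> \<le> C * \<bar>real_of_int (n - m)\<bar> powr c) \<longleftrightarrow>
        (\<forall>n m. \<bar>?h n - ?h m\<bar> \<le> C * \<bar>real_of_int (n - m)\<bar> powr c)" for C
    proof safe
      fix n m assume "\<forall>n m. \<bar>?h (n - int s) - ?h (m - int s)\<bar> \<le> C * \<bar>real_of_int (n - m)\<bar> powr c"
      from this[rule_format, of "n + int s" "m + int s"]
      show "\<bar>?h n - ?h m\<bar> \<le> C * \<bar>real_of_int (n - m)\<bar> powr c" by simp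
    next
      fix n m assume "\<forall>n m. \<bar>?h n - ?h m\<bar> \<le> C * \<bar>real_of_int (n - m)\<bar> powr c"
      from this[rule_format, of "n - int s" "m - int s"]
      show "\<bar>?h (n - int s) - ?h (m - int s)\<bar> \<le> C * \<bar>real_of_int (n - m)\<bar> powr c" by simp
    qed
    ultimately show ?thesis unfolding holder_order_def by simp
  qed
  show ?thesis
    unfolding holder_space_def mem_Collect_eq eq1 eq2
  proof
    assume "\<forall>l s. l + s = nat \<lfloor>a\<rfloor> \<longrightarrow> holder_order (frac a) ((delta_right ^^ (l + s)) f)"
    from this[rule_format, of "nat \<lfloor>a\<rfloor>" 0]
    show "holder_order (frac a) ((delta_right ^^ nat \<lfloor>a\<rfloor>) f)" by simp
  qed simp
qed

lemma zygmund_1_iff: "g \<in> zygmund_1 \<longleftrightarrow> growth_order 1 g \<and> second_difference_order 1 g"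
proof -
  have "(SUP n \<in> - {0}. sup_norm (\<lambda>m. g (m + n) + g (m - n) - 2 * g m) / ennreal (real_of_int \<bar>n\<bar>)) < \<infinity>
    \<longleftrightarrow> second_difference_order 1 g" (is "?S < \<infinity> \<longleftrightarrow> _")
  proof
    assume "?S < \<infinity>"
    then have c: "?S = ennreal (enn2real ?S)" by simp
    define c where "c = enn2real ?S"
    with c have c: "?S = ennreal c" "0 \<le> c" by simp_all
    show "second_difference_order 1 g" unfolding second_difference_order_def
    proof (intro exI[of _ c] allI)
      fix m n
      show "\<bar>g (m + n) + g (m - n) - 2 * g m\<bar> \<le> c * \<bar>real_of_int n\<bar> powr 1"
      proof (cases "n = 0")
        case False
        let ?N = "sup_norm (\<lambda>m. g (m + n) + g (m - n) - 2 * g m)"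
        have "?N / ennreal (real_of_int \<bar>n\<bar>) \<le> ennreal c"
          using SUP_upper[of n "- {0}" "\<lambda>n. sup_norm (\<lambda>m. g (m + n) + g (m - n) - 2 * g m) / ennreal (real_of_int \<bar>n\<bar>)"] False
          unfolding c(1)[symmetric] by simp
        then have "?N / ennreal (real_of_int \<bar>n\<bar>) * ennreal (real_of_int \<bar>n\<bar>) \<le> ennreal c * ennreal (real_of_int \<bar>n\<bar>)"
          by (rule mult_right_mono) simp
        also have "?N / ennreal (real_of_int \<bar>n\<bar>) * ennreal (real_of_int \<bar>n\<bar>) = ?N"
          using False by (simp add: ennreal_divide_times)
        finally have "?N \<le> ennreal (c * real_of_int \<bar>n\<bar>)" using c by (simp add: ennreal_mult)
        then show ?thesis using c by (subst (asm) sup_norm_le_iff) auto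
      qed simp
    qed
  next
    assume "second_difference_order 1 g"
    then obtain c where c: "\<And>m n. \<bar>g (m + n) + g (m - n) - 2 * g m\<bar> \<le> c * \<bar>real_of_int n\<bar> powr 1"
      unfolding second_difference_order_def by blast
    have c0: "0 \<le> c" using order_trans[OF abs_ge_zero c[of 0 1]] by simp
    have "?S \<le> ennreal c"
    proof (rule SUP_least)
      fix n :: int assume n: "n \<in> - {0}"
      have "sup_norm (\<lambda>m. g (m + n) + g (m - n) - 2 * g m) \<le> ennreal (c * real_of_int \<bar>n\<bar>)"
        using c[of _ n] c0 by (subst sup_norm_le_iff) auto
      then have "sup_norm (\<lambda>m. g (m + n) + g (m - n) - 2 * g m) / ennreal (real_of_int \<bar>n\<bar>) \<le> ennreal (c * real_of_int \<bar>n\<bar>) / ennreal (real_of_int \<bar>n\<bar>)"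
        by (rule divide_right_mono_ennreal)
      also have "\<dots> = ennreal c" using n c0 by (subst divide_ennreal) auto
      finally show "sup_norm (\<lambda>m. g (m + n) + g (m - n) - 2 * g m) / ennreal (real_of_int \<bar>n\<bar>) \<le> ennreal c" .
    qed
    then show "?S < \<infinity>" by (simp add: order_le_less_trans)
  qed
  moreover have "sup_norm (\<lambda>n. g n / (1 + real_of_int \<bar>n\<bar>)) < \<infinity> \<longleftrightarrow> growth_order 1 g"
    using sup_norm_growth_iff[of g 1] by simp
  ultimately show ?thesis unfolding zygmund_1_def by simp
qed

lemma growth_order_delta_iff: "growth_order 1 (delta l s f) \<longleftrightarrow> growth_order 1 ((delta_right ^^ (l + s)) f)"
proof -
  have shift: "growth_order 1 (\<lambda>n. h (n + m))" if h: "growth_order 1 h" for h m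
  proof -
    obtain C where C: "\<And>n. \<bar>h n\<bar> \<le> C * (1 + \<bar>real_of_int n\<bar> powr 1)"
      using h unfolding growth_order_def by blast
    have C0: "0 \<le> C" using order_trans[OF abs_ge_zero C[of 0]] by simp
    show ?thesis unfolding growth_order_def
    proof (intro exI[of _ "C * (1 + \<bar>real_of_int m\<bar>)"] allI)
      fix n
      have "1 + \<bar>real_of_int (n + m)\<bar> \<le> (1 + \<bar>real_of_int m\<bar>) * (1 + \<bar>real_of_int n\<bar>)"
        using abs_triangle_ineq[of "real_of_int n" "real_of_int m"] mult_nonneg_nonneg[of "\<bar>real_of_int m\<bar>" "\<bar>real_of_int n\<bar>"]
        unfolding distrib_left distrib_right of_int_add mult_1 mult_1_right by linarith
      from mult_left_mono[OF this C0] C[of "n + m"]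
      show "\<bar>h (n + m)\<bar> \<le> C * (1 + \<bar>real_of_int m\<bar>) * (1 + \<bar>real_of_int n\<bar> powr 1)"
        by (simp add: mult_ac)
    qed
  qed
  let ?h = "(delta_right ^^ (l + s)) f"
  have "growth_order 1 (delta l s f) \<longleftrightarrow> growth_order 1 (\<lambda>n. ?h (n - int s))"
    unfolding delta_eq growth_order_def by (simp add: abs_mult)
  also have "\<dots> \<longleftrightarrow> growth_order 1 ?h"
    using shift[of "\<lambda>n. ?h (n - int s)" "int s"] shift[of ?h "- int s"] by auto
  finally show ?thesis .
qed

lemma second_difference_order_delta_iff:
  "second_difference_order b (delta l s f) \<longleftrightarrow> second_difference_order b ((delta_right ^^ (l + s)) f)"
proof -
  let ?h = "(delta_right ^^ (l + s)) f"
  let ?d = "\<lambda>m n. \<bar>?h (m + n) + ?h (m - n) - 2 * ?h m\<bar>"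
  have "delta l s f (m + n) + delta l s f (m - n) - 2 * delta l s f m
      = (- 1) ^ s * (?h (m - int s + n) + ?h (m - int s - n) - 2 * ?h (m - int s))" for m n
    unfolding delta_eq by (simp add: algebra_simps)
  then have "\<bar>delta l s f (m + n) + delta l s f (m - n) - 2 * delta l s f m\<bar> = ?d (m - int s) n" for m n
    by (simp add: abs_mult)
  moreover have "(\<forall>m n. ?d (m - int s) n \<le> C * \<bar>real_of_int n\<bar> powr b) \<longleftrightarrow> (\<forall>m n. ?d m n \<le> C * \<bar>real_of_int n\<bar> powr b)" for C
    by (metis add_diff_cancel_right')
  ultimately show ?thesis unfolding second_difference_order_def by simp
qed

lemma zygmund_iff:
  assumes "1 \<le> a"
  shows "f \<in> zygmund a \<longleftrightarrow> growth_order (real a) f \<and> growth_order 1 ((delta_right ^^ (a - 1)) f)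
     \<and> second_difference_order 1 ((delta_right ^^ (a - 1)) f)"
proof (cases "a = 1")
  case True
  then show ?thesis by (auto simp: zygmund_def zygmund_1_iff)
next
  case False
  have "sup_norm (\<lambda>n. f n / (1 + real_of_int \<bar>n\<bar> ^ a)) < \<infinity> \<longleftrightarrow> growth_order (real a) f"
  proof -
    have "real_of_int \<bar>n\<bar> ^ a = \<bar>real_of_int n\<bar> powr real a" for n
      using assms by (cases "n = 0") (auto simp: powr_realpow)
    then show ?thesis by (simp only: sup_norm_growth_iff)
  qed
  moreover have "(\<forall>l s. l + s = a - 1 \<longrightarrow> delta l s f \<in> zygmund_1) \<longleftrightarrow>
    growth_order 1 ((delta_right ^^ (a - 1)) f) \<and> second_difference_order 1 ((delta_right ^^ (a - 1)) f)"
    unfolding zygmund_1_iff growth_order_delta_iff second_difference_order_delta_iff by (metis add_0_right)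
  ultimately show ?thesis using False by (simp add: zygmund_def)
qed

text \<open>The semigroups are given by their series for positive times only, whence the open
  set.\<close>
lemma nth_derivative_eqI:
  fixes \<phi> :: "nat \<Rightarrow> real \<Rightarrow> 'a::real_normed_vector"
  assumes "open S" "\<And>x. x \<in> S \<Longrightarrow> f x = \<phi> 0 x"
    and d: "\<And>i x. x \<in> S \<Longrightarrow> (\<phi> i has_vector_derivative \<phi> (Suc i) x) (at x)" and "x \<in> S"
  shows "nth_derivative k f x = \<phi> k x"
  using \<open>x \<in> S\<close>
proof (induction k arbitrary: x)
  case (Suc k)
  have "(nth_derivative k f has_vector_derivative \<phi> (Suc k) x) (at x)"
    by (rule has_vector_derivative_transform_within_open[OF d[OF Suc.prems] \<open>open S\<close> Suc.prems])
       (use Suc.IH in simp)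
  then show ?case by (simp add: nth_derivative_def vector_derivative_at)
qed (use assms in \<open>simp add: nth_derivative_def\<close>)

lemma positive_constant_iff:
  fixes F :: "real \<Rightarrow> int \<Rightarrow> real"
  assumes w: "\<And>t. 0 < t \<Longrightarrow> 0 \<le> w t"
  shows "(\<exists>C>0. \<forall>t>0. \<forall>n. \<bar>F t n\<bar> \<le> C * w t) \<longleftrightarrow> (\<exists>C. \<forall>t>0. \<forall>n. \<bar>F t n\<bar> \<le> C * w t)"
proof
  assume "\<exists>C. \<forall>t>0. \<forall>n. \<bar>F t n\<bar> \<le> C * w t"
  then obtain C where C: "\<forall>t>0. \<forall>n. \<bar>F t n\<bar> \<le> C * w t" by blast
  show "\<exists>C>0. \<forall>t>0. \<forall>n. \<bar>F t n\<bar> \<le> C * w t"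
  proof (intro exI[of _ "\<bar>C\<bar> + 1"] conjI allI impI)
    fix t :: real and n assume t: "0 < t"
    have "\<bar>F t n\<bar> \<le> C * w t" using C t by blast
    also have "\<dots> \<le> (\<bar>C\<bar> + 1) * w t" by (rule mult_right_mono) (use w[OF t] in auto)
    finally show "\<bar>F t n\<bar> \<le> (\<bar>C\<bar> + 1) * w t" .
  qed simp
qed blast

lemma Lambda_H_iff:
  assumes a: "0 < a"
  shows "f \<in> Lambda_H a \<longleftrightarrow> growth_order a f \<and> heat_decay a (2 * (nat \<lfloor>a / 2\<rfloor> + 1)) f"
proof (cases "growth_order a f")
  case True
  define K where "K = nat \<lfloor>a / 2\<rfloor> + 1"
  have eg: "exp_growth f" by (rule growth_order_exp_growth[OF True a])
  have nd: "nth_derivative K (\<lambda>t. heat_semigroup t f n) t = (delta_right ^^ (2 * K)) (heat t f) (n - int K)"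
    if t: "0 < t" for t n
  proof -
    have "nth_derivative K (\<lambda>t. heat_semigroup t f n) t = heat t ((lap ^^ K) f) n"
    proof (rule nth_derivative_eqI[where S = "{0<..}" and \<phi> = "\<lambda>i t. heat t ((lap ^^ i) f) n"])
      show "((\<lambda>t. heat t ((lap ^^ i) f) n) has_vector_derivative heat t ((lap ^^ Suc i) f) n) (at t)" for i t
        using heat_has_derivative[OF exp_growth_tri_pow[OF eg], of i 1 "- 2" 1 n t]
        by (simp add: has_real_derivative_iff_has_vector_derivative)
    qed (use t eg in \<open>auto simp: heat_semigroup_eq\<close>)
    then show ?thesis by (simp add: lap_pow_eq_delta flip: heat_tri_pow[OF eg])
  qed
  have e: "- real K + a / 2 = (a - real (2 * K)) / 2" by (simp add: field_simps)
  have "(\<exists>C>0. \<forall>t>0. sup_norm (\<lambda>n. nth_derivative K (\<lambda>t. heat_semigroup t f n) t) \<le> ennreal (C * t powr (- real K + a / 2)))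
    \<longleftrightarrow> (\<exists>C>0. \<forall>t>0. \<forall>n. \<bar>(delta_right ^^ (2 * K)) (heat t f) (n - int K)\<bar> \<le> C * t powr ((a - real (2 * K)) / 2))"
    unfolding e by (intro ex_cong1 conj_cong refl all_cong1 imp_cong) (simp add: sup_norm_le_iff nd)
  also have "\<dots> \<longleftrightarrow> (\<exists>C>0. \<forall>t>0. \<forall>n. \<bar>(delta_right ^^ (2 * K)) (heat t f) n\<bar> \<le> C * t powr ((a - real (2 * K)) / 2))"
    by (metis add_diff_cancel_right')
  also have "\<dots> \<longleftrightarrow> heat_decay a (2 * K) f"
    unfolding heat_decay_def by (rule positive_constant_iff) simp
  finally show ?thesis using True
    unfolding Lambda_H_def mem_Collect_eq of_int_abs sup_norm_growth_iff Let_def K_def by simp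
next
  case False
  then show ?thesis unfolding Lambda_H_def mem_Collect_eq of_int_abs sup_norm_growth_iff by simp
qed

lemma half_floor_bound: "0 < a \<Longrightarrow> a < real (2 * (nat \<lfloor>a / 2\<rfloor> + 1))" for a :: real
  using floor_correct[of "a / 2"] by simp linarith

theorem Lambda_H_eq_holder_space:
  assumes a: "0 < a" "a \<notin> \<nat>"
  shows "Lambda_H a = holder_space a"
proof -
  have k: "real (nat \<lfloor>a\<rfloor>) = of_int \<lfloor>a\<rfloor>" using a by simp
  have b: "0 < frac a" "frac a < 1"
    using a frac_ge_0[of a] frac_lt_1[of a] frac_eq_0_iff[of a] Nats_altdef2 by (auto simp: less_le)
  have ak: "real (nat \<lfloor>a\<rfloor>) + frac a = a" by (simp add: k frac_def)
  show ?thesis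
    using holder_order_iff_heat_decay[OF b, of "nat \<lfloor>a\<rfloor>" "2 * (nat \<lfloor>a / 2\<rfloor> + 1)"] half_floor_bound[OF a(1)]
    unfolding ak by (auto simp: Lambda_H_iff[OF a(1)] holder_space_iff)
qed

theorem Lambda_H_eq_zygmund:
  assumes a: "1 \<le> a"
  shows "Lambda_H (real a) = zygmund a"
proof -
  have ak: "real (a - 1) + 1 = real a" using a by simp
  have "0 < real a" using a by simp
  then show ?thesis
    using zygmund_order_iff_heat_decay[of "a - 1" "2 * (nat \<lfloor>real a / 2\<rfloor> + 1)"] half_floor_bound[of "real a"]
    unfolding ak using zygmund_iff[OF a] Lambda_H_iff[of "real a"] by blast
qed

section \<open>The subordination integral\<close>

lemma gaussian_antiderivative:
  obtains E :: "real \<Rightarrow> real" where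
    "\<And>x. (E has_real_derivative exp (- x\<^sup>2)) (at x)" "E 0 = 0"
    "(E \<longlongrightarrow> sqrt pi / 2) at_top" "(E \<longlongrightarrow> - (sqrt pi / 2)) at_bot"
proof -
  obtain F where "\<And>x. - \<infinity> < x \<Longrightarrow> x < \<infinity> \<Longrightarrow> (F has_vector_derivative exp (- x\<^sup>2)) (at x)"
    using einterval_antiderivative[of "-\<infinity>" \<infinity> "\<lambda>x::real. exp (- x\<^sup>2)"] by (auto intro!: continuous_intros)
  then have F: "(F has_real_derivative exp (- x\<^sup>2)) (at x)" for x
    by (simp add: has_real_derivative_iff_has_vector_derivative)
  define E where "E x = F x - F 0" for x
  have E: "(E has_real_derivative exp (- x\<^sup>2)) (at x)" for x
    unfolding E_def by (auto intro!: derivative_eq_intros F)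
  have E0: "E 0 = 0" by (simp add: E_def)
  have top: "(E \<longlongrightarrow> sqrt pi / 2) at_top"
  proof -
    have "((\<lambda>x. LINT s|lborel. indicator {..x} s *\<^sub>R (indicator {0..} s *\<^sub>R exp (- s\<^sup>2))) \<longlongrightarrow> sqrt pi / 2) at_top"
      using tendsto_integral_at_top[of lborel "\<lambda>s. indicator {0..} s *\<^sub>R exp (- s\<^sup>2)"] gaussian_moment_0
      unfolding has_bochner_integral_iff by (metis sets_lborel)
    moreover have "\<forall>\<^sub>F x in at_top. (LINT s|lborel. indicator {..x} s *\<^sub>R (indicator {0..} s *\<^sub>R exp (- s\<^sup>2))) = E x"
      using eventually_ge_at_top[of 0]
    proof eventually_elim
      case (elim x)
      have "(LINT s|lborel. exp (- s\<^sup>2) * indicator {0..x} s) = E x - E 0"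
        by (rule integral_FTC_Icc_real[OF elim]) (use E in \<open>auto intro!: continuous_intros\<close>)
      moreover have "(\<lambda>s. indicator {..x} s *\<^sub>R (indicator {0..} s *\<^sub>R exp (- s\<^sup>2))) = (\<lambda>s. exp (- s\<^sup>2) * indicator {0..x} s)"
        by (auto simp: indicator_def)
      ultimately show ?case by (simp only: E0 diff_0_right)
    qed
    ultimately show ?thesis by (rule Lim_transform_eventually)
  qed
  have odd: "E (- x) = - E x" for x
  proof -
    have "((\<lambda>x. E x + E (- x)) has_real_derivative 0) (at x)" for x
      by (rule derivative_eq_intros DERIV_chain2[OF E] E | simp)+
    then have "E x + E (- x) = E 0 + E (- 0)"
      by (intro DERIV_isconst_all[rule_format]) auto
    then show ?thesis by (simp add: E0)
  qed
  have "((\<lambda>x. - E (- x)) \<longlongrightarrow> - (sqrt pi / 2)) at_bot"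
    by (intro tendsto_minus filterlim_compose[OF top] filterlim_uminus_at_top_at_bot)
  then have "(E \<longlongrightarrow> - (sqrt pi / 2)) at_bot" by (simp add: odd)
  with that E E0 top show thesis by blast
qed

text \<open>The density of the one-sided stable law of index \<open>1/2\<close>, the weight in the
  definition of the Poisson kernel.\<close>
definition subordinator :: "real \<Rightarrow> real \<Rightarrow> real" where
  "subordinator y t = y / (2 * sqrt pi) * (exp (- (y\<^sup>2) / (4 * t)) / t powr (3 / 2))"

lemma subordinator_nonneg: "0 \<le> y \<Longrightarrow> 0 \<le> subordinator y t"
  by (simp add: subordinator_def)

lemma filterlim_inverse_sqrt_at_right:
  fixes A B :: real
  assumes "0 < A"
  shows "filterlim (\<lambda>t. A / sqrt t + B * sqrt t) at_top (at_right 0)"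
proof -
  have 1: "((\<lambda>t::real. sqrt t) \<longlongrightarrow> 0) (at_right 0)"
    using tendsto_real_sqrt[OF tendsto_ident_at[of 0 "{0<..}"]] by simp
  then have "filterlim (\<lambda>t::real. sqrt t) (at_right 0) (at_right 0)"
    unfolding filterlim_at by (auto simp: eventually_at_filter)
  then have "filterlim (\<lambda>t::real. inverse (sqrt t)) at_top (at_right 0)"
    by (rule filterlim_compose[OF filterlim_inverse_at_top_right])
  then have 2: "filterlim (\<lambda>t::real. A * inverse (sqrt t)) at_top (at_right 0)"
    by (rule filterlim_tendsto_pos_mult_at_top[OF tendsto_const assms])
  have 3: "((\<lambda>t. B * sqrt t) \<longlongrightarrow> B * 0) (at_right 0)" by (intro tendsto_intros 1)
  show ?thesis using filterlim_tendsto_add_at_top[OF 3 2] by (simp add: divide_inverse add.commute)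
qed

lemma filterlim_sqrt_at_top':
  fixes A B :: real
  assumes "0 < B"
  shows "filterlim (\<lambda>t. A / sqrt t + B * sqrt t) at_top at_top"
proof -
  have "((\<lambda>t. A / sqrt t) \<longlongrightarrow> 0) at_top"
    by (intro tendsto_divide_0[OF tendsto_const] filterlim_at_top_imp_at_infinity sqrt_at_top)
  moreover have "filterlim (\<lambda>t. B * sqrt t) at_top at_top"
    by (intro filterlim_tendsto_pos_mult_at_top[OF tendsto_const assms] sqrt_at_top)
  ultimately show ?thesis by (rule filterlim_tendsto_add_at_top)
qed

text \<open>The integrand has an explicit antiderivative \<open>F\<close> in terms of the Gaussian
  integral \<open>E\<close> at \<open>y / (2 \<surd>t) \<plusminus> l \<surd>t\<close>. For \<open>l
  = 0\<close> both arguments tend to \<open>0\<close> at infinity instead of diverging.\<close>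
lemma subordinator_laplace:
  assumes y: "0 < y" and l: "0 \<le> l"
  shows "set_integrable lborel {0<..} (\<lambda>t. subordinator y t * exp (- (l\<^sup>2) * t))"
    and "(LINT t:{0<..}|lborel. subordinator y t * exp (- (l\<^sup>2) * t)) = exp (- y * l)"
proof -
  obtain E :: "real \<Rightarrow> real" where
    E: "\<And>x. (E has_real_derivative exp (- x\<^sup>2)) (at x)" and E0: "E 0 = 0" and
    top: "(E \<longlongrightarrow> sqrt pi / 2) at_top" and bot: "(E \<longlongrightarrow> - (sqrt pi / 2)) at_bot"
    by (rule gaussian_antiderivative) blast
  define u v where "u t = (y / 2) / sqrt t + (- l) * sqrt t" and "v t = (y / 2) / sqrt t + l * sqrt t" for t
  define F where "F t = (1 / sqrt pi) * (exp (- y * l) * (sqrt pi / 2 - E (u t)) + exp (y * l) * (sqrt pi / 2 - E (v t)))" for t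
  let ?f = "\<lambda>t. subordinator y t * exp (- (l\<^sup>2) * t)"
  have dF: "(F has_real_derivative ?f t) (at t)" if t: "0 < t" for t
  proof -
    define s where "s = sqrt t"
    have s: "0 < s" "t = s\<^sup>2" using t by (simp_all add: s_def)
    have rt: "sqrt t = s" by (simp add: s_def)
    have ds: "((\<lambda>t. sqrt t) has_real_derivative 1 / (2 * s)) (at t)"
      using DERIV_real_sqrt[OF t] by (simp add: rt field_simps)
    have du: "((\<lambda>t. (y / 2) / sqrt t + c * sqrt t) has_real_derivative - (y / 4) / s ^ 3 + c / (2 * s)) (at t)" for c
    proof -
      have "((\<lambda>t. inverse (sqrt t)) has_real_derivative - (inverse s * (1 / (2 * s)) * inverse s)) (at t)"
        using DERIV_inverse'[OF ds] s(1) unfolding rt by simp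
      from DERIV_add[OF DERIV_cmult[OF this, of "y / 2"] DERIV_cmult[OF ds, of c]]
      have "((\<lambda>t. y / 2 * inverse (sqrt t) + c * sqrt t) has_real_derivative
          y / 2 * - (inverse s * (1 / (2 * s)) * inverse s) + c * (1 / (2 * s))) (at t)" .
      moreover have "y / 2 * - (inverse s * (1 / (2 * s)) * inverse s) + c * (1 / (2 * s)) = - (y / 4) / s ^ 3 + c / (2 * s)"
        using s(1) by (simp add: power3_eq_cube divide_simps)
      moreover have "(\<lambda>t. (y / 2) / sqrt t + c * sqrt t) = (\<lambda>t. y / 2 * inverse (sqrt t) + c * sqrt t)"
        by (rule ext) (simp only: divide_inverse)
      ultimately show ?thesis by (simp only:)
    qed
    have "(u t)\<^sup>2 = y\<^sup>2 / (4 * t) - y * l + l\<^sup>2 * t" "(v t)\<^sup>2 = y\<^sup>2 / (4 * t) + y * l + l\<^sup>2 * t"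
      unfolding u_def v_def rt unfolding s(2) using s(1) by (simp_all add: power2_eq_square field_simps)
    then have e1: "exp (- y * l) * exp (- (u t)\<^sup>2) = exp (- (y\<^sup>2) / (4 * t) - l\<^sup>2 * t)"
      "exp (y * l) * exp (- (v t)\<^sup>2) = exp (- (y\<^sup>2) / (4 * t) - l\<^sup>2 * t)"
      by (simp_all flip: exp_add)
    have "(F has_real_derivative (1 / sqrt pi) * (exp (- y * l) * (0 - exp (- (u t)\<^sup>2) * (- (y / 4) / s ^ 3 + (- l) / (2 * s)))
        + exp (y * l) * (0 - exp (- (v t)\<^sup>2) * (- (y / 4) / s ^ 3 + l / (2 * s))))) (at t)"
      unfolding F_def
      by (intro DERIV_cmult DERIV_add DERIV_diff DERIV_const DERIV_chain2[OF E] du[of "- l", folded u_def[abs_def]] du[of l, folded v_def[abs_def]])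
    also have "(1 / sqrt pi) * (exp (- y * l) * (0 - exp (- (u t)\<^sup>2) * (- (y / 4) / s ^ 3 + (- l) / (2 * s)))
        + exp (y * l) * (0 - exp (- (v t)\<^sup>2) * (- (y / 4) / s ^ 3 + l / (2 * s))))
      = (1 / sqrt pi) * ((exp (- y * l) * exp (- (u t)\<^sup>2)) * (y / 4 / s ^ 3 + l / (2 * s))
        + (exp (y * l) * exp (- (v t)\<^sup>2)) * (y / 4 / s ^ 3 - l / (2 * s)))"
      by (simp add: algebra_simps)
    also have "\<dots> = (1 / sqrt pi) * (exp (- (y\<^sup>2) / (4 * t) - l\<^sup>2 * t) * (y / 2 / s ^ 3))"
      unfolding e1 by (simp add: algebra_simps)
    also have "\<dots> = ?f t"
    proof -
      have "t powr (3 / 2) = s ^ 3"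
      proof -
        have "t powr (3 / 2) = (s powr 2) powr (3 / 2)" unfolding s(2) using s(1) by simp
        also have "\<dots> = s powr 3" by (simp only: powr_powr) simp
        also have "\<dots> = s ^ 3" using s(1) by simp
        finally show ?thesis .
      qed
      then show ?thesis
        by (simp add: subordinator_def exp_diff exp_minus field_simps)
    qed
    finally show ?thesis .
  qed
  have lim0: "(F \<longlongrightarrow> 0) (at_right 0)"
  proof -
    have "(F \<longlongrightarrow> (1 / sqrt pi) * (exp (- y * l) * (sqrt pi / 2 - sqrt pi / 2) + exp (y * l) * (sqrt pi / 2 - sqrt pi / 2))) (at_right 0)"
      unfolding F_def u_def v_def
      by (intro tendsto_intros filterlim_compose[OF top] filterlim_inverse_sqrt_at_right) (use y in auto)
    then show ?thesis by simp
  qed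
  have lim1: "(F \<longlongrightarrow> exp (- y * l)) at_top"
  proof (cases "l = 0")
    case True
    have "((\<lambda>t. (y / 2) / sqrt t) \<longlongrightarrow> 0) at_top"
      by (intro tendsto_divide_0[OF tendsto_const] filterlim_at_top_imp_at_infinity sqrt_at_top)
    moreover have "isCont E 0" by (rule DERIV_isCont[OF E])
    ultimately have "((\<lambda>t. E ((y / 2) / sqrt t)) \<longlongrightarrow> E 0) at_top"
      by (rule isCont_tendsto_compose[rotated])
    then have "(F \<longlongrightarrow> (1 / sqrt pi) * (exp (- y * l) * (sqrt pi / 2 - E 0) + exp (y * l) * (sqrt pi / 2 - E 0))) at_top"
      unfolding F_def u_def v_def by (intro tendsto_intros) (simp_all add: True)
    then show ?thesis by (simp add: True E0)
  next
    case False
    then have l: "0 < l" using l by simp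
    have "filterlim (\<lambda>t. (- (y / 2)) / sqrt t + l * sqrt t) at_top at_top" by (rule filterlim_sqrt_at_top'[OF l])
    then have ub: "filterlim u at_bot at_top"
      unfolding filterlim_uminus_at_bot u_def[abs_def] by (simp add: algebra_simps)
    have vt: "filterlim v at_top at_top" unfolding v_def[abs_def] by (rule filterlim_sqrt_at_top'[OF l])
    have "(F \<longlongrightarrow> (1 / sqrt pi) * (exp (- y * l) * (sqrt pi / 2 - (- (sqrt pi / 2))) + exp (y * l) * (sqrt pi / 2 - sqrt pi / 2))) at_top"
      unfolding F_def
      by (intro tendsto_intros filterlim_compose[OF top vt] filterlim_compose[OF bot ub])
    then show ?thesis by simp
  qed
  have cont: "isCont ?f t" if "0 < t" for t
    using that unfolding subordinator_def by (auto intro!: continuous_intros)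
  have ftc: "set_integrable lborel (einterval 0 \<infinity>) ?f \<and> (LBINT t=0..\<infinity>. ?f t) = exp (- y * l) - 0"
  proof (intro conjI)
    have 1: "((F \<circ> real_of_ereal) \<longlongrightarrow> 0) (at_right (0::ereal))"
      unfolding zero_ereal_def ereal_tendsto_simps1 by (rule lim0)
    have 2: "((F \<circ> real_of_ereal) \<longlongrightarrow> exp (- y * l)) (at_left \<infinity>)"
      unfolding ereal_tendsto_simps1 by (rule lim1)
    show "set_integrable lborel (einterval 0 \<infinity>) ?f" "(LBINT t=0..\<infinity>. ?f t) = exp (- y * l) - 0"
      using interval_integral_FTC_nonneg[of 0 \<infinity> F ?f, OF _ _ _ _ 1 2] dF cont y subordinator_nonneg
      by (auto simp: zero_ereal_def)
  qed
  have "einterval 0 \<infinity> = {0::real<..}" by (auto simp: einterval_def zero_ereal_def)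
  then show "set_integrable lborel {0<..} ?f" using ftc by simp
  show "(LINT t:{0<..}|lborel. ?f t) = exp (- y * l)"
    using ftc by (simp add: interval_lebesgue_integral_0_infty)
qed

lemma subordinator_integrable: "0 < y \<Longrightarrow> set_integrable lborel {0<..} (subordinator y)"
  using subordinator_laplace(1)[of y 0] by simp

lemma subordinator_integral: "0 < y \<Longrightarrow> (LINT t:{0<..}|lborel. subordinator y t) = 1"
  using subordinator_laplace(2)[of y 0] by simp

section \<open>Cosine coefficients\<close>

definition cos_coeff :: "(real \<Rightarrow> real) \<Rightarrow> int \<Rightarrow> real" where
  "cos_coeff h j = (1 / pi) * (LINT x:{0..pi}|lborel. h x * cos (real_of_int j * x))"

lemma cos_coeff_integrable:
  "continuous_on {0..pi} h \<Longrightarrow> set_integrable lborel {0..pi} (\<lambda>x. h x * cos (real_of_int j * x))"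
  by (rule borel_integrable_atLeastAtMost') (intro continuous_intros)

lemma cos_coeff_cmult: "cos_coeff (\<lambda>x. c * h x) j = c * cos_coeff h j"
  by (simp add: cos_coeff_def mult.assoc)

lemma cos_coeff_one: "cos_coeff (\<lambda>_. 1) j = point_mass j"
proof (cases "j = 0")
  case True
  then show ?thesis by (simp add: cos_coeff_def set_lebesgue_integral_def)
next
  case False
  have "(LINT x|lborel. cos (real_of_int j * x) * indicator {0..pi} x)
      = sin (real_of_int j * pi) / real_of_int j - sin (real_of_int j * 0) / real_of_int j"
    by (rule integral_FTC_Icc_real) (use False in \<open>auto intro!: derivative_eq_intros continuous_intros\<close>)
  then show ?thesis
    using False sin_int_times_real[of j] by (simp add: cos_coeff_def set_lebesgue_integral_def mult.commute)
qed

text \<open>Product formula for cosines: multiplication by the symbol \<open>2 cos x - 2\<close> is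
  the Laplacian on the coefficients.\<close>
lemma cos_coeff_lap:
  assumes h: "continuous_on {0..pi} h"
  shows "cos_coeff (\<lambda>x. (2 * cos x - 2) * h x) j = lap (cos_coeff h) j"
proof -
  have pw: "(2 * cos x - 2) * h x * cos (real_of_int j * x) =
      (h x * cos (real_of_int (j - 1) * x) + h x * cos (real_of_int (j + 1) * x)) - 2 * (h x * cos (real_of_int j * x))" for x
    by (simp add: left_diff_distrib distrib_right cos_diff cos_add algebra_simps)
  define I where "I k = (LINT x:{0..pi}|lborel. h x * cos (real_of_int k * x))" for k
  note int = cos_coeff_integrable[OF h]
  have "(LINT x:{0..pi}|lborel. (2 * cos x - 2) * h x * cos (real_of_int j * x))
      = (LINT x:{0..pi}|lborel. h x * cos (real_of_int (j - 1) * x) + h x * cos (real_of_int (j + 1) * x))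
        - (LINT x:{0..pi}|lborel. 2 * (h x * cos (real_of_int j * x)))"
    unfolding pw by (intro set_integral_diff(2) set_integral_add(1) set_integrable_mult_right impI int)
  also have "\<dots> = I (j - 1) + I (j + 1) - 2 * I j"
    unfolding I_def by (subst set_integral_add(2)[OF int int], subst set_integral_mult_right) (rule refl)
  finally have eq: "(LINT x:{0..pi}|lborel. (2 * cos x - 2) * h x * cos (real_of_int j * x)) = I (j - 1) + I (j + 1) - 2 * I j" .
  show ?thesis
    unfolding cos_coeff_def tri_def eq I_def[symmetric] by (simp add: algebra_simps)
qed

lemma cos_coeff_exp_sums:
  assumes m: "continuous_on {0..pi} m"
  shows "(\<lambda>k. t ^ k / fact k * cos_coeff (\<lambda>x. m x ^ k) j) sums cos_coeff (\<lambda>x. exp (t * m x)) j"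
proof -
  obtain B where B': "\<forall>x\<in>{0..pi}. norm (m x) \<le> B"
    using compact_imp_bounded[OF compact_continuous_image[OF m compact_Icc]]
    unfolding bounded_iff by auto
  have B: "\<bar>m x\<bar> \<le> B" if "0 \<le> x" "x \<le> pi" for x using B' that by auto
  have B0: "0 \<le> B" using B[of 0] by (simp add: order_trans[OF abs_ge_zero])
  let ?f = "\<lambda>k x. indicator {0..pi} x *\<^sub>R (t ^ k / fact k * m x ^ k * cos (real_of_int j * x))"
  have bd: "norm (?f k x) \<le> ((\<bar>t\<bar> * B) ^ k / fact k) * indicator {0..pi} x" for k x
  proof (cases "x \<in> {0..pi}")
    case True
    have "\<bar>m x\<bar> ^ k * \<bar>cos (real_of_int j * x)\<bar> \<le> B ^ k * 1"
      using B[of x] True B0 by (intro mult_mono power_mono) auto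
    then have "(\<bar>t\<bar> ^ k / fact k) * (\<bar>m x\<bar> ^ k * \<bar>cos (real_of_int j * x)\<bar>) \<le> (\<bar>t\<bar> ^ k / fact k) * (B ^ k * 1)"
      by (intro mult_left_mono) auto
    then show ?thesis using True by (simp add: abs_mult power_abs power_mult_distrib mult.assoc)
  qed simp
  have int: "integrable lborel (?f k)" for k
    using borel_integrable_atLeastAtMost'[of 0 pi "\<lambda>x. t ^ k / fact k * m x ^ k * cos (real_of_int j * x)"]
    by (simp add: set_integrable_def continuous_intros m)
  have exps: "(\<lambda>k. t ^ k / fact k * m x ^ k * cos (real_of_int j * x)) sums (exp (t * m x) * cos (real_of_int j * x))" for x
    using sums_mult2[OF exp_converges[of "t * m x"], of "cos (real_of_int j * x)"]
    by (simp add: power_mult_distrib divide_inverse mult_ac)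
  have "(\<lambda>k. integral\<^sup>L lborel (?f k)) sums (LINT x|lborel. (\<Sum>k. ?f k x))"
  proof (rule sums_integral[OF int])
    show "AE x in lborel. summable (\<lambda>k. norm (?f k x))"
      by (intro AE_I2 summable_comparison_test'[OF summable_mult2[OF summable_exp_real[of "\<bar>t\<bar> * B"]], of 0])
         (use bd in auto)
    show "summable (\<lambda>k. LINT x|lborel. norm (?f k x))"
    proof (rule summable_comparison_test'[OF summable_mult2[OF summable_exp_real[of "\<bar>t\<bar> * B"], of pi], of 0])
      fix k
      have "(LINT x|lborel. norm (?f k x)) \<le> (LINT x|lborel. ((\<bar>t\<bar> * B) ^ k / fact k) * indicator {0..pi} x)"
        by (intro integral_mono integrable_norm int bd) auto
      also have "\<dots> = ((\<bar>t\<bar> * B) ^ k / fact k) * pi" by simp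
      finally show "norm (LINT x|lborel. norm (?f k x)) \<le> (\<bar>t\<bar> * B) ^ k / fact k * pi" by simp
    qed
  qed
  moreover have "(\<Sum>k. ?f k x) = indicator {0..pi} x *\<^sub>R (exp (t * m x) * cos (real_of_int j * x))" for x
    using exps[of x] by (cases "x \<in> {0..pi}") (auto simp: sums_iff)
  moreover have "(1 / pi) * integral\<^sup>L lborel (?f k) = t ^ k / fact k * cos_coeff (\<lambda>x. m x ^ k) j" for k
    unfolding cos_coeff_cmult[symmetric] by (simp add: cos_coeff_def set_lebesgue_integral_def)
  ultimately show ?thesis
    using sums_mult[of "\<lambda>k. integral\<^sup>L lborel (?f k)" _ "1 / pi"]
    by (simp add: cos_coeff_def set_lebesgue_integral_def)
qed

text \<open>Both sides are exponential series in \<open>t\<close>, and their coefficients satisfy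
  the same recursion by \<open>cos_coeff_lap\<close>.\<close>
lemma heat_kernel_fourier:
  assumes t: "0 \<le> t"
  shows "heat_kernel t j = cos_coeff (\<lambda>x. exp (- ((2 * sin (x / 2))\<^sup>2) * t)) j"
proof -
  have c: "(lap ^^ k) point_mass = cos_coeff (\<lambda>x. (2 * cos x - 2) ^ k)" for k
  proof (induction k)
    case (Suc k)
    have "cos_coeff (\<lambda>x. (2 * cos x - 2) * (2 * cos x - 2) ^ k) i = lap (cos_coeff (\<lambda>x. (2 * cos x - 2) ^ k)) i" for i
      by (rule cos_coeff_lap) (intro continuous_intros)
    then show ?case by (auto simp: Suc)
  qed (auto simp: cos_coeff_one)
  have "(\<lambda>k. t ^ k / fact k * cos_coeff (\<lambda>x. (2 * cos x - 2) ^ k) j) sums cos_coeff (\<lambda>x. exp (t * (2 * cos x - 2))) j"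
    by (rule cos_coeff_exp_sums) (intro continuous_intros)
  then have "heat t point_mass j = cos_coeff (\<lambda>x. exp (t * (2 * cos x - 2))) j"
    by (simp add: heat_egf egf_def c sums_iff)
  moreover have "t * (2 * cos x - 2) = - ((2 * sin (x / 2))\<^sup>2) * t" for x
  proof -
    have "cos x = 1 - 2 * (sin (x / 2))\<^sup>2" using cos_double_sin[of "x / 2"] by simp
    show ?thesis unfolding \<open>cos x = _\<close> by (simp add: power_mult_distrib algebra_simps)
  qed
  ultimately show ?thesis by (simp add: heat_kernel_eq_heat t)
qed

section \<open>The Poisson kernel as an exponential series\<close>

text \<open>The convolution kernel of the \<open>i\<close>-th power of
  \<open>\<surd>(-\<Delta>)\<close>, whose symbol is \<open>2 sin (x / 2)\<close>.\<close>
definition half_lap_coeff :: "nat \<Rightarrow> int \<Rightarrow> real" where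
  "half_lap_coeff i = cos_coeff (\<lambda>x. (2 * sin (x / 2)) ^ i)"

lemma half_lap_coeff_0: "half_lap_coeff 0 = point_mass"
  by (auto simp: half_lap_coeff_def cos_coeff_one)

lemma half_lap_coeff_Suc_Suc: "half_lap_coeff (Suc (Suc i)) = (\<lambda>j. - lap (half_lap_coeff i) j)"
proof
  fix j
  have "(2 * sin (x / 2)) ^ Suc (Suc i) = - 1 * ((2 * cos x - 2) * (2 * sin (x / 2)) ^ i)" for x :: real
  proof -
    have "cos x = 1 - 2 * (sin (x / 2))\<^sup>2" using cos_double_sin[of "x / 2"] by simp
    show ?thesis unfolding \<open>cos x = _\<close> by (simp add: algebra_simps power2_eq_square)
  qed
  then have "half_lap_coeff (Suc (Suc i)) j = - 1 * cos_coeff (\<lambda>x. (2 * cos x - 2) * (2 * sin (x / 2)) ^ i) j"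
    unfolding half_lap_coeff_def cos_coeff_cmult[symmetric] by simp
  also have "cos_coeff (\<lambda>x. (2 * cos x - 2) * (2 * sin (x / 2)) ^ i) j = lap (half_lap_coeff i) j"
    unfolding half_lap_coeff_def by (rule cos_coeff_lap) (intro continuous_intros, simp)
  finally show "half_lap_coeff (Suc (Suc i)) j = - lap (half_lap_coeff i) j" by simp
qed

text \<open>The product \<open>2 sin (x / 2) cos (j x)\<close> is a difference of two sines with
  half-integer frequencies \<open>a\<close> and \<open>b\<close>.\<close>
lemma half_lap_coeff_1: "half_lap_coeff 1 j = - 1 / (pi * ((real_of_int j)\<^sup>2 - 1 / 4))"
proof -
  define a b where "a = real_of_int j + 1 / 2" and "b = real_of_int j - 1 / 2"
  have "real_of_int (2 * j + 1) \<noteq> 0" "real_of_int (2 * j - 1) \<noteq> 0" by presburger+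
  then have a0: "a \<noteq> 0" and b0: "b \<noteq> 0" by (auto simp: a_def b_def)
  have cz: "cos (a * pi) = 0" "cos (b * pi) = 0"
    using sin_zero_iff_int2[of "real_of_int j * pi"] cos_add[of "real_of_int j * pi" "pi / 2"] cos_diff[of "real_of_int j * pi" "pi / 2"]
    by (simp_all add: a_def b_def distrib_right left_diff_distrib)
  have pw: "2 * sin (x / 2) * cos (real_of_int j * x) = sin (a * x) - sin (b * x)" for x
  proof -
    have "a * x = real_of_int j * x + x / 2" "b * x = real_of_int j * x - x / 2" by (simp_all add: a_def b_def algebra_simps)
    then show ?thesis by (simp add: sin_add sin_diff)
  qed
  have "(LINT x|lborel. (sin (a * x) - sin (b * x)) * indicator {0..pi} x)
      = (- cos (a * pi) / a + cos (b * pi) / b) - (- cos (a * 0) / a + cos (b * 0) / b)"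
    by (rule integral_FTC_Icc_real) (use a0 b0 in \<open>auto intro!: derivative_eq_intros continuous_intros\<close>)
  then have "(LINT x|lborel. (sin (a * x) - sin (b * x)) * indicator {0..pi} x) = 1 / a - 1 / b"
    by (simp add: cz)
  moreover have "half_lap_coeff 1 j = (1 / pi) * (LINT x|lborel. (sin (a * x) - sin (b * x)) * indicator {0..pi} x)"
    unfolding half_lap_coeff_def cos_coeff_def set_lebesgue_integral_def power_one_right pw real_scaleR_def
    by (simp only: mult.commute)
  ultimately have "half_lap_coeff 1 j = (1 / pi) * (1 / a - 1 / b)" by (simp only:)
  also have "1 / a - 1 / b = - 1 / (a * b)" using a0 b0 by (simp add: a_def b_def field_simps)
  also have "a * b = (real_of_int j)\<^sup>2 - 1 / 4" by (simp add: a_def b_def power2_eq_square algebra_simps)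
  finally show ?thesis by simp
qed

lemma poisson_kernel_subordination:
  "poisson_kernel y j = (LINT t:{0<..}|lborel. subordinator y t * heat_kernel t j)"
  unfolding poisson_kernel_def subordinator_def mult.assoc set_integral_mult_right ..

text \<open>The Fourier formula of the heat kernel is averaged over the subordinator; Fubini applies
  because that density is integrable.\<close>
lemma poisson_kernel_fourier:
  assumes y: "0 < y"
  shows "poisson_kernel y j = cos_coeff (\<lambda>x. exp (- y * (2 * sin (x / 2)))) j"
proof -
  let ?F = "\<lambda>t x. indicator {0<..} t * subordinator y t *
    (indicator {0..pi} x * (exp (- ((2 * sin (x / 2))\<^sup>2) * t) * cos (real_of_int j * x)))"
  have meas: "(\<lambda>(t, x). ?F t x) \<in> borel_measurable (lborel \<Otimes>\<^sub>M lborel)"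
    unfolding subordinator_def by measurable
  have sub: "integrable lborel (\<lambda>t. indicator {0<..} t * subordinator y t)"
    using subordinator_integrable[OF y] by (simp add: set_integrable_def)
  have bd: "norm (?F t x) \<le> indicator {0<..} t * subordinator y t * indicator {0..pi} x" for t x
  proof (cases "0 < t \<and> x \<in> {0..pi}")
    case True
    have "exp (- ((2 * sin (x / 2))\<^sup>2) * t) * \<bar>cos (real_of_int j * x)\<bar> \<le> 1 * 1"
      using True by (intro mult_mono) auto
    then have "subordinator y t * (exp (- ((2 * sin (x / 2))\<^sup>2) * t) * \<bar>cos (real_of_int j * x)\<bar>) \<le> subordinator y t * (1 * 1)"
      using subordinator_nonneg[of y t] y by (intro mult_left_mono) auto
    then show ?thesis using True subordinator_nonneg[of y t] y by (simp add: abs_mult)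
  qed (auto simp: indicator_def)
  have inner: "integrable lborel (\<lambda>x. ?F t x)" for t
  proof (rule Bochner_Integration.integrable_bound)
    show "integrable lborel (\<lambda>x. indicator {0<..} t * subordinator y t * indicator {0..pi} x)" by simp
    show "AE x in lborel. norm (?F t x) \<le> norm (indicator {0<..} t * subordinator y t * indicator {0..pi} x)"
      by (intro AE_I2 order_trans[OF bd]) simp
  qed simp
  have int: "integrable (lborel \<Otimes>\<^sub>M lborel) (\<lambda>(t, x). ?F t x)"
  proof (rule lborel_pair.Fubini_integrable[OF meas])
    show "integrable lborel (\<lambda>t. LINT x|lborel. norm (case (t, x) of (t, x) \<Rightarrow> ?F t x))"
    proof (rule Bochner_Integration.integrable_bound[OF integrable_mult_left[OF sub, of pi]])
      show "(\<lambda>t. LINT x|lborel. norm (case (t, x) of (t, x) \<Rightarrow> ?F t x)) \<in> borel_measurable lborel"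
        using meas by measurable
      show "AE t in lborel. norm (LINT x|lborel. norm (case (t, x) of (t, x) \<Rightarrow> ?F t x)) \<le> norm (indicator {0<..} t * subordinator y t * pi)"
      proof (intro AE_I2)
        fix t
        have "(LINT x|lborel. norm (?F t x)) \<le> (LINT x|lborel. indicator {0<..} t * subordinator y t * indicator {0..pi} x)"
          by (intro integral_mono integrable_norm inner bd) auto
        then show "norm (LINT x|lborel. norm (case (t, x) of (t, x) \<Rightarrow> ?F t x)) \<le> norm (indicator {0<..} t * subordinator y t * pi)"
          by simp
      qed
    qed
  qed (use inner in auto)
  have "poisson_kernel y j = (LINT t|lborel. indicator {0<..} t * subordinator y t * heat_kernel t j)"
    by (simp add: poisson_kernel_subordination set_lebesgue_integral_def mult.assoc)
  also have "\<dots> = (LINT t|lborel. (1 / pi) * (LINT x|lborel. ?F t x))"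
  proof (intro Bochner_Integration.integral_cong refl)
    fix t
    show "indicator {0<..} t * subordinator y t * heat_kernel t j = (1 / pi) * (LINT x|lborel. ?F t x)"
    proof (cases "0 < t")
      case True
      then show ?thesis by (simp add: heat_kernel_fourier cos_coeff_def set_lebesgue_integral_def)
    qed simp
  qed
  also have "\<dots> = (1 / pi) * (LINT x|lborel. (LINT t|lborel. ?F t x))"
    using lborel_pair.Fubini_integral[OF int] by simp
  also have "(LINT x|lborel. (LINT t|lborel. ?F t x)) = (LINT x:{0..pi}|lborel. exp (- y * (2 * sin (x / 2))) * cos (real_of_int j * x))"
    unfolding set_lebesgue_integral_def
  proof (intro Bochner_Integration.integral_cong refl)
    fix x
    show "(LINT t|lborel. ?F t x) = indicator {0..pi} x *\<^sub>R (exp (- y * (2 * sin (x / 2))) * cos (real_of_int j * x))"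
    proof (cases "x \<in> {0..pi}")
      case True
      then have "0 \<le> 2 * sin (x / 2)" by (simp add: sin_ge_zero)
      from subordinator_laplace(2)[OF y this]
      have "(LINT t|lborel. indicator {0<..} t * subordinator y t * exp (- ((2 * sin (x / 2))\<^sup>2) * t)) = exp (- y * (2 * sin (x / 2)))"
        by (simp add: set_lebesgue_integral_def mult.assoc)
      then have "(LINT t|lborel. indicator {0<..} t * subordinator y t * exp (- ((2 * sin (x / 2))\<^sup>2) * t) * cos (real_of_int j * x))
          = exp (- y * (2 * sin (x / 2))) * cos (real_of_int j * x)"
        by (simp del: mult_minus_left)
      then show ?thesis using True by (simp add: mult.assoc)
    qed simp
  qed
  finally show ?thesis by (simp add: cos_coeff_def)
qed

lemma poisson_kernel_sums:
  assumes y: "0 < y"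
  shows "(\<lambda>i. y ^ i / fact i * ((- 1) ^ i * half_lap_coeff i j)) sums poisson_kernel y j"
proof -
  have "(\<lambda>i. (- y) ^ i / fact i * half_lap_coeff i j) sums poisson_kernel y j"
    unfolding half_lap_coeff_def poisson_kernel_fourier[OF y]
    by (rule cos_coeff_exp_sums) (intro continuous_intros, simp)
  moreover have "(- y) ^ i = y ^ i * (- 1) ^ i" for i by (subst power_minus) (rule mult.commute)
  ultimately show ?thesis by (simp add: mult.assoc)
qed

text \<open>The weight \<open>1 / (1 + j\<^sup>2)\<close> changes by a factor of at most
  \<open>3\<close> under a unit shift, so the Laplacian costs at most the factor \<open>3 + 2 + 3
  \<le> 3\<^sup>2\<close>; powers \<open>0\<close> and \<open>1\<close> are explicit.\<close>
lemma half_lap_coeff_bound: "\<bar>half_lap_coeff i j\<bar> \<le> 2 * 3 ^ i / (1 + (real_of_int j)\<^sup>2)"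
proof (induction i arbitrary: j rule: induct_nat_012)
  case 0
  show ?case by (simp add: half_lap_coeff_0)
next
  case 1
  show ?case
  proof (cases "j = 0")
    case True
    then show ?thesis using pi_gt3 by (simp add: half_lap_coeff_1[unfolded One_nat_def] divide_le_eq)
  next
    case False
    then have "1 \<le> \<bar>real_of_int j\<bar>" by linarith
    from one_le_power[OF this, of 2] have j: "1 \<le> (real_of_int j)\<^sup>2" by (simp only: power2_abs)
    then have "1 + (real_of_int j)\<^sup>2 \<le> 6 * (3 * ((real_of_int j)\<^sup>2 - 1 / 4))" by simp
    also have "\<dots> \<le> 6 * (pi * ((real_of_int j)\<^sup>2 - 1 / 4))"
      using j pi_gt3 by (intro mult_left_mono mult_right_mono) auto
    finally show ?thesis using j pi_gt3
      by (simp add: half_lap_coeff_1[unfolded One_nat_def] abs_divide abs_mult divide_simps)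
  qed
next
  case (ge2 i)
  define w where "w j = 1 / (1 + (real_of_int j)\<^sup>2)" for j
  have nb: "w (j + e) \<le> 3 * w j" if "e = 1 \<or> e = - 1" for j e
  proof -
    let ?x = "real_of_int j"
    have "1 + ?x\<^sup>2 \<le> 3 * (1 + (?x + 1)\<^sup>2)" "1 + ?x\<^sup>2 \<le> 3 * (1 + (?x - 1)\<^sup>2)"
      using zero_le_power2[of "2 * ?x + 3"] zero_le_power2[of "2 * ?x - 3"]
      by (auto simp: power2_eq_square algebra_simps)
    moreover have "0 < 1 + z\<^sup>2" for z :: real by (rule add_pos_nonneg) auto
    ultimately show ?thesis using that by (auto simp: w_def divide_simps)
  qed
  have b: "\<bar>half_lap_coeff i j\<bar> \<le> 2 * 3 ^ i * w j" for j using ge2(1)[of j] by (simp add: w_def)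
  have "\<bar>half_lap_coeff (Suc (Suc i)) j\<bar> \<le> \<bar>half_lap_coeff i (j - 1)\<bar> + 2 * \<bar>half_lap_coeff i j\<bar> + \<bar>half_lap_coeff i (j + 1)\<bar>"
    by (simp add: half_lap_coeff_Suc_Suc tri_def)
  also have "\<dots> \<le> 2 * 3 ^ i * (3 * w j) + 2 * (2 * 3 ^ i * w j) + 2 * 3 ^ i * (3 * w j)"
    by (intro add_mono mult_left_mono order_trans[OF b] nb[of "- 1" j, simplified] nb[of 1 j]) auto
  also have "\<dots> = 2 * (8 * 3 ^ i) * w j" by simp
  also have "\<dots> \<le> 2 * 3 ^ Suc (Suc i) * w j" by (intro mult_right_mono) (auto simp: w_def)
  finally show ?case by (simp add: w_def)
qed

section \<open>The Poisson semigroup as an exponential series\<close>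

definition half_lap_pow :: "nat \<Rightarrow> (int \<Rightarrow> real) \<Rightarrow> int \<Rightarrow> real" where
  "half_lap_pow i f n = (\<Sum>\<^sub>\<infinity>j. half_lap_coeff i j * f (n - j))"

definition poisson_norm :: "(int \<Rightarrow> real) \<Rightarrow> real" where
  "poisson_norm f = (\<Sum>\<^sub>\<infinity>j. \<bar>f j\<bar> / (1 + (real_of_int j)\<^sup>2))"

lemma one_plus_square_pos: "0 < 1 + (x::real)\<^sup>2"
  by (rule add_pos_nonneg) auto

text \<open>A shift by \<open>n\<close> changes the weight of Poisson summability only by a factor
  depending on \<open>n\<close>.\<close>
lemma peetre: "1 / (1 + (real_of_int j)\<^sup>2) \<le> 2 * (1 + (real_of_int n)\<^sup>2) / (1 + (real_of_int (n - j))\<^sup>2)"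
proof -
  let ?n = "real_of_int n" and ?j = "real_of_int j"
  have "(?n - ?j)\<^sup>2 \<le> 2 * ?n\<^sup>2 + 2 * ?j\<^sup>2"
    using zero_le_power2[of "?n + ?j"] by (simp add: power2_eq_square algebra_simps)
  moreover have "0 \<le> ?n\<^sup>2 * ?j\<^sup>2" by simp
  ultimately have *: "(?n - ?j)\<^sup>2 \<le> 2 * ?n\<^sup>2 + 2 * ?j\<^sup>2" "0 \<le> ?n\<^sup>2 * ?j\<^sup>2" .
  have "1 + (?n - ?j)\<^sup>2 \<le> 2 * (1 + ?n\<^sup>2) * (1 + ?j\<^sup>2)"
  proof -
    have "2 * (1 + ?n\<^sup>2) * (1 + ?j\<^sup>2) = 2 + 2 * ?n\<^sup>2 + 2 * ?j\<^sup>2 + 2 * (?n\<^sup>2 * ?j\<^sup>2)"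
      by (simp add: algebra_simps)
    with * show ?thesis by linarith
  qed
  then show ?thesis using one_plus_square_pos[of ?j] one_plus_square_pos[of "?n - ?j"]
    by (simp add: pos_le_divide_eq pos_divide_le_eq)
qed

lemma poisson_summable_iff: "poisson_summable f \<longleftrightarrow> (\<lambda>j. \<bar>f j\<bar> / (1 + (real_of_int j)\<^sup>2)) summable_on UNIV"
  for f :: "int \<Rightarrow> real"
  by (simp add: poisson_summable_def)

lemma bij_reflect: "bij_betw (\<lambda>j. n - j) UNIV (UNIV :: int set)"
  by (rule bij_betwI[of _ _ _ "\<lambda>j. n - j"]) auto

lemma poisson_summable_reflect:
  assumes f: "poisson_summable f"
  shows "(\<lambda>j. \<bar>f (n - j)\<bar> / (1 + (real_of_int j)\<^sup>2)) summable_on UNIV"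
    and "(\<Sum>\<^sub>\<infinity>j. \<bar>f (n - j)\<bar> / (1 + (real_of_int j)\<^sup>2)) \<le> 2 * (1 + (real_of_int n)\<^sup>2) * poisson_norm f"
proof -
  let ?w = "\<lambda>j. \<bar>f j\<bar> / (1 + (real_of_int j)\<^sup>2)"
  have "(\<lambda>j. ?w (n - j)) summable_on UNIV"
    using f summable_on_reindex_bij_betw[OF bij_reflect, of ?w n] by (simp add: poisson_summable_iff)
  then have s: "(\<lambda>j. 2 * (1 + (real_of_int n)\<^sup>2) * ?w (n - j)) summable_on UNIV"
    by (rule summable_on_cmult_right)
  have le: "\<bar>f (n - j)\<bar> / (1 + (real_of_int j)\<^sup>2) \<le> 2 * (1 + (real_of_int n)\<^sup>2) * ?w (n - j)" for j
    using mult_left_mono[OF peetre[of j n], of "\<bar>f (n - j)\<bar>"] by (simp add: mult_ac)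
  show s1: "(\<lambda>j. \<bar>f (n - j)\<bar> / (1 + (real_of_int j)\<^sup>2)) summable_on UNIV"
    by (rule summable_on_comparison_test[OF s le]) (simp add: add_nonneg_nonneg)
  have "(\<Sum>\<^sub>\<infinity>j. \<bar>f (n - j)\<bar> / (1 + (real_of_int j)\<^sup>2)) \<le> (\<Sum>\<^sub>\<infinity>j. 2 * (1 + (real_of_int n)\<^sup>2) * ?w (n - j))"
    by (rule infsum_mono[OF s1 s]) (rule le)
  also have "\<dots> = 2 * (1 + (real_of_int n)\<^sup>2) * (\<Sum>\<^sub>\<infinity>j. ?w (n - j))"
    by (rule infsum_cmult_right')
  also have "(\<Sum>\<^sub>\<infinity>j. ?w (n - j)) = poisson_norm f"
    unfolding poisson_norm_def by (rule infsum_reindex_bij_betw[OF bij_reflect])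
  finally show "(\<Sum>\<^sub>\<infinity>j. \<bar>f (n - j)\<bar> / (1 + (real_of_int j)\<^sup>2)) \<le> 2 * (1 + (real_of_int n)\<^sup>2) * poisson_norm f" .
qed

lemma poisson_norm_nonneg: "0 \<le> poisson_norm f"
  unfolding poisson_norm_def by (intro infsum_nonneg) (simp add: add_nonneg_nonneg)

lemma poisson_summable_growth:
  assumes f: "poisson_summable f"
  shows "\<bar>f n\<bar> \<le> poisson_norm f * (1 + (real_of_int n)\<^sup>2)"
proof -
  have "(\<Sum>j\<in>{n}. \<bar>f j\<bar> / (1 + (real_of_int j)\<^sup>2)) \<le> poisson_norm f"
    unfolding poisson_norm_def
    by (rule finite_sum_le_infsum) (use f in \<open>auto simp: poisson_summable_iff add_nonneg_nonneg\<close>)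
  then show ?thesis using one_plus_square_pos[of "real_of_int n"] by (simp add: pos_divide_le_eq)
qed

lemma half_lap_coeff_mult_bound:
  "\<bar>half_lap_coeff i j * x\<bar> \<le> 2 * 3 ^ i * (\<bar>x\<bar> / (1 + (real_of_int j)\<^sup>2))"
  using mult_right_mono[OF half_lap_coeff_bound[of i j], of "\<bar>x\<bar>"] by (simp add: abs_mult)

lemma half_lap_summable:
  assumes f: "poisson_summable f"
  shows "(\<lambda>j. \<bar>half_lap_coeff i j * f (n - j)\<bar>) summable_on UNIV"
  by (rule summable_on_comparison_test[OF summable_on_cmult_right[OF poisson_summable_reflect(1)[OF f]]])
     (rule half_lap_coeff_mult_bound, simp)

lemma half_lap_has_sum:
  assumes f: "poisson_summable f"
  shows "((\<lambda>j. half_lap_coeff i j * f (n - j)) has_sum half_lap_pow i f n) UNIV"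
proof -
  have "(\<lambda>j. norm (half_lap_coeff i j * f (n - j))) summable_on UNIV"
    using half_lap_summable[OF f] by simp
  then show ?thesis unfolding half_lap_pow_def using Infinite_Sum.abs_summable_summable by fastforce
qed

lemma half_lap_pow_bound:
  assumes f: "poisson_summable f"
  shows "\<bar>half_lap_pow i f n\<bar> \<le> (4 * poisson_norm f * (1 + (real_of_int n)\<^sup>2)) * 3 ^ i"
proof -
  have "\<bar>half_lap_pow i f n\<bar> \<le> (\<Sum>\<^sub>\<infinity>j. \<bar>half_lap_coeff i j * f (n - j)\<bar>)"
    unfolding half_lap_pow_def using norm_infsum_bound[of "\<lambda>j. half_lap_coeff i j * f (n - j)" UNIV] half_lap_summable[OF f] by simp
  also have "\<dots> \<le> (\<Sum>\<^sub>\<infinity>j. 2 * 3 ^ i * (\<bar>f (n - j)\<bar> / (1 + (real_of_int j)\<^sup>2)))"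
    by (rule infsum_mono[OF half_lap_summable[OF f] summable_on_cmult_right[OF poisson_summable_reflect(1)[OF f]]])
       (rule half_lap_coeff_mult_bound)
  also have "\<dots> = 2 * 3 ^ i * (\<Sum>\<^sub>\<infinity>j. \<bar>f (n - j)\<bar> / (1 + (real_of_int j)\<^sup>2))"
    by (rule infsum_cmult_right')
  also have "\<dots> \<le> 2 * 3 ^ i * (2 * (1 + (real_of_int n)\<^sup>2) * poisson_norm f)"
    by (intro mult_left_mono poisson_summable_reflect(2) f) auto
  also have "\<dots> = (4 * poisson_norm f * (1 + (real_of_int n)\<^sup>2)) * 3 ^ i"
    by (simp add: algebra_simps)
  finally show ?thesis .
qed

lemma half_lap_pow_0:
  assumes "poisson_summable f"
  shows "half_lap_pow 0 f n = f n"
proof -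
  have "((\<lambda>j. half_lap_coeff 0 j * f (n - j)) has_sum f n) UNIV"
    using has_sum_finite_neutralI[of "{0}" UNIV "\<lambda>j. half_lap_coeff 0 j * f (n - j)" "f n"]
    by (simp add: half_lap_coeff_0)
  then show ?thesis using half_lap_has_sum[OF assms] has_sum_unique by blast
qed

lemma half_lap_pow_Suc_Suc:
  assumes f: "poisson_summable f"
  shows "half_lap_pow (Suc (Suc i)) f n = - lap (half_lap_pow i f) n"
proof -
  have sh: "((\<lambda>j. half_lap_coeff i (j + e) * f (n - j)) has_sum half_lap_pow i f (n + e)) UNIV" for e
  proof -
    have "((\<lambda>j. half_lap_coeff i (j + e) * f (n - j)) has_sum half_lap_pow i f (n + e)) UNIV \<longleftrightarrow>
      ((\<lambda>j. half_lap_coeff i j * f (n + e - j)) has_sum half_lap_pow i f (n + e)) UNIV"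
      by (rule has_sum_reindex_bij_witness[of _ "\<lambda>j. j - e" "\<lambda>j. j + e"]) (auto simp: algebra_simps)
    then show ?thesis using half_lap_has_sum[OF f] by simp
  qed
  have "((\<lambda>j. (- 1) * (half_lap_coeff i (j + - 1) * f (n - j)) + 2 * (half_lap_coeff i (j + 0) * f (n - j))
     + (- 1) * (half_lap_coeff i (j + 1) * f (n - j))) has_sum
     ((- 1) * half_lap_pow i f (n + - 1) + 2 * half_lap_pow i f (n + 0) + (- 1) * half_lap_pow i f (n + 1))) UNIV"
    by (intro has_sum_add has_sum_cmult_right sh)
  moreover have "(- 1) * (half_lap_coeff i (j + - 1) * f (n - j)) + 2 * (half_lap_coeff i (j + 0) * f (n - j))
     + (- 1) * (half_lap_coeff i (j + 1) * f (n - j)) = half_lap_coeff (Suc (Suc i)) j * f (n - j)" for j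
    by (simp add: half_lap_coeff_Suc_Suc tri_def algebra_simps)
  moreover have "(- 1) * half_lap_pow i f (n + - 1) + 2 * half_lap_pow i f (n + 0) + (- 1) * half_lap_pow i f (n + 1)
     = - lap (half_lap_pow i f) n"
    by (simp add: tri_def)
  ultimately have "((\<lambda>j. half_lap_coeff (Suc (Suc i)) j * f (n - j)) has_sum - lap (half_lap_pow i f) n) UNIV"
    by simp
  then show ?thesis using half_lap_has_sum[OF f] has_sum_unique by blast
qed

lemma half_lap_pow_lap:
  assumes f: "poisson_summable f"
  shows "half_lap_pow i (lap f) n = lap (half_lap_pow i f) n"
proof -
  have sh: "((\<lambda>j. half_lap_coeff i j * f (n - j + e)) has_sum half_lap_pow i f (n + e)) UNIV" for e
    using half_lap_has_sum[OF f, of i "n + e"] by (simp add: algebra_simps)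
  have "((\<lambda>j. half_lap_coeff i j * f (n - j + - 1) + (- 2) * (half_lap_coeff i j * f (n - j + 0))
     + half_lap_coeff i j * f (n - j + 1)) has_sum
     (half_lap_pow i f (n + - 1) + (- 2) * half_lap_pow i f (n + 0) + half_lap_pow i f (n + 1))) UNIV"
    by (intro has_sum_add has_sum_cmult_right sh)
  moreover have "half_lap_coeff i j * f (n - j + - 1) + (- 2) * (half_lap_coeff i j * f (n - j + 0))
     + half_lap_coeff i j * f (n - j + 1) = half_lap_coeff i j * lap f (n - j)" for j
    by (simp add: tri_def algebra_simps)
  moreover have "half_lap_pow i f (n + - 1) + (- 2) * half_lap_pow i f (n + 0) + half_lap_pow i f (n + 1) = lap (half_lap_pow i f) n"
    by (simp add: tri_def)
  ultimately have "((\<lambda>j. half_lap_coeff i j * lap f (n - j)) has_sum lap (half_lap_pow i f) n) UNIV"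
    by simp
  then show ?thesis unfolding half_lap_pow_def[of i "lap f"] by (rule infsumI)
qed

text \<open>The \<open>l\<close>-th \<open>y\<close>-derivative of the Poisson extension. As a power
  series it is defined at \<open>y = 0\<close> too, where the Taylor expansions below start.\<close>
definition poisson_deriv :: "nat \<Rightarrow> (int \<Rightarrow> real) \<Rightarrow> real \<Rightarrow> int \<Rightarrow> real" where
  "poisson_deriv l f y n = egf (\<lambda>i. (- 1) ^ (i + l) * half_lap_pow (i + l) f n) y"

lemma signed_half_lap_bound:
  assumes f: "poisson_summable f"
  shows "\<bar>(- 1) ^ i * half_lap_pow i f n\<bar> \<le> (4 * poisson_norm f * (1 + (real_of_int n)\<^sup>2)) * 3 ^ i"
  using half_lap_pow_bound[OF f, of i n] by (simp add: abs_mult)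

lemma signed_half_lap_shift_bound:
  assumes f: "poisson_summable f"
  shows "\<bar>(- 1) ^ (i + l) * half_lap_pow (i + l) f n\<bar> \<le> (4 * poisson_norm f * (1 + (real_of_int n)\<^sup>2) * 3 ^ l) * 3 ^ i"
  using signed_half_lap_bound[OF f, of "i + l" n] by (simp add: power_add mult_ac)

lemma poisson_deriv_has_derivative:
  assumes f: "poisson_summable f"
  shows "((\<lambda>y. poisson_deriv l f y n) has_real_derivative poisson_deriv (Suc l) f y n) (at y)"
  unfolding poisson_deriv_def[abs_def]
  by (rule egf_iterated_has_derivative[OF signed_half_lap_bound[OF f]])

lemma poisson_deriv_at_0: "poisson_deriv l f 0 n = (- 1) ^ l * half_lap_pow l f n"
  by (simp add: poisson_deriv_def)

text \<open>The extension is harmonic in \<open>(y, n)\<close>, because the square of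
  \<open>\<surd>(-\<Delta>)\<close> is \<open>-\<Delta>\<close>.\<close>
lemma poisson_deriv_Suc_Suc:
  assumes f: "poisson_summable f"
  shows "poisson_deriv (Suc (Suc l)) f y n = - lap (poisson_deriv l f y) n"
proof -
  let ?c = "\<lambda>n i. (- 1) ^ (i + l) * half_lap_pow (i + l) f n"
  have s: "(\<lambda>i. y ^ i / fact i * ?c n i) sums poisson_deriv l f y n" for n
    unfolding poisson_deriv_def by (rule egf_sums[OF signed_half_lap_shift_bound[OF f]])
  have "(\<lambda>i. - (1 * (y ^ i / fact i * ?c (n - 1) i) + (- 2) * (y ^ i / fact i * ?c n i) + 1 * (y ^ i / fact i * ?c (n + 1) i)))
     sums (- lap (poisson_deriv l f y) n)"
    unfolding tri_def by (intro sums_minus sums_add sums_mult s)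
  moreover have "- (1 * (y ^ i / fact i * ?c (n - 1) i) + (- 2) * (y ^ i / fact i * ?c n i) + 1 * (y ^ i / fact i * ?c (n + 1) i))
      = y ^ i / fact i * ((- 1) ^ (i + Suc (Suc l)) * half_lap_pow (i + Suc (Suc l)) f n)" for i
    by (simp add: half_lap_pow_Suc_Suc[OF f] tri_def algebra_simps)
  ultimately show ?thesis
    unfolding poisson_deriv_def[of "Suc (Suc l)"] egf_def by (simp add: sums_iff)
qed

lemma poisson_kernel_has_sum:
  assumes f: "poisson_summable f" and y: "0 < y"
  shows "((\<lambda>j. poisson_kernel y j * f (n - j)) has_sum poisson_deriv 0 f y n) UNIV"
proof -
  let ?a = "\<lambda>j i. y ^ i / fact i * ((- 1) ^ i * half_lap_coeff i j) * f (n - j)"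
  have dom: "\<bar>?a j i\<bar> \<le> (\<bar>f (n - j)\<bar> / (1 + (real_of_int j)\<^sup>2)) * (2 * ((3 * y) ^ i / fact i))" for j i
  proof -
    have "\<bar>?a j i\<bar> = (y ^ i / fact i) * \<bar>half_lap_coeff i j * f (n - j)\<bar>"
      using y by (simp add: abs_mult)
    also have "\<dots> \<le> (y ^ i / fact i) * (2 * 3 ^ i * (\<bar>f (n - j)\<bar> / (1 + (real_of_int j)\<^sup>2)))"
      using y by (intro mult_left_mono half_lap_coeff_mult_bound) auto
    finally show ?thesis by (simp add: power_mult_distrib mult_ac)
  qed
  have x: "(\<lambda>j. \<bar>f (n - j)\<bar> / (1 + (real_of_int j)\<^sup>2)) summable_on UNIV"
    by (rule poisson_summable_reflect(1)[OF f])
  have "summable (\<lambda>i. 2 * ((3 * y) ^ i / fact i))" by (intro summable_mult summable_exp_real)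
  then have yy: "(\<lambda>i. 2 * ((3 * y) ^ i / fact i)) summable_on UNIV"
    by (rule summable_nonneg_imp_summable_on) (use y in auto)
  have pos: "0 \<le> \<bar>f (n - j)\<bar> / (1 + (real_of_int j)\<^sup>2)" "0 \<le> 2 * ((3 * y) ^ i / fact i)" for i j
    using y by (simp_all add: add_nonneg_nonneg)
  note ds = double_sum_dominated[OF dom x yy pos]
  have "(\<Sum>\<^sub>\<infinity>i. ?a j i) = poisson_kernel y j * f (n - j)" for j
    using has_sum_imp_sums[OF has_sum_infsum[OF ds(4)[of j]]]
      sums_mult2[OF poisson_kernel_sums[OF y, of j], of "f (n - j)"] sums_unique2 by blast
  moreover have "(\<Sum>\<^sub>\<infinity>j. ?a j i) = y ^ i / fact i * ((- 1) ^ i * half_lap_pow i f n)" for i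
    unfolding half_lap_pow_def infsum_cmult_right'[symmetric] by (simp only: mult.assoc)
  ultimately have 1: "((\<lambda>j. poisson_kernel y j * f (n - j)) has_sum (\<Sum>\<^sub>\<infinity>(j, i). ?a j i)) UNIV"
    and 2: "((\<lambda>i. y ^ i / fact i * ((- 1) ^ i * half_lap_pow i f n)) has_sum (\<Sum>\<^sub>\<infinity>(j, i). ?a j i)) UNIV"
    using ds(2,3) by simp_all
  have "poisson_deriv 0 f y n = (\<Sum>\<^sub>\<infinity>(j, i). ?a j i)"
    unfolding poisson_deriv_def egf_def using has_sum_imp_sums[OF 2] by (simp add: sums_iff)
  with 1 show ?thesis by simp
qed

lemma poisson_semigroup_eq:
  assumes f: "poisson_summable f" and y: "0 < y"
  shows "poisson_semigroup y (\<lambda>n. complex_of_real (f n)) n = complex_of_real (poisson_deriv 0 f y n)"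
proof -
  have "((\<lambda>j. complex_of_real (poisson_kernel y j * f (n - j))) has_sum complex_of_real (poisson_deriv 0 f y n)) UNIV"
    using has_sum_bounded_linear[OF bounded_linear_of_real poisson_kernel_has_sum[OF f y]] by (simp add: o_def)
  then show ?thesis unfolding poisson_semigroup_def by (intro infsumI) simp
qed

definition poisson_decay :: "real \<Rightarrow> nat \<Rightarrow> (int \<Rightarrow> real) \<Rightarrow> bool" where
  "poisson_decay a l f \<longleftrightarrow> (\<exists>C. \<forall>y>0. \<forall>n. \<bar>poisson_deriv l f y n\<bar> \<le> C * y powr (a - real l))"

lemma Lambda_P_iff:
  assumes f: "poisson_summable f"
  shows "(\<lambda>n. complex_of_real (f n)) \<in> Lambda_P a \<longleftrightarrow> poisson_decay a (nat \<lfloor>a\<rfloor> + 1) f"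
proof -
  define l where "l = nat \<lfloor>a\<rfloor> + 1"
  have nd: "nth_derivative l (\<lambda>y. poisson_semigroup y (\<lambda>n. complex_of_real (f n)) n) y = complex_of_real (poisson_deriv l f y n)"
    if y: "0 < y" for y n
  proof (rule nth_derivative_eqI[where S = "{0<..}" and \<phi> = "\<lambda>i y. complex_of_real (poisson_deriv i f y n)"])
    show "((\<lambda>y. complex_of_real (poisson_deriv i f y n)) has_vector_derivative complex_of_real (poisson_deriv (Suc i) f y n)) (at y)" for i y
      by (rule has_vector_derivative_of_real)
         (use poisson_deriv_has_derivative[OF f] in \<open>simp add: has_real_derivative_iff_has_vector_derivative\<close>)
  qed (use y f in \<open>auto simp: poisson_semigroup_eq\<close>)
  have ps: "poisson_summable (\<lambda>n. complex_of_real (f n))" using f by (simp add: poisson_summable_def)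
  have e: "- real l + a = a - real l" by simp
  have "(\<exists>C>0. \<forall>y>0. sup_norm (\<lambda>n. nth_derivative l (\<lambda>y. poisson_semigroup y (\<lambda>n. complex_of_real (f n)) n) y) \<le> ennreal (C * y powr (- real l + a)))
    \<longleftrightarrow> (\<exists>C>0. \<forall>y>0. \<forall>n. \<bar>poisson_deriv l f y n\<bar> \<le> C * y powr (a - real l))"
    unfolding e by (intro ex_cong1 conj_cong refl all_cong1 imp_cong) (simp add: sup_norm_le_iff nd)
  also have "\<dots> \<longleftrightarrow> poisson_decay a l f"
    unfolding poisson_decay_def by (rule positive_constant_iff) simp
  finally show ?thesis unfolding Lambda_P_def mem_Collect_eq Let_def l_def using ps by simp
qed

section \<open>From Poisson decay to heat decay\<close>

lemma heat_cmult: "exp_growth g \<Longrightarrow> heat t (\<lambda>n. c * g n) n = c * heat t g n"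
  using exp_tri_linear[OF _ exp_growth_const[of 0], of g t "- 2 * t" t c 0 n] by (simp add: heat_def)

lemma square_powr: "0 < s \<Longrightarrow> (s\<^sup>2) powr x = s powr (2 * x)" for s x :: real
  using powr_powr[of s 2 x] by simp

lemma tri_pow_cmult: "(tri p q r ^^ k) (\<lambda>n. c * f n) = (\<lambda>n. c * (tri p q r ^^ k) f n)"
  using tri_pow_linear[of k p q r c f 0 f] by simp

lemma one_plus_square_le_exp: "1 + (real_of_int n)\<^sup>2 \<le> 2 * exp (1 * \<bar>real_of_int n\<bar>)"
  using exp_lower_Taylor_quadratic[of "\<bar>real_of_int n\<bar>"] by simp

lemma half_lap_pow_exp_bound:
  assumes f: "poisson_summable f"
  shows "\<bar>half_lap_pow i f n\<bar> \<le> (8 * poisson_norm f * 3 ^ i) * exp (1 * \<bar>real_of_int n\<bar>)"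
proof -
  have "\<bar>half_lap_pow i f n\<bar> \<le> (4 * poisson_norm f * 3 ^ i) * (1 + (real_of_int n)\<^sup>2)"
    using half_lap_pow_bound[OF f, of i n] by (simp only: mult_ac)
  also have "\<dots> \<le> (4 * poisson_norm f * 3 ^ i) * (2 * exp (1 * \<bar>real_of_int n\<bar>))"
    using poisson_norm_nonneg[of f] by (intro mult_left_mono one_plus_square_le_exp) auto
  finally show ?thesis by simp
qed

lemma exp_growth_half_lap_pow: "poisson_summable f \<Longrightarrow> exp_growth (half_lap_pow i f)"
  by (rule exp_growthI[OF half_lap_pow_exp_bound]) (auto simp: poisson_norm_nonneg)

lemma poisson_summable_exp_growth: "poisson_summable f \<Longrightarrow> exp_growth f"
  using exp_growth_half_lap_pow[of f 0] by (simp add: half_lap_pow_0 exp_growth_def)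

text \<open>The heat flow at time \<open>t\<close> of the \<open>l\<close>-th derivative of the
  Poisson extension (see \<open>heat_poisson_eq\<close>), written as a power series in
  \<open>y\<close> so that it can be differentiated termwise.\<close>
definition heat_poisson :: "real \<Rightarrow> nat \<Rightarrow> (int \<Rightarrow> real) \<Rightarrow> real \<Rightarrow> int \<Rightarrow> real" where
  "heat_poisson t l f y n = egf (\<lambda>i. (- 1) ^ (i + l) * heat t (half_lap_pow (i + l) f) n) y"

lemma heat_half_lap_bound:
  assumes f: "poisson_summable f"
  shows "\<exists>K. \<forall>i. \<bar>(- 1) ^ i * heat t (half_lap_pow i f) n\<bar> \<le> K * 3 ^ i"
proof (intro exI allI)
  fix i
  show "\<bar>(- 1) ^ i * heat t (half_lap_pow i f) n\<bar> \<le>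
      (8 * poisson_norm f * exp ((\<bar>t\<bar> + \<bar>- 2 * t\<bar> + \<bar>t\<bar>) * exp 1) * exp (1 * \<bar>real_of_int n\<bar>)) * 3 ^ i"
    using exp_tri_bound[OF half_lap_pow_exp_bound[OF f, of i], of t "- 2 * t" t n] poisson_norm_nonneg[of f]
    by (simp add: heat_def abs_mult mult_ac)
qed

lemma heat_poisson_has_derivative:
  assumes f: "poisson_summable f"
  shows "((\<lambda>y. heat_poisson t l f y n) has_real_derivative heat_poisson t (Suc l) f y n) (at y)"
proof -
  obtain K where "\<And>i. \<bar>(- 1) ^ i * heat t (half_lap_pow i f) n\<bar> \<le> K * 3 ^ i"
    using heat_half_lap_bound[OF f] by blast
  then show ?thesis unfolding heat_poisson_def[abs_def] by (rule egf_iterated_has_derivative)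
qed

lemma heat_poisson_eq:
  assumes f: "poisson_summable f"
  shows "heat_poisson t l f y n = heat t (poisson_deriv l f y) n"
proof -
  let ?g = "\<lambda>i n. y ^ i / fact i * ((- 1) ^ (i + l) * half_lap_pow (i + l) f n)"
  have dom: "\<bar>?g i n\<bar> \<le> ((\<bar>y\<bar> * 3) ^ i / fact i) * ((8 * poisson_norm f * 3 ^ l) * exp (1 * \<bar>real_of_int n\<bar>))" for i n
  proof -
    have "\<bar>?g i n\<bar> = (\<bar>y\<bar> ^ i / fact i) * \<bar>half_lap_pow (i + l) f n\<bar>" by (simp add: abs_mult power_abs)
    also have "\<dots> \<le> (\<bar>y\<bar> ^ i / fact i) * ((8 * poisson_norm f * 3 ^ (i + l)) * exp (1 * \<bar>real_of_int n\<bar>))"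
      by (intro mult_left_mono half_lap_pow_exp_bound f) auto
    finally show ?thesis by (simp add: power_add power_mult_distrib mult_ac)
  qed
  have "(\<lambda>i. exp_tri t (- 2 * t) t (?g i) n) sums exp_tri t (- 2 * t) t (\<lambda>n. \<Sum>i. ?g i n) n"
  proof (rule exp_tri_suminf[OF dom])
    show "summable (\<lambda>i. (\<bar>y\<bar> * 3) ^ i / fact i)" by (rule summable_exp_real)
  qed (auto simp: poisson_norm_nonneg)
  moreover have "(\<lambda>n. \<Sum>i. ?g i n) = poisson_deriv l f y"
    by (rule ext) (simp add: poisson_deriv_def egf_def)
  moreover have "exp_tri t (- 2 * t) t (?g i) n = y ^ i / fact i * ((- 1) ^ (i + l) * heat t (half_lap_pow (i + l) f) n)" for i
    using heat_cmult[OF exp_growth_half_lap_pow[OF f], of t "y ^ i / fact i * (- 1) ^ (i + l)" "i + l" n]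
    by (simp add: heat_def mult.assoc)
  ultimately show ?thesis
    unfolding heat_poisson_def egf_def by (simp add: heat_def sums_iff)
qed

lemma poisson_deriv_add_even:
  assumes f: "poisson_summable f"
  shows "poisson_deriv (l + 2 * b) f y = (\<lambda>n. (- 1) ^ b * (lap ^^ b) (poisson_deriv l f y) n)"
proof (induction b)
  case (Suc b)
  have "poisson_deriv (l + 2 * Suc b) f y = (\<lambda>n. - lap (poisson_deriv (l + 2 * b) f y) n)"
    using poisson_deriv_Suc_Suc[OF f, of "l + 2 * b" y] by (auto simp: fun_eq_iff)
  then show ?case
    using tri_pow_cmult[of 1 1 "- 2" 1 "(- 1) ^ b" "(lap ^^ b) (poisson_deriv l f y)"] by (simp add: Suc)
qed simp

lemma half_lap_pow_even:
  assumes f: "poisson_summable f"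
  shows "half_lap_pow (2 * b) f = (\<lambda>n. (- 1) ^ b * (lap ^^ b) f n)"
proof -
  have "poisson_deriv 0 f 0 = f"
    by (rule ext) (simp add: poisson_deriv_at_0 half_lap_pow_0[OF f])
  moreover have "poisson_deriv (0 + 2 * b) f 0 = half_lap_pow (2 * b) f"
    by (rule ext) (simp add: poisson_deriv_at_0)
  ultimately show ?thesis using poisson_deriv_add_even[OF f, of 0 b 0] by simp
qed

lemma heat_lap_smoothing:
  assumes f: "\<And>n. \<bar>f n\<bar> \<le> B" and t: "0 < t"
  shows "\<bar>heat t ((lap ^^ b) f) n\<bar> \<le> sqrt (real (2 * b) ^ (2 * b)) * B * t powr (- real b)"
  using heat_smoothing[of f B t "2 * b" "n - int b", OF f t] heat_tri_pow[OF exp_growth_bounded[of f B, OF f], of b 1 "- 2" 1 t n]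
  by (simp add: lap_pow_eq_delta)

text \<open>An even number of \<open>y\<close>-derivatives is a power of the Laplacian, which the
  heat flow smooths.\<close>
lemma heat_poisson_even_bound:
  assumes f: "poisson_summable f" and B: "\<And>n. \<bar>poisson_deriv l f y n\<bar> \<le> B" and t: "0 < t"
  shows "\<bar>heat_poisson t (l + 2 * b) f y n\<bar> \<le> sqrt (real (2 * b) ^ (2 * b)) * B * t powr (- real b)"
proof -
  have eg: "exp_growth (poisson_deriv l f y)" by (rule exp_growth_bounded[OF B])
  have "heat_poisson t (l + 2 * b) f y n = (- 1) ^ b * heat t ((lap ^^ b) (poisson_deriv l f y)) n"
    unfolding heat_poisson_eq[OF f] poisson_deriv_add_even[OF f]
    by (rule heat_cmult[OF exp_growth_tri_pow[OF eg]])
  then show ?thesis using heat_lap_smoothing[of "poisson_deriv l f y" B t b n, OF B t] by (simp add: abs_mult)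
qed

text \<open>Derivatives whose order differs from \<open>l\<close> by an even number are bounded on
  \<open>[s, \<infinity>)\<close> by \<open>heat_poisson_even_bound\<close>. The others are
  interpolated between their neighbours, as in Landau's inequality, by two applications of the mean
  value theorem on \<open>[s, 2 s]\<close>.\<close>
lemma heat_poisson_bound_at_sqrt:
  assumes f: "poisson_summable f" and dec: "poisson_decay a l f" and al: "a \<le> real l" and j: "l \<le> j"
  shows "\<exists>c. \<forall>s>0. \<forall>n. \<bar>heat_poisson (s\<^sup>2) j f s n\<bar> \<le> c * s powr (a - real j)"
proof -
  obtain C where C: "\<And>y n. 0 < y \<Longrightarrow> \<bar>poisson_deriv l f y n\<bar> \<le> C * y powr (a - real l)"
    using dec unfolding poisson_decay_def by blast
  have C0: "0 \<le> C" using order_trans[OF abs_ge_zero C[of 1 0]] by simp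
  define q where "q b = sqrt (real (2 * b) ^ (2 * b)) * C" for b
  have q0: "0 \<le> q b" for b using C0 by (simp add: q_def)
  have even: "\<bar>heat_poisson (s\<^sup>2) (l + 2 * b) f y n\<bar> \<le> q b * s powr (a - real (l + 2 * b))"
    if s: "0 < s" and y: "s \<le> y" for s y b n
  proof -
    have "\<bar>poisson_deriv l f y m\<bar> \<le> C * s powr (a - real l)" for m
    proof -
      have "y powr (a - real l) \<le> s powr (a - real l)" using s y al by (intro powr_mono2') auto
      from mult_left_mono[OF this C0] C[of y m] s y show ?thesis by linarith
    qed
    from heat_poisson_even_bound[OF f this, of "s\<^sup>2" b n] s
    have "\<bar>heat_poisson (s\<^sup>2) (l + 2 * b) f y n\<bar> \<le> q b * (s powr (a - real l) * (s\<^sup>2) powr (- real b))"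
      by (simp add: q_def mult.assoc)
    also have "(s\<^sup>2) powr (- real b) = s powr (- real (2 * b))"
      using square_powr[OF s, of "- real b"] by simp
    also have "s powr (a - real l) * s powr (- real (2 * b)) = s powr (a - real (l + 2 * b))"
      unfolding powr_add[symmetric] by (simp add: algebra_simps)
    finally show ?thesis .
  qed
  show ?thesis
  proof (cases "even (j - l)")
    case True
    then obtain b where "j = l + 2 * b" using j by (metis dvdE le_add_diff_inverse)
    then show ?thesis using even by (intro exI[of _ "q b"]) auto
  next
    case False
    then obtain b where jb: "j = l + 2 * b + 1" using j by (metis add.assoc le_add_diff_inverse oddE)
    show ?thesis
    proof (intro exI[of _ "2 * q b + q (Suc b)"] allI impI)
      fix s :: real and n assume s: "0 < s"
      let ?\<phi> = "\<lambda>i y. heat_poisson (s\<^sup>2) i f y n"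
      note d = heat_poisson_has_derivative[OF f]
      obtain z where z: "s < z" "z < 2 * s" "?\<phi> (l + 2 * b) (2 * s) - ?\<phi> (l + 2 * b) s = (2 * s - s) * ?\<phi> j z"
        using MVT2[of s "2 * s" "?\<phi> (l + 2 * b)" "?\<phi> j"] s d[of "s\<^sup>2" "l + 2 * b" n] by (auto simp: jb)
      obtain z' where z': "s < z'" "z' < z" "?\<phi> j z - ?\<phi> j s = (z - s) * ?\<phi> (Suc j) z'"
        using MVT2[of s z "?\<phi> j" "?\<phi> (Suc j)"] z(1) d[of "s\<^sup>2" j n] by auto
      have sj: "s powr (a - real (l + 2 * b)) = s * s powr (a - real j)" "s * s powr (a - real (l + 2 * Suc b)) = s powr (a - real j)"
      proof -
        have P: "s * s powr z = s powr (1 + z)" for z using s by (simp add: powr_add)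
        have "a - real (l + 2 * b) = 1 + (a - real j)" "1 + (a - real (l + 2 * Suc b)) = a - real j"
          by (simp_all add: jb)
        then show "s powr (a - real (l + 2 * b)) = s * s powr (a - real j)" "s * s powr (a - real (l + 2 * Suc b)) = s powr (a - real j)"
          unfolding P by (simp_all only:)
      qed
      have "s * \<bar>?\<phi> j z\<bar> = \<bar>?\<phi> (l + 2 * b) (2 * s) - ?\<phi> (l + 2 * b) s\<bar>" using z(3) s by (simp add: abs_mult)
      also have "\<dots> \<le> 2 * (q b * s powr (a - real (l + 2 * b)))"
        using even[OF s, of "2 * s" b n] even[OF s, of s b n] s by linarith
      also have "\<dots> = s * (2 * q b * s powr (a - real j))" unfolding sj(1) by simp
      finally have 1: "\<bar>?\<phi> j z\<bar> \<le> 2 * q b * s powr (a - real j)" using s by simp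
      have "\<bar>?\<phi> (Suc j) z'\<bar> \<le> q (Suc b) * s powr (a - real (l + 2 * Suc b))"
        using even[OF s, of z' "Suc b" n] z'(1) by (simp add: jb)
      then have "(z - s) * \<bar>?\<phi> (Suc j) z'\<bar> \<le> s * (q (Suc b) * s powr (a - real (l + 2 * Suc b)))"
        using z s by (intro mult_mono) auto
      also have "\<dots> = q (Suc b) * s powr (a - real j)" unfolding sj(2)[symmetric] by (rule mult.left_commute)
      finally have "\<bar>?\<phi> j z - ?\<phi> j s\<bar> \<le> q (Suc b) * s powr (a - real j)"
        using z(1) by (simp add: z'(3) abs_mult)
      with 1 show "\<bar>?\<phi> j s\<bar> \<le> (2 * q b + q (Suc b)) * s powr (a - real j)"
        by (simp add: distrib_right)
    qed
  qed
qed

text \<open>The sum is the Taylor polynomial of \<open>V 0\<close>, centred at \<open>y\<close> and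
  evaluated at \<open>0\<close>; its derivative in the centre telescopes.\<close>
lemma taylor_sum_has_derivative:
  fixes V :: "nat \<Rightarrow> real \<Rightarrow> real"
  assumes d: "\<And>i y. (V i has_real_derivative V (Suc i) y) (at y)"
  shows "((\<lambda>y. \<Sum>i<Suc l. (- y) ^ i / fact i * V i y) has_real_derivative (- y) ^ l / fact l * V (Suc l) y) (at y)"
proof (induction l)
  case 0
  show ?case using d[of 0 y] by simp
next
  case (Suc l)
  have "((\<lambda>y. (- y) ^ Suc l / fact (Suc l)) has_real_derivative - ((- y) ^ l / fact l)) (at y)"
    by (rule derivative_eq_intros refl | simp add: field_simps del: of_nat_Suc)+
  from DERIV_add[OF Suc DERIV_mult[OF this d[of "Suc l" y]]]
  show ?case by (simp add: algebra_simps)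
qed

text \<open>Let \<open>T y\<close> be the Taylor polynomial, centred at \<open>y\<close> and
  evaluated at \<open>0\<close>, of the heat flow of an even derivative of the extension. Its value
  at \<open>0\<close> is the quantity to be bounded, its value at \<open>\<surd>t\<close> is
  controlled by \<open>heat_poisson_bound_at_sqrt\<close>, and its derivative contains
  \<open>l\<close> additional \<open>y\<close>-derivatives, so that the assumption and heat
  smoothing apply. The factor \<open>y\<^bsup>l - 1\<^esup>\<close> in that derivative makes it
  integrable at \<open>0\<close>.\<close>
lemma poisson_decay_imp_heat_decay:
  assumes f: "poisson_summable f" and dec: "poisson_decay a l f" and a: "0 < a"
    and al: "a \<le> real l" and lK: "l \<le> 2 * K"
  shows "heat_decay a (2 * K) f"
proof -
  have "0 < l" using a al by (cases l) auto
  then obtain l' where l': "l = Suc l'" by (cases l) auto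
  obtain C where C: "\<And>y n. 0 < y \<Longrightarrow> \<bar>poisson_deriv l f y n\<bar> \<le> C * y powr (a - real l)"
    using dec unfolding poisson_decay_def by blast
  have C0: "0 \<le> C" using order_trans[OF abs_ge_zero C[of 1 0]] by simp
  have "\<forall>i. \<exists>c. \<forall>s>0. \<forall>n. \<bar>heat_poisson (s\<^sup>2) (2 * K + i) f s n\<bar> \<le> c * s powr (a - real (2 * K + i))"
    by (intro allI heat_poisson_bound_at_sqrt[OF f dec al]) (use lK in simp)
  then obtain c where c: "\<And>i s n. 0 < s \<Longrightarrow> \<bar>heat_poisson (s\<^sup>2) (2 * K + i) f s n\<bar> \<le> c i * s powr (a - real (2 * K + i))"
    by metis
  define q where "q = sqrt (real (2 * K) ^ (2 * K)) * C"
  \<comment> \<open>The first part bounds \<open>T (\<surd>t)\<close>, the second \<open>T (\<surd>t) - T 0\<close>.\<close>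
  define D where "D = (\<Sum>i<l. c i / fact i) + q / a"
  have main: "\<bar>heat t ((lap ^^ K) f) n\<bar> \<le> D * sqrt t powr (a - real (2 * K))" if t: "0 < t" for t n
  proof -
    define s where "s = sqrt t"
    have s: "0 < s" "t = s\<^sup>2" using t by (simp_all add: s_def)
    define V where "V i y = heat_poisson t (2 * K + i) f y n" for i y
    have dV: "(V i has_real_derivative V (Suc i) y) (at y)" for i y
      unfolding V_def[abs_def] using heat_poisson_has_derivative[OF f, of t "2 * K + i" n y] by simp
    define T where "T y = (\<Sum>i<l. (- y) ^ i / fact i * V i y)" for y
    have dT: "(T has_real_derivative (- y) ^ l' / fact l' * V l y) (at y)" for y
      unfolding T_def[abs_def] l' by (rule taylor_sum_has_derivative[of V, OF dV])
    have bT: "\<bar>(- y) ^ l' / fact l' * V l y\<bar> \<le> (q * t powr (- real K)) * y powr (a - 1)" if y: "0 < y" for y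
    proof -
      have "\<bar>V l y\<bar> \<le> sqrt (real (2 * K) ^ (2 * K)) * (C * y powr (a - real l)) * t powr (- real K)"
        using heat_poisson_even_bound[OF f C[OF y] t, of K n] by (simp add: V_def add.commute)
      then have V: "\<bar>V l y\<bar> \<le> q * t powr (- real K) * y powr (a - real l)" by (simp add: q_def mult_ac)
      have "y ^ l' * 1 \<le> y ^ l' * fact l'" using y by (intro mult_left_mono fact_ge_1) auto
      then have "\<bar>(- y) ^ l' / fact l'\<bar> \<le> y ^ l'"
        using y by (simp add: power_abs pos_divide_le_eq)
      then have "\<bar>(- y) ^ l' / fact l'\<bar> * \<bar>V l y\<bar> \<le> y ^ l' * (q * t powr (- real K) * y powr (a - real l))"
        using y V by (intro mult_mono) auto
      also have "y ^ l' = y powr (real l - 1)" using y by (simp add: l' powr_realpow)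
      also have "y powr (real l - 1) * (q * t powr (- real K) * y powr (a - real l))
          = (q * t powr (- real K)) * (y powr (real l - 1) * y powr (a - real l))" by (simp add: mult_ac)
      also have "y powr (real l - 1) * y powr (a - real l) = y powr (a - 1)"
        unfolding powr_add[symmetric] by simp
      finally show ?thesis by (simp add: abs_mult)
    qed
    have "\<bar>T s - T 0\<bar> \<le> (q * t powr (- real K)) / a * s powr a"
      by (rule growth_from_derivative[OF dT bT a DERIV_isCont[OF dT] s(1)])
    also have "t powr (- real K) = s powr (- real (2 * K))"
      unfolding s(2) using square_powr[OF s(1), of "- real K"] by simp
    also have "q * s powr (- real (2 * K)) / a * s powr a = q / a * (s powr (- real (2 * K)) * s powr a)" by simp
    also have "s powr (- real (2 * K)) * s powr a = s powr (a - real (2 * K))"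
      unfolding powr_add[symmetric] by simp
    finally have T1: "\<bar>T s - T 0\<bar> \<le> q / a * s powr (a - real (2 * K))" .
    have "\<bar>T s\<bar> \<le> (\<Sum>i<l. \<bar>(- s) ^ i / fact i * V i s\<bar>)" unfolding T_def by (rule sum_abs)
    also have "\<dots> \<le> (\<Sum>i<l. c i / fact i * s powr (a - real (2 * K)))"
    proof (rule sum_mono)
      fix i
      have "\<bar>(- s) ^ i / fact i * V i s\<bar> = s ^ i / fact i * \<bar>V i s\<bar>" using s(1) by (simp add: abs_mult power_abs)
      also have "\<dots> \<le> s ^ i / fact i * (c i * s powr (a - real (2 * K + i)))"
        unfolding V_def s(2) using s(1) by (intro mult_left_mono c) auto
      also have "\<dots> = c i / fact i * (s powr real i * s powr (a - real (2 * K + i)))"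
        using s(1) by (simp add: powr_realpow)
      also have "s powr real i * s powr (a - real (2 * K + i)) = s powr (a - real (2 * K))"
        unfolding powr_add[symmetric] by simp
      finally show "\<bar>(- s) ^ i / fact i * V i s\<bar> \<le> c i / fact i * s powr (a - real (2 * K))" .
    qed
    also have "\<dots> = (\<Sum>i<l. c i / fact i) * s powr (a - real (2 * K))" by (simp add: sum_distrib_right)
    finally have T2: "\<bar>T s\<bar> \<le> (\<Sum>i<l. c i / fact i) * s powr (a - real (2 * K))" .
    have "T 0 = V 0 0"
      unfolding T_def l' by (subst sum.lessThan_Suc_shift) simp
    also have "\<dots> = (- 1) ^ K * heat t ((lap ^^ K) f) n"
    proof -
      have "exp_growth f" by (rule poisson_summable_exp_growth[OF f])
      from heat_cmult[OF exp_growth_tri_pow[OF this], of t "(- 1) ^ K" K 1 "- 2" 1 n]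
      show ?thesis by (simp add: V_def heat_poisson_def half_lap_pow_even[OF f])
    qed
    finally have "\<bar>T 0\<bar> = \<bar>heat t ((lap ^^ K) f) n\<bar>" by (simp add: abs_mult)
    moreover have "\<bar>T 0\<bar> \<le> D * s powr (a - real (2 * K))" using T1 T2 by (simp add: D_def distrib_right)
    ultimately show ?thesis by (simp add: s_def)
  qed
  have eg: "exp_growth f" by (rule poisson_summable_exp_growth[OF f])
  show ?thesis unfolding heat_decay_def
  proof (intro exI[of _ D] allI impI)
    fix t :: real and n assume t: "0 < t"
    have "sqrt t powr (a - real (2 * K)) = t powr ((a - real (2 * K)) / 2)"
      using t by (simp add: powr_half_sqrt[symmetric] powr_powr)
    then show "\<bar>(delta_right ^^ (2 * K)) (heat t f) n\<bar> \<le> D * t powr ((a - real (2 * K)) / 2)"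
      using main[OF t, of "n + int K"] by (simp add: lap_pow_eq_delta flip: heat_tri_pow[OF eg])
  qed
qed

section \<open>Growth of Poisson-summable functions with small second differences\<close>

text \<open>For \<open>i \<le> |n| / 2\<close> the sum \<open>f (n + i) + f (n - i)\<close> is close
  to \<open>2 f n\<close>. So a large value at \<open>n\<close> forces a proportional mass of
  \<open>|f|\<close> on the points \<open>n \<plusminus> i\<close>, whose weight is about \<open>1 /
  n\<^sup>2\<close>.\<close>
lemma second_difference_mass:
  assumes sd: "\<And>m n. \<bar>f (m + n) + f (m - n) - 2 * f m\<bar> \<le> C * \<bar>real_of_int n\<bar> powr a"
    and a: "0 < a" and n: "2 \<le> \<bar>n\<bar>"
  obtains J where "finite J" "\<And>j. j \<in> J \<Longrightarrow> \<bar>n\<bar> \<le> 2 * \<bar>j\<bar>"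
    "\<bar>f n\<bar> \<le> 10 * \<bar>real_of_int n\<bar> * (\<Sum>j\<in>J. \<bar>f j\<bar> / (1 + (real_of_int j)\<^sup>2)) + C / 2 * \<bar>real_of_int n\<bar> powr a"
proof -
  define h where "h = nat (\<bar>n\<bar> div 2)"
  define x where "x = \<bar>real_of_int n\<bar>"
  define w where "w j = \<bar>f j\<bar> / (1 + (real_of_int j)\<^sup>2)" for j
  have C0: "0 \<le> C" using order_trans[OF abs_ge_zero sd[of 0 1]] by simp
  have x2: "2 \<le> x" using n by (simp add: x_def)
  have h: "x / 4 \<le> real h" "2 * int h \<le> \<bar>n\<bar>" "1 \<le> h"
    using n by (auto simp: h_def x_def)
  let ?A = "(\<lambda>i. n + int i) ` {1..h}" and ?B = "(\<lambda>i. n - int i) ` {1..h}"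
  have disj: "?A \<inter> ?B = {}" by auto
  have sumJ: "(\<Sum>j\<in>?A \<union> ?B. w j) = (\<Sum>i=1..h. w (n + int i) + w (n - int i))"
    using disj by (subst sum.union_disjoint) (auto simp: sum.reindex inj_on_def sum.distrib)
  have wb: "\<bar>f (n + e)\<bar> / (5 * x\<^sup>2) \<le> w (n + e)" if "\<bar>e\<bar> \<le> int h" for e
  proof -
    have "\<bar>real_of_int (n + e)\<bar> \<le> 2 * x" using that h(2) unfolding x_def by linarith
    then have "(real_of_int (n + e))\<^sup>2 \<le> (2 * x)\<^sup>2" using x2 by (subst abs_le_square_iff[symmetric]) simp
    moreover have "1 \<le> x\<^sup>2" using x2 by (simp add: one_le_power)
    ultimately have "1 + (real_of_int (n + e))\<^sup>2 \<le> 5 * x\<^sup>2" by (simp add: power_mult_distrib)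
    then show ?thesis unfolding w_def by (intro frac_le one_plus_square_pos) auto
  qed
  have each: "(2 * \<bar>f n\<bar> - C * x powr a) / (5 * x\<^sup>2) \<le> w (n + int i) + w (n - int i)" if "i \<in> {1..h}" for i
  proof -
    have ih: "int i \<le> int h" using that by simp
    have "\<bar>real_of_int (int i)\<bar> powr a \<le> x powr a"
      using a ih h(2) unfolding x_def by (intro powr_mono2) linarith+
    from mult_left_mono[OF this C0] sd[of n "int i"]
    have "2 * \<bar>f n\<bar> - C * x powr a \<le> \<bar>f (n + int i)\<bar> + \<bar>f (n - int i)\<bar>" by linarith
    then have "(2 * \<bar>f n\<bar> - C * x powr a) / (5 * x\<^sup>2) \<le> (\<bar>f (n + int i)\<bar> + \<bar>f (n - int i)\<bar>) / (5 * x\<^sup>2)"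
      by (intro divide_right_mono) auto
    with wb[of "int i"] wb[of "- int i"] ih show ?thesis by (simp add: add_divide_distrib)
  qed
  have W0: "0 \<le> (\<Sum>j\<in>?A \<union> ?B. w j)" by (intro sum_nonneg) (simp add: w_def add_nonneg_nonneg)
  have bound: "\<bar>f n\<bar> \<le> 10 * x * (\<Sum>j\<in>?A \<union> ?B. w j) + C / 2 * x powr a"
  proof (cases "2 * \<bar>f n\<bar> \<le> C * x powr a")
    case True
    then show ?thesis using W0 x2 mult_nonneg_nonneg[of "10 * x" "\<Sum>j\<in>?A \<union> ?B. w j"] by linarith
  next
    case False
    have "(x / 4) * ((2 * \<bar>f n\<bar> - C * x powr a) / (5 * x\<^sup>2)) \<le> real h * ((2 * \<bar>f n\<bar> - C * x powr a) / (5 * x\<^sup>2))"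
      using False h(1) by (intro mult_right_mono) auto
    also have "\<dots> = (\<Sum>i=1..h. (2 * \<bar>f n\<bar> - C * x powr a) / (5 * x\<^sup>2))" by simp
    also have "\<dots> \<le> (\<Sum>j\<in>?A \<union> ?B. w j)" unfolding sumJ by (rule sum_mono) (rule each)
    finally have "(2 * \<bar>f n\<bar> - C * x powr a) / (20 * x) \<le> (\<Sum>j\<in>?A \<union> ?B. w j)"
      using x2 by (simp add: power2_eq_square)
    then have "2 * \<bar>f n\<bar> - C * x powr a \<le> 20 * x * (\<Sum>j\<in>?A \<union> ?B. w j)"
      using x2 by (simp add: pos_divide_le_eq mult_ac)
    then show ?thesis by simp
  qed
  show thesis
  proof (rule that[of "?A \<union> ?B"])
    fix j assume "j \<in> ?A \<union> ?B"
    then obtain i where "i \<le> h" "j = n + int i \<or> j = n - int i" by auto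
    then show "\<bar>n\<bar> \<le> 2 * \<bar>j\<bar>" using h(2) by linarith
  qed (use bound in \<open>auto simp: w_def x_def\<close>)
qed

text \<open>The sets \<open>J\<close> of the previous lemma move to infinity with \<open>n\<close>,
  where little mass is left.\<close>
lemma sublinear_of_summable:
  assumes f: "poisson_summable f"
    and sd: "\<And>m n. \<bar>f (m + n) + f (m - n) - 2 * f m\<bar> \<le> C * \<bar>real_of_int n\<bar> powr a"
    and a: "0 < a" "a < 1" and e: "0 < e"
  shows "\<exists>X. \<forall>n. X \<le> \<bar>n\<bar> \<longrightarrow> \<bar>f n\<bar> \<le> e * \<bar>real_of_int n\<bar> + C / 2 * \<bar>real_of_int n\<bar> powr a"
proof -
  let ?w = "\<lambda>j. \<bar>f j\<bar> / (1 + (real_of_int j)\<^sup>2)"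
  have w0: "0 \<le> ?w j" for j by (simp add: add_nonneg_nonneg)
  have sm: "?w summable_on UNIV" using f by (simp add: poisson_summable_iff)
  have "(?w has_sum poisson_norm f) UNIV" unfolding poisson_norm_def using sm by simp
  from this[unfolded has_sum_def tendsto_iff, rule_format, of "e / 10"] e
  have "\<forall>\<^sub>F F in finite_subsets_at_top UNIV. dist (sum ?w F) (poisson_norm f) < e / 10"
    by simp
  then obtain F where F: "finite F" "dist (sum ?w F) (poisson_norm f) < e / 10"
    unfolding eventually_finite_subsets_at_top by blast
  have bF: "bdd_above (abs ` F)" using F(1) by (intro bdd_above_finite) auto
  then obtain M where M: "\<And>j. j \<in> F \<Longrightarrow> \<bar>j\<bar> \<le> M" unfolding bdd_above_def by auto
  show ?thesis
  proof (intro exI[of _ "max 2 (2 * M + 1)"] allI impI)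
    fix n :: int assume n: "max 2 (2 * M + 1) \<le> \<bar>n\<bar>"
    then have n2: "2 \<le> \<bar>n\<bar>" by simp
    obtain J where J: "finite J" "\<And>j. j \<in> J \<Longrightarrow> \<bar>n\<bar> \<le> 2 * \<bar>j\<bar>"
      "\<bar>f n\<bar> \<le> 10 * \<bar>real_of_int n\<bar> * (\<Sum>j\<in>J. ?w j) + C / 2 * \<bar>real_of_int n\<bar> powr a"
      by (rule second_difference_mass[OF sd a(1) n2]) blast
    have "J \<inter> F = {}" using J(2) M n by fastforce
    then have "sum ?w J + sum ?w F = sum ?w (J \<union> F)" using J(1) F(1) by (simp add: sum.union_disjoint)
    also have "\<dots> \<le> poisson_norm f"
      unfolding poisson_norm_def by (rule finite_sum_le_infsum[OF sm]) (use J F w0 in auto)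
    finally have "sum ?w J \<le> e / 10" using F(2) unfolding dist_real_def abs_less_iff by linarith
    then have "10 * \<bar>real_of_int n\<bar> * sum ?w J \<le> 10 * \<bar>real_of_int n\<bar> * (e / 10)"
      by (intro mult_left_mono) auto
    with J(3) show "\<bar>f n\<bar> \<le> e * \<bar>real_of_int n\<bar> + C / 2 * \<bar>real_of_int n\<bar> powr a" by (simp add: mult_ac)
  qed
qed

text \<open>The second difference centred at \<open>m\<close> with step \<open>m\<close> compares
  \<open>f (2 m) - f 0\<close> with \<open>2 (f m - f 0)\<close>. Iterated along \<open>n, 2 n, 4 n,
  \<dots>\<close> the errors form a geometric series with ratio \<open>2\<^bsup>a -
  1\<^esup>\<close>, and the main term vanishes in the limit since \<open>f\<close> is
  sublinear.\<close>
lemma growth_order_of_doubling: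
  assumes sd: "\<And>m n. \<bar>f (m + n) + f (m - n) - 2 * f m\<bar> \<le> C * \<bar>real_of_int n\<bar> powr a"
    and a: "0 < a" "a < 1"
    and sub: "\<And>e. 0 < e \<Longrightarrow> \<exists>X. \<forall>n. X \<le> \<bar>n\<bar> \<longrightarrow> \<bar>f n\<bar> \<le> e * \<bar>real_of_int n\<bar>"
  shows "growth_order a f"
proof -
  have C0: "0 \<le> C" using order_trans[OF abs_ge_zero sd[of 0 1]] by simp
  \<comment> \<open>The ratio of the geometric error series.\<close>
  define r where "r = (2::real) powr (a - 1)"
  have r: "0 < r" "r < 1" using a by (auto simp: r_def powr_less_one)
  have key: "\<bar>f n - f 0\<bar> \<le> C / 2 / (1 - r) * \<bar>real_of_int n\<bar> powr a" if n: "n \<noteq> 0" for n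
  proof -
    define x where "x = \<bar>real_of_int n\<bar>"
    have x: "0 < x" using n by (simp add: x_def)
    have iter: "\<bar>f n - f 0\<bar> \<le> \<bar>f (2 ^ M * n) - f 0\<bar> / 2 ^ M + C / 2 * x powr a * (\<Sum>i<M. r ^ i)" for M
    proof (induction M)
      case (Suc M)
      let ?m = "2 ^ M * n"
      have "\<bar>real_of_int ?m\<bar> powr a = (2 powr a) ^ M * x powr a"
      proof -
        have "\<bar>real_of_int ?m\<bar> = 2 ^ M * x" by (simp add: x_def abs_mult)
        then have "\<bar>real_of_int ?m\<bar> powr a = (2 ^ M) powr a * x powr a" using x by (simp add: powr_mult)
        also have "(2 ^ M) powr a = (2 powr a :: real) ^ M"
          by (simp add: powr_powr mult.commute flip: powr_realpow)
        finally show ?thesis .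
      qed
      then have "\<bar>f (?m + ?m) + f 0 - 2 * f ?m\<bar> \<le> C * ((2 powr a) ^ M * x powr a)"
        using sd[of ?m ?m] by simp
      moreover have "2 * \<bar>v - w\<bar> \<le> \<bar>u - w\<bar> + d" if "\<bar>u + w - 2 * v\<bar> \<le> d" for u v w d :: real
      proof -
        have "(u - w) - (u + w - 2 * v) = 2 * (v - w)" by simp
        then have "2 * \<bar>v - w\<bar> = \<bar>(u - w) - (u + w - 2 * v)\<bar>" by (simp only: abs_mult)
        with abs_triangle_ineq4[of "u - w" "u + w - 2 * v"] that show ?thesis by linarith
      qed
      ultimately have "2 * \<bar>f ?m - f 0\<bar> \<le> \<bar>f (?m + ?m) - f 0\<bar> + C * ((2 powr a) ^ M * x powr a)" by blast
      then have "2 * \<bar>f ?m - f 0\<bar> / 2 ^ Suc M \<le> (\<bar>f (?m + ?m) - f 0\<bar> + C * ((2 powr a) ^ M * x powr a)) / 2 ^ Suc M"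
        by (intro divide_right_mono) auto
      also have "\<dots> = \<bar>f (2 ^ Suc M * n) - f 0\<bar> / 2 ^ Suc M + C / 2 * x powr a * ((2 powr a) ^ M / 2 ^ M)"
        by (simp add: add_divide_distrib mult_ac)
      also have "(2 powr a) ^ M / 2 ^ M = r ^ M" by (simp add: r_def powr_diff power_divide)
      finally have "\<bar>f ?m - f 0\<bar> / 2 ^ M \<le> \<bar>f (2 ^ Suc M * n) - f 0\<bar> / 2 ^ Suc M + C / 2 * x powr a * r ^ M"
        by simp
      with Suc show ?case by (simp add: distrib_left)
    qed simp
    have geo: "(\<Sum>i<M. r ^ i) \<le> 1 / (1 - r)" for M
    proof -
      have "(\<Sum>i<M. r ^ i) = (1 - r ^ M) / (1 - r)" using r by (simp add: sum_gp_strict)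
      also have "\<dots> \<le> 1 / (1 - r)" using r by (intro divide_right_mono) auto
      finally show ?thesis .
    qed
    have "\<bar>f n - f 0\<bar> \<le> C / 2 / (1 - r) * x powr a + e" if e: "0 < e" for e
    proof -
      obtain X where X: "\<And>n. X \<le> \<bar>n\<bar> \<Longrightarrow> \<bar>f n\<bar> \<le> (e / (2 * x)) * \<bar>real_of_int n\<bar>"
        using sub[of "e / (2 * x)"] e x by auto
      \<comment> \<open>Chosen so that both \<open>f (2 ^ M * n)\<close> and \<open>f 0\<close> are at most \<open>e / 2 * 2 ^ M\<close>.\<close>
      obtain M where M: "max (real_of_int X) (2 * \<bar>f 0\<bar> / e) < 2 ^ M"
        using real_arch_pow[of 2 "max (real_of_int X) (2 * \<bar>f 0\<bar> / e)"] by auto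
      have XM: "X \<le> \<bar>2 ^ M * n\<bar>"
      proof -
        have "real_of_int X \<le> 2 ^ M * 1" using M by simp
        also have "\<dots> \<le> 2 ^ M * \<bar>real_of_int n\<bar>" using n by (intro mult_left_mono) auto
        also have "\<dots> = real_of_int \<bar>2 ^ M * n\<bar>" by (simp add: abs_mult)
        finally show ?thesis by linarith
      qed
      have "\<bar>f (2 ^ M * n)\<bar> \<le> (e / (2 * x)) * (2 ^ M * x)" using X[OF XM] by (simp add: x_def abs_mult)
      then have "\<bar>f (2 ^ M * n)\<bar> \<le> e / 2 * 2 ^ M" using x by simp
      moreover have "\<bar>f 0\<bar> \<le> e / 2 * 2 ^ M" using M e by (simp add: pos_divide_less_eq mult_ac)
      ultimately have "\<bar>f (2 ^ M * n) - f 0\<bar> \<le> e * 2 ^ M" by linarith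
      then have "\<bar>f (2 ^ M * n) - f 0\<bar> / 2 ^ M \<le> e" by (simp add: pos_divide_le_eq)
      moreover have "C / 2 * x powr a * (\<Sum>i<M. r ^ i) \<le> C / 2 * x powr a * (1 / (1 - r))"
        using C0 by (intro mult_left_mono geo) auto
      moreover have "C / 2 * x powr a * (1 / (1 - r)) = C / 2 / (1 - r) * x powr a" by simp
      ultimately show ?thesis using iter[of M] by linarith
    qed
    then have "\<bar>f n - f 0\<bar> \<le> C / 2 / (1 - r) * x powr a" by (rule field_le_epsilon)
    then show ?thesis by (simp add: x_def)
  qed
  define Q where "Q = C / 2 / (1 - r)"
  have Q0: "0 \<le> Q" using C0 r by (simp add: Q_def)
  show ?thesis unfolding growth_order_def
  proof (intro exI[of _ "\<bar>f 0\<bar> + Q"] allI)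
    fix n
    let ?y = "\<bar>real_of_int n\<bar> powr a"
    have "\<bar>f n - f 0\<bar> \<le> Q * ?y" using key[of n] Q0 by (cases "n = 0") (auto simp: Q_def)
    moreover have "0 \<le> \<bar>f 0\<bar> * ?y" by simp
    ultimately show "\<bar>f n\<bar> \<le> (\<bar>f 0\<bar> + Q) * (1 + ?y)"
      unfolding distrib_left distrib_right mult_1_right using Q0 by linarith
  qed
qed

text \<open>For \<open>a \<ge> 1\<close> the mass estimate gives linear growth at once; for \<open>a
  < 1\<close> it only gives \<open>o(n)\<close>, which doubling improves.\<close>
lemma growth_order_of_summable:
  assumes f: "poisson_summable f" and sd: "second_difference_order a f" and a: "0 < a"
  shows "growth_order a f"
proof -
  obtain C where C: "\<And>m n. \<bar>f (m + n) + f (m - n) - 2 * f m\<bar> \<le> C * \<bar>real_of_int n\<bar> powr a"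
    using sd unfolding second_difference_order_def by blast
  have C0: "0 \<le> C" using order_trans[OF abs_ge_zero C[of 0 1]] by simp
  show ?thesis
  proof (cases "a < 1")
    case True
    show ?thesis
    proof (rule growth_order_of_doubling[OF C a True])
      fix e :: real assume e: "0 < e"
      obtain X where X: "\<And>n. X \<le> \<bar>n\<bar> \<Longrightarrow> \<bar>f n\<bar> \<le> e / 2 * \<bar>real_of_int n\<bar> + C / 2 * \<bar>real_of_int n\<bar> powr a"
        using sublinear_of_summable[OF f C a True, of "e / 2"] e by auto
      have "((\<lambda>x::real. x powr (- (1 - a))) \<longlongrightarrow> 0) at_top"
        by (intro tendsto_neg_powr filterlim_ident) (use True in auto)
      then have "((\<lambda>x::real. C * x powr (- (1 - a))) \<longlongrightarrow> C * 0) at_top" by (intro tendsto_mult_left)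
      then have "\<forall>\<^sub>F x in at_top. C * x powr (- (1 - a)) < e" using e by (intro order_tendstoD) auto
      then obtain Y where Y: "\<And>x. Y \<le> x \<Longrightarrow> C * x powr (a - 1) < e" unfolding eventually_at_top_linorder by auto
      show "\<exists>X. \<forall>n. X \<le> \<bar>n\<bar> \<longrightarrow> \<bar>f n\<bar> \<le> e * \<bar>real_of_int n\<bar>"
      proof (intro exI[of _ "max X (max 1 \<lceil>Y\<rceil>)"] allI impI)
        fix n assume n: "max X (max 1 \<lceil>Y\<rceil>) \<le> \<bar>n\<bar>"
        let ?x = "\<bar>real_of_int n\<bar>"
        have x: "1 \<le> ?x" "Y \<le> ?x" using n by linarith+
        have "C * ?x powr a = (C * ?x powr (a - 1)) * ?x" using x by (simp add: powr_diff)
        also have "\<dots> \<le> e * ?x" using Y[OF x(2)] by (intro mult_right_mono) auto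
        finally show "\<bar>f n\<bar> \<le> e * ?x" using X[of n] n by simp
      qed
    qed
  next
    case False
    let ?N = "poisson_norm f"
    show ?thesis unfolding growth_order_def
    proof (intro exI[of _ "10 * ?N + C / 2 + 2 * ?N"] allI)
      fix n
      let ?x = "\<bar>real_of_int n\<bar>"
      have N0: "0 \<le> ?N" by (rule poisson_norm_nonneg)
      have p0: "0 \<le> ?x powr a" by simp
      show "\<bar>f n\<bar> \<le> (10 * ?N + C / 2 + 2 * ?N) * (1 + ?x powr a)"
      proof (cases "2 \<le> \<bar>n\<bar>")
        case True
        obtain J where J: "finite J"
          "\<bar>f n\<bar> \<le> 10 * ?x * (\<Sum>j\<in>J. \<bar>f j\<bar> / (1 + (real_of_int j)\<^sup>2)) + C / 2 * ?x powr a"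
          by (rule second_difference_mass[OF C a True]) blast
        have "(\<Sum>j\<in>J. \<bar>f j\<bar> / (1 + (real_of_int j)\<^sup>2)) \<le> ?N"
          unfolding poisson_norm_def
          by (rule finite_sum_le_infsum) (use f J in \<open>auto simp: poisson_summable_iff add_nonneg_nonneg\<close>)
        then have "10 * ?x * (\<Sum>j\<in>J. \<bar>f j\<bar> / (1 + (real_of_int j)\<^sup>2)) \<le> 10 * ?x * ?N" by (intro mult_left_mono) auto
        moreover have "?x powr 1 \<le> ?x powr a" using True False by (intro powr_mono) auto
        then have "10 * ?N * ?x \<le> 10 * ?N * ?x powr a" using N0 by (intro mult_left_mono) auto
        moreover have "10 * ?x * ?N = 10 * ?N * ?x" by simp
        ultimately have "\<bar>f n\<bar> \<le> (10 * ?N + C / 2) * ?x powr a" using J(2) unfolding distrib_right by linarith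
        also have "\<dots> \<le> (10 * ?N + C / 2 + 2 * ?N) * (1 + ?x powr a)"
          using N0 C0 by (intro mult_mono) auto
        finally show ?thesis .
      next
        case False
        then have "?x \<le> 1" by linarith
        then have "(real_of_int n)\<^sup>2 \<le> 1" by (simp add: abs_square_le_1)
        then have "?N * (1 + (real_of_int n)\<^sup>2) \<le> ?N * 2" using N0 by (intro mult_left_mono) auto
        then have "\<bar>f n\<bar> \<le> (2 * ?N) * 1" using poisson_summable_growth[OF f, of n] by linarith
        also have "\<dots> \<le> (10 * ?N + C / 2 + 2 * ?N) * (1 + ?x powr a)"
          using N0 C0 by (intro mult_mono) auto
        finally show ?thesis .
      qed
    qed
  qed
qed

lemma growth_order_of_summable_large:
  assumes f: "poisson_summable f" and a: "2 \<le> a"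
  shows "growth_order a f"
  unfolding growth_order_def
proof (intro exI[of _ "2 * poisson_norm f"] allI)
  fix n
  let ?x = "\<bar>real_of_int n\<bar>"
  have "?x\<^sup>2 \<le> 1 + ?x powr a"
  proof (cases "n = 0")
    case False
    then have "1 \<le> ?x" by linarith
    then have "?x powr 2 \<le> ?x powr a" using a by (intro powr_mono) auto
    then show ?thesis using \<open>1 \<le> ?x\<close> by simp
  qed simp
  moreover have "0 \<le> ?x powr a" by simp
  moreover have "1 + z \<le> 2 * (1 + p)" if "z \<le> 1 + p" "0 \<le> p" for z p :: real
    using that by simp
  ultimately have "1 + (real_of_int n)\<^sup>2 \<le> 2 * (1 + ?x powr a)"
    unfolding power2_abs by blast
  from order_trans[OF poisson_summable_growth[OF f] mult_left_mono[OF this poisson_norm_nonneg[of f]]]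
  show "\<bar>f n\<bar> \<le> 2 * poisson_norm f * (1 + ?x powr a)" by (simp only: mult_ac)
qed

lemma poisson_decay_imp_growth_order:
  assumes f: "poisson_summable f" and dec: "heat_decay a (2 * K) f" and a: "0 < a"
    and K: "a < 2 \<Longrightarrow> K = 1"
  shows "growth_order a f"
proof (cases "a < 2")
  case True
  have eg: "exp_growth f" by (rule poisson_summable_exp_growth[OF f])
  have "heat_decay a (0 + 2) f" using dec unfolding K[OF True] by (simp only: add_0 mult_1_right)
  then interpret decaying_heat a a 0 f
    by unfold_locales (simp, rule a, rule eg)
  have "second_difference_order a f"
    using second_difference unfolding second_difference_order_def g_def by auto
  then show ?thesis by (rule growth_order_of_summable[OF assms(1) _ assms(3)])
qed (use growth_order_of_summable_large[OF f] in simp)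

section \<open>From heat decay to Poisson decay\<close>

lemma poisson_kernel_integrable:
  assumes y: "0 < y"
  shows "set_integrable lborel {0<..} (\<lambda>t. subordinator y t * heat_kernel t j)"
proof (rule set_integrable_bound[OF subordinator_integrable[OF y]])
  have "(\<lambda>t. heat t point_mass j) \<in> borel_measurable borel"
  proof (rule borel_measurable_continuous_onI, rule continuous_at_imp_continuous_on, rule ballI)
    fix t show "isCont (\<lambda>t. heat t point_mass j) t"
      by (rule DERIV_isCont[OF heat_has_derivative]) (rule exp_growth_bounded[of _ 1], simp)
  qed
  then have "(\<lambda>t. indicator {0<..} t *\<^sub>R (subordinator y t * heat t point_mass j)) \<in> borel_measurable lborel"
    unfolding subordinator_def by measurable
  also have "(\<lambda>t. indicator {0<..} t *\<^sub>R (subordinator y t * heat t point_mass j))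
      = (\<lambda>t. indicator {0<..} t *\<^sub>R (subordinator y t * heat_kernel t j))"
    by (auto simp: indicator_def heat_kernel_eq_heat)
  finally show "set_borel_measurable lborel {0<..} (\<lambda>t. subordinator y t * heat_kernel t j)"
    unfolding set_borel_measurable_def .
  show "AE t in lborel. t \<in> {0<..} \<longrightarrow> norm (subordinator y t * heat_kernel t j) \<le> norm (subordinator y t)"
  proof (intro AE_I2 impI)
    fix t :: real assume "t \<in> {0<..}"
    then show "norm (subordinator y t * heat_kernel t j) \<le> norm (subordinator y t)"
      using heat_kernel_bounds[of t j] by (simp add: abs_mult mult_left_le)
  qed
qed

lemma poisson_kernel_nonneg: "0 < y \<Longrightarrow> 0 \<le> poisson_kernel y j"
  unfolding poisson_kernel_subordination set_lebesgue_integral_def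
  by (intro integral_nonneg_AE AE_I2) (auto simp: indicator_def heat_kernel_bounds subordinator_nonneg)

lemma poisson_kernel_le_one:
  assumes y: "0 < y"
  shows "poisson_kernel y j \<le> 1"
proof -
  have "poisson_kernel y j \<le> (LINT t:{0<..}|lborel. subordinator y t)"
    unfolding poisson_kernel_subordination
    by (rule set_integral_mono[OF poisson_kernel_integrable[OF y] subordinator_integrable[OF y]])
       (use y in \<open>auto intro!: mult_left_le heat_kernel_bounds subordinator_nonneg\<close>)
  then show ?thesis by (simp add: subordinator_integral[OF y])
qed

text \<open>The subordinating density divided by \<open>y\<close> decreases in
  \<open>y\<close>.\<close>
lemma poisson_kernel_ratio_antimono:
  assumes z: "0 < z" "z \<le> y"
  shows "poisson_kernel y j / y \<le> poisson_kernel z j / z"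
proof -
  have y: "0 < y" using z by simp
  have "(1 / y) * poisson_kernel y j = (LINT t:{0<..}|lborel. (1 / y) * (subordinator y t * heat_kernel t j))"
    unfolding poisson_kernel_subordination by (rule set_integral_mult_right[symmetric])
  also have "\<dots> \<le> (LINT t:{0<..}|lborel. (1 / z) * (subordinator z t * heat_kernel t j))"
  proof (rule set_integral_mono)
    fix t :: real assume t: "t \<in> {0<..}"
    have "exp (- (y\<^sup>2) / (4 * t)) \<le> exp (- (z\<^sup>2) / (4 * t))"
      using z t by (auto intro!: divide_right_mono power_mono)
    then have "(1 / y) * subordinator y t \<le> (1 / z) * subordinator z t"
      using y z by (simp add: subordinator_def divide_right_mono)
    then show "(1 / y) * (subordinator y t * heat_kernel t j) \<le> (1 / z) * (subordinator z t * heat_kernel t j)"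
      using heat_kernel_bounds(1)[of t j] t unfolding mult.assoc[symmetric] by (intro mult_right_mono) auto
  qed (intro set_integrable_mult_right impI poisson_kernel_integrable y z)+
  also have "\<dots> = (1 / z) * poisson_kernel z j"
    unfolding poisson_kernel_subordination by (rule set_integral_mult_right)
  finally show ?thesis by simp
qed

text \<open>Away from \<open>j = 0\<close> the quotient by \<open>y\<close> is at most its limit as
  \<open>y \<rightarrow> 0\<close>, which is the linear coefficient of the exponential
  series.\<close>
lemma poisson_kernel_bound:
  assumes y: "1 \<le> y"
  shows "poisson_kernel y j \<le> 6 * y * (1 / (1 + (real_of_int j)\<^sup>2))"
proof (cases "j = 0")
  case True
  then show ?thesis using poisson_kernel_le_one[of y j] y by simp
next
  case False
  let ?c = "\<lambda>i. (- 1) ^ i * half_lap_coeff i j"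
  have cb: "\<bar>?c i\<bar> \<le> (2 / (1 + (real_of_int j)\<^sup>2)) * 3 ^ i" for i
    using half_lap_coeff_bound[of i j] by (simp add: abs_mult)
  have P: "poisson_kernel z j = egf ?c z" if "0 < z" for z
    using poisson_kernel_sums[OF that, of j] by (simp add: egf_def sums_iff)
  have "((\<lambda>h. (egf ?c (0 + h) - egf ?c 0) / h) \<longlongrightarrow> egf (\<lambda>k. ?c (Suc k)) 0) (at 0)"
    using egf_has_derivative[OF cb, of 0] by (rule DERIV_D)
  then have "((\<lambda>h. egf ?c h / h) \<longlongrightarrow> - half_lap_coeff 1 j) (at 0)"
    using False by (simp add: half_lap_coeff_0)
  then have lim: "((\<lambda>h. egf ?c h / h) \<longlongrightarrow> - half_lap_coeff 1 j) (at_right 0)"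
    by (rule filterlim_mono) (auto simp: at_within_le_at)
  have "\<forall>\<^sub>F h in at_right 0. poisson_kernel y j / y \<le> egf ?c h / h"
  proof (rule eventually_mono)
    show "\<forall>\<^sub>F h in at_right 0. h \<in> {0<..<y}" using eventually_at_right_real[of 0 y] y by simp
    fix h assume "h \<in> {0<..<y}"
    then show "poisson_kernel y j / y \<le> egf ?c h / h"
      using poisson_kernel_ratio_antimono[of h y j] P[of h] by simp
  qed
  then have "poisson_kernel y j / y \<le> - half_lap_coeff 1 j"
    by (rule tendsto_lowerbound[OF lim]) simp
  also have "\<dots> \<le> 6 / (1 + (real_of_int j)\<^sup>2)" using half_lap_coeff_bound[of 1 j] by simp
  finally show ?thesis using y by (simp add: pos_divide_le_eq mult_ac)
qed

text \<open>Dominated convergence: the kernel divided by \<open>y\<close> tends to \<open>0\<close>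
  pointwise and is at most a multiple of the weight. Finitely many terms and a small tail are
  estimated separately.\<close>
lemma poisson_sublinear:
  assumes f: "poisson_summable f"
  shows "((\<lambda>y. poisson_deriv 0 f y n / y) \<longlongrightarrow> 0) at_top"
proof (rule tendstoI)
  fix e :: real assume e: "0 < e"
  let ?v = "\<lambda>j. \<bar>f (n - j)\<bar> / (1 + (real_of_int j)\<^sup>2)"
  have v0: "0 \<le> ?v j" for j by (simp add: add_nonneg_nonneg)
  have vs: "?v summable_on UNIV" by (rule poisson_summable_reflect(1)[OF f])
  then have "(?v has_sum infsum ?v UNIV) UNIV" by simp
  from this[unfolded has_sum_def tendsto_iff, rule_format, of "e / 12"] e
  have "\<forall>\<^sub>F F in finite_subsets_at_top UNIV. dist (sum ?v F) (infsum ?v UNIV) < e / 12"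
    by simp
  then obtain F where F: "finite F" "dist (sum ?v F) (infsum ?v UNIV) < e / 12"
    unfolding eventually_finite_subsets_at_top by blast
  have vs': "?v summable_on (- F)" by (rule summable_on_subset_banach[OF vs]) simp
  have "infsum ?v UNIV = infsum ?v (F \<union> - F)" by simp
  also have "\<dots> = infsum ?v F + infsum ?v (- F)" by (rule infsum_Un_disjoint) (use F vs' in auto)
  finally have tail: "infsum ?v (- F) < e / 12" using F unfolding dist_real_def abs_less_iff by simp
  define S where "S = (\<Sum>j\<in>F. \<bar>f (n - j)\<bar>)"
  show "\<forall>\<^sub>F y in at_top. dist (poisson_deriv 0 f y n / y) 0 < e"
    using eventually_ge_at_top[of "max 1 (2 * S / e + 1)"]
  proof eventually_elim
    case (elim y)
    then have y: "1 \<le> y" "0 < y" "2 * S / e < y" by auto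
    let ?p = "\<lambda>j. poisson_kernel y j * f (n - j)"
    have p1: "\<bar>?p j\<bar> \<le> 6 * y * ?v j" for j
    proof -
      have "poisson_kernel y j * \<bar>f (n - j)\<bar> \<le> (6 * y * (1 / (1 + (real_of_int j)\<^sup>2))) * \<bar>f (n - j)\<bar>"
        by (intro mult_right_mono poisson_kernel_bound y) auto
      then show ?thesis using poisson_kernel_nonneg[OF y(2), of j] by (simp add: abs_mult)
    qed
    have p2: "\<bar>?p j\<bar> \<le> \<bar>f (n - j)\<bar>" for j
      using poisson_kernel_nonneg[OF y(2), of j] poisson_kernel_le_one[OF y(2), of j]
      by (simp add: abs_mult mult_left_le_one_le)
    have ps: "(\<lambda>j. \<bar>?p j\<bar>) summable_on UNIV"
      by (rule summable_on_comparison_test[OF summable_on_cmult_right[OF vs, of "6 * y"] p1]) simp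
    have ps': "(\<lambda>j. \<bar>?p j\<bar>) summable_on (- F)" by (rule summable_on_subset_banach[OF ps]) simp
    have "\<bar>poisson_deriv 0 f y n\<bar> \<le> infsum (\<lambda>j. \<bar>?p j\<bar>) UNIV"
      using norm_infsum_bound[of ?p UNIV] ps infsumI[OF poisson_kernel_has_sum[OF f y(2), of n]] by simp
    also have "\<dots> = infsum (\<lambda>j. \<bar>?p j\<bar>) (F \<union> - F)" by simp
    also have "\<dots> = (\<Sum>j\<in>F. \<bar>?p j\<bar>) + infsum (\<lambda>j. \<bar>?p j\<bar>) (- F)"
      by (subst infsum_Un_disjoint) (use F ps' in auto)
    also have "\<dots> \<le> S + infsum (\<lambda>j. 6 * y * ?v j) (- F)"
      unfolding S_def by (intro add_mono sum_mono p2 infsum_mono ps' summable_on_cmult_right vs' p1)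
    also have "infsum (\<lambda>j. 6 * y * ?v j) (- F) = 6 * y * infsum ?v (- F)" by (rule infsum_cmult_right')
    also have "S + 6 * y * infsum ?v (- F) < e / 2 * y + 6 * y * (e / 12)"
      using y tail e by (intro add_le_less_mono mult_strict_left_mono) (auto simp: field_simps)
    also have "\<dots> = e * y" by simp
    finally show ?case using y by (simp add: pos_divide_less_eq)
  qed
qed

text \<open>Integrating a derivative that stays above a positive constant makes the one below it
  eventually positive as well, down to \<open>\<phi> 0\<close>, which would then grow at least
  linearly.\<close>
lemma derivative_chain_not_positive:
  fixes \<phi> :: "nat \<Rightarrow> real \<Rightarrow> real"
  assumes d: "\<And>i y. 0 < y \<Longrightarrow> (\<phi> i has_real_derivative \<phi> (Suc i) y) (at y)"
    and lim: "((\<lambda>y. \<phi> 0 y / y) \<longlongrightarrow> 0) at_top" and c: "0 < c" "0 < Y"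
    and pos: "\<And>y. Y \<le> y \<Longrightarrow> c \<le> \<phi> (Suc l) y"
  shows False
  using c pos
proof (induction l arbitrary: c Y)
  case 0
  have grow: "\<phi> 0 Y + c * (y - Y) \<le> \<phi> 0 y" if y: "Y \<le> y" for y
  proof -
    have "\<phi> 0 Y - c * Y \<le> \<phi> 0 y - c * y"
    proof (rule DERIV_nonneg_imp_nondecreasing[OF y])
      fix x assume x: "Y \<le> x"
      have "((\<lambda>y. \<phi> 0 y - c * y) has_real_derivative \<phi> (Suc 0) x - c) (at x)"
        using 0 x by (auto intro!: derivative_eq_intros d)
      then show "\<exists>z. DERIV (\<lambda>y. \<phi> 0 y - c * y) x :> z \<and> 0 \<le> z" using 0(3)[OF x] by auto
    qed
    then show ?thesis by (simp add: algebra_simps)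
  qed
  have "((\<lambda>y. \<phi> 0 Y / y + c * (1 - Y / y)) \<longlongrightarrow> 0 + c * (1 - 0)) at_top"
    by (intro tendsto_intros tendsto_divide_0[OF tendsto_const] filterlim_at_top_imp_at_infinity filterlim_ident)
  moreover have "\<forall>\<^sub>F y in at_top. \<phi> 0 Y / y + c * (1 - Y / y) \<le> \<phi> 0 y / y"
    using eventually_ge_at_top[of Y]
  proof eventually_elim
    case (elim y)
    then have "(\<phi> 0 Y + c * (y - Y)) / y \<le> \<phi> 0 y / y" using 0 grow by (intro divide_right_mono) auto
    then show ?case using elim 0 by (simp add: add_divide_distrib right_diff_distrib diff_divide_distrib)
  qed
  ultimately have "0 + c * (1 - 0) \<le> 0"
    using lim by (intro tendsto_le[of at_top "\<lambda>y. \<phi> 0 y / y" 0]) auto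
  then show False using 0 by simp
next
  case (Suc l)
  define Z where "Z = max Y (Y + (1 - \<phi> (Suc l) Y) / c)"
  show False
  proof (rule Suc.IH[of 1 Z])
    show "0 < Z" using Suc.prems by (simp add: Z_def)
    fix y assume y: "Z \<le> y"
    then have Yy: "Y \<le> y" and le: "(1 - \<phi> (Suc l) Y) / c \<le> y - Y" by (auto simp: Z_def)
    have "\<phi> (Suc l) Y - c * Y \<le> \<phi> (Suc l) y - c * y"
    proof (rule DERIV_nonneg_imp_nondecreasing[OF Yy])
      fix x assume x: "Y \<le> x"
      have "((\<lambda>y. \<phi> (Suc l) y - c * y) has_real_derivative \<phi> (Suc (Suc l)) x - c) (at x)"
        using Suc.prems x by (auto intro!: derivative_eq_intros d)
      then show "\<exists>z. DERIV (\<lambda>y. \<phi> (Suc l) y - c * y) x :> z \<and> 0 \<le> z" using Suc.prems(3)[OF x] by auto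
    qed
    moreover have "1 - \<phi> (Suc l) Y \<le> c * (y - Y)"
      using le Suc.prems(1) by (simp add: pos_divide_le_eq mult.commute)
    ultimately show "1 \<le> \<phi> (Suc l) y" by (simp add: algebra_simps)
  qed simp
qed

text \<open>If the bound failed at \<open>z\<close>, the integrable bound of the next derivative
  would keep \<open>\<phi> l\<close> above a positive constant on \<open>[z,
  \<infinity>)\<close>.\<close>
lemma upper_bound_of_sublinear_primitive:
  fixes \<phi> :: "nat \<Rightarrow> real \<Rightarrow> real"
  assumes d: "\<And>i y. 0 < y \<Longrightarrow> (\<phi> i has_real_derivative \<phi> (Suc i) y) (at y)"
    and lim: "((\<lambda>y. \<phi> 0 y / y) \<longlongrightarrow> 0) at_top" and l: "0 < l"
    and b: "\<And>y. 0 < y \<Longrightarrow> - (C * y powr (- e)) \<le> \<phi> (Suc l) y" and e: "1 < e" and C: "0 \<le> C" and z: "0 < z"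
  shows "\<phi> l z \<le> C / (e - 1) * z powr (1 - e)"
proof (rule ccontr)
  define q where "q y = C / (e - 1) * y powr (1 - e)" for y
  assume "\<not> ?thesis"
  then have c: "0 < \<phi> l z - q z" by (simp add: q_def)
  obtain l' where l': "l = Suc l'" using l by (cases l) auto
  have q0: "0 \<le> q y" for y using C e by (simp add: q_def)
  have low: "\<phi> l z - q z \<le> \<phi> (Suc l') y" if y: "z \<le> y" for y
  proof -
    have "\<phi> l z - q z \<le> \<phi> l y - q y"
    proof (rule DERIV_nonneg_imp_nondecreasing[OF y])
      fix x assume "z \<le> x"
      then have x: "0 < x" using z by simp
      have "((\<lambda>y. \<phi> l y - q y) has_real_derivative \<phi> (Suc l) x - C / (e - 1) * ((1 - e) * x powr (1 - e - 1))) (at x)"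
        unfolding q_def by (intro DERIV_diff DERIV_cmult d x has_real_derivative_powr)
      moreover have "C / (e - 1) * (1 - e) = - C" using e by (simp add: field_simps)
      then have "C / (e - 1) * ((1 - e) * x powr (1 - e - 1)) = - (C * x powr (- e))"
        unfolding mult.assoc[symmetric] by simp
      ultimately show "\<exists>w. DERIV (\<lambda>y. \<phi> l y - q y) x :> w \<and> 0 \<le> w" using b[OF x]
        by (intro exI[of _ "\<phi> (Suc l) x + C * x powr (- e)"]) simp
    qed
    then show ?thesis using q0[of y] by (simp add: l')
  qed
  show False
  proof (rule derivative_chain_not_positive[of \<phi>, OF _ lim c z])
    show "\<phi> l z - q z \<le> \<phi> (Suc l') y" if "z \<le> y" for y by (rule low[OF that])
  qed (rule d)
qed

lemma decay_of_sublinear_primitive: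
  fixes \<phi> :: "nat \<Rightarrow> real \<Rightarrow> real"
  assumes d: "\<And>i y. 0 < y \<Longrightarrow> (\<phi> i has_real_derivative \<phi> (Suc i) y) (at y)"
    and lim: "((\<lambda>y. \<phi> 0 y / y) \<longlongrightarrow> 0) at_top" and l: "0 < l"
    and b: "\<And>y. 0 < y \<Longrightarrow> \<bar>\<phi> (Suc l) y\<bar> \<le> C * y powr (- e)" and e: "1 < e" and z: "0 < z"
  shows "\<bar>\<phi> l z\<bar> \<le> C / (e - 1) * z powr (1 - e)"
proof -
  have C: "0 \<le> C" using order_trans[OF abs_ge_zero b[of 1]] by simp
  have "\<phi> l z \<le> C / (e - 1) * z powr (1 - e)"
    by (rule upper_bound_of_sublinear_primitive[OF d lim l _ e C z]) (use b in \<open>auto simp: abs_le_iff minus_le_iff\<close>)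
  moreover have "- \<phi> l z \<le> C / (e - 1) * z powr (1 - e)"
    by (rule upper_bound_of_sublinear_primitive[of "\<lambda>i y. - \<phi> i y", OF DERIV_minus[OF d] _ l _ e C z])
       (use b tendsto_minus[OF lim] in \<open>auto simp: abs_le_iff\<close>)
  ultimately show ?thesis by linarith
qed

text \<open>Sum and integral are exchanged by dominated convergence along the boxes
  \<open>{-J..J}\<close>; the partial sums are bounded because the heat kernel has total mass
  \<open>1\<close>.\<close>
lemma poisson_as_heat_average:
  assumes h: "\<And>n. \<bar>h n\<bar> \<le> H" and y: "0 < y"
  shows "set_integrable lborel {0<..} (\<lambda>t. subordinator y t * heat t h n)"
    and "((\<lambda>j. poisson_kernel y j * h (n - j)) has_sum s) UNIV \<Longrightarrow>
      s = (LINT t:{0<..}|lborel. subordinator y t * heat t h n)"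
proof -
  have eg: "exp_growth h" by (rule exp_growth_bounded[OF h])
  have H0: "0 \<le> H" using order_trans[OF abs_ge_zero h[of 0]] .
  let ?box = "\<lambda>J::nat. {- int J..int J}"
  let ?s = "\<lambda>J t. \<Sum>j\<in>?box J. heat_kernel t j * h (n - j)"
  have box: "filterlim ?box (finite_subsets_at_top UNIV) sequentially"
    unfolding filterlim_finite_subsets_at_top
  proof (intro allI impI)
    fix X :: "int set" assume "finite X \<and> X \<subseteq> UNIV"
    then have "bdd_above (abs ` X)" by (intro bdd_above_finite) auto
    then obtain M where M: "\<And>j. j \<in> X \<Longrightarrow> \<bar>j\<bar> \<le> M" unfolding bdd_above_def by auto
    show "\<forall>\<^sub>F J in sequentially. finite (?box J) \<and> X \<subseteq> ?box J \<and> ?box J \<subseteq> UNIV"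
      using eventually_ge_at_top[of "nat M"]
      by eventually_elim (use M in \<open>fastforce simp: abs_le_iff\<close>)
  qed
  have reflect: "((\<lambda>j. heat_kernel t j * g (n - j)) has_sum heat t g n) UNIV" if "exp_growth g" "0 < t" for g t
    using heat_kernel_has_sum[OF that(1), of t n] that(2)
      has_sum_reindex_bij_witness[of UNIV "\<lambda>j. n - j" "\<lambda>j. n - j" UNIV "\<lambda>j. heat_kernel t j * g (n - j)" "\<lambda>j. heat_kernel t (n - j) * g j" "heat t g n" "heat t g n"]
    by simp
  have s_lim: "(\<lambda>J. ?s J t) \<longlonglongrightarrow> heat t h n" if "0 < t" for t
    using filterlim_compose[OF reflect[OF eg that, unfolded has_sum_def] box] .
  have s_bd: "\<bar>?s J t\<bar> \<le> H" if t: "0 < t" for J t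
  proof -
    have "\<bar>?s J t\<bar> \<le> (\<Sum>j\<in>?box J. heat_kernel t j * H)"
      by (rule order_trans[OF sum_abs], rule sum_mono)
         (use heat_kernel_bounds[of t] t h in \<open>auto simp: abs_mult intro!: mult_left_mono\<close>)
    also have "\<dots> = H * (\<Sum>j\<in>?box J. heat_kernel t j * 1)" by (simp add: sum_distrib_left mult.commute)
    also have "(\<Sum>j\<in>?box J. heat_kernel t j * 1) \<le> 1"
      using has_sum_mono_neutral[OF has_sum_finite[of "?box J" "\<lambda>j. heat_kernel t j * 1"] reflect[OF exp_growth_const[of 1] t]]
        heat_kernel_bounds[of t] t by simp
    then have "H * (\<Sum>j\<in>?box J. heat_kernel t j * 1) \<le> H * 1" using H0 by (intro mult_left_mono) auto
    finally show ?thesis by simp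
  qed
  have intJ: "integrable lborel (\<lambda>t. indicator {0<..} t *\<^sub>R (subordinator y t * ?s J t))" for J
  proof -
    have "indicator {0<..} t *\<^sub>R (subordinator y t * ?s J t)
        = (\<Sum>j\<in>?box J. h (n - j) * (indicator {0<..} t *\<^sub>R (subordinator y t * heat_kernel t j)))" for t
      by (simp add: sum_distrib_left mult_ac)
    then show ?thesis
      using poisson_kernel_integrable[OF y] by (simp add: set_integrable_def)
  qed
  have valJ: "(LINT t|lborel. indicator {0<..} t *\<^sub>R (subordinator y t * ?s J t))
      = (\<Sum>j\<in>?box J. poisson_kernel y j * h (n - j))" for J
  proof -
    have "indicator {0<..} t *\<^sub>R (subordinator y t * ?s J t)
        = (\<Sum>j\<in>?box J. h (n - j) * (indicator {0<..} t *\<^sub>R (subordinator y t * heat_kernel t j)))" for t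
      by (simp add: sum_distrib_left mult_ac)
    then show ?thesis
      using poisson_kernel_integrable[OF y]
      by (simp add: set_integrable_def poisson_kernel_subordination set_lebesgue_integral_def mult.commute)
  qed
  have dom: "integrable lborel (\<lambda>t. indicator {0<..} t *\<^sub>R (subordinator y t * H))"
    using set_integrable_mult_left[of H lborel "{0<..}" "subordinator y"] subordinator_integrable[OF y]
    by (simp add: set_integrable_def)
  have meas: "(\<lambda>t. indicator {0<..} t *\<^sub>R (subordinator y t * heat t h n)) \<in> borel_measurable lborel"
  proof -
    have "(\<lambda>t. heat t h n) \<in> borel_measurable borel"
      by (rule borel_measurable_continuous_onI, rule continuous_at_imp_continuous_on, rule ballI)
         (rule DERIV_isCont[OF heat_has_derivative[OF eg]])
    then show ?thesis unfolding subordinator_def by measurable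
  qed
  note dc = integral_dominated_convergence[where s = "\<lambda>J t. indicator {0<..} t *\<^sub>R (subordinator y t * ?s J t)"
      and f = "\<lambda>t. indicator {0<..} t *\<^sub>R (subordinator y t * heat t h n)"
      and w = "\<lambda>t. indicator {0<..} t *\<^sub>R (subordinator y t * H)" and M = lborel, OF meas _ dom]
  have c1: "(\<lambda>t. indicator {0<..} t *\<^sub>R (subordinator y t * ?s J t)) \<in> borel_measurable lborel" for J
    using intJ[of J] by (rule borel_measurable_integrable)
  have c2: "AE t in lborel. (\<lambda>J. indicator {0<..} t *\<^sub>R (subordinator y t * ?s J t)) \<longlonglongrightarrow> indicator {0<..} t *\<^sub>R (subordinator y t * heat t h n)"
  proof (intro AE_I2)
    fix t :: real
    show "(\<lambda>J. indicator {0<..} t *\<^sub>R (subordinator y t * ?s J t)) \<longlonglongrightarrow> indicator {0<..} t *\<^sub>R (subordinator y t * heat t h n)"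
      by (cases "0 < t") (auto intro!: tendsto_mult_left s_lim)
  qed
  have c3: "AE t in lborel. norm (indicator {0<..} t *\<^sub>R (subordinator y t * ?s J t)) \<le> indicator {0<..} t *\<^sub>R (subordinator y t * H)" for J
  proof (intro AE_I2)
    fix t :: real
    show "norm (indicator {0<..} t *\<^sub>R (subordinator y t * ?s J t)) \<le> indicator {0<..} t *\<^sub>R (subordinator y t * H)"
      using s_bd[of t J] y subordinator_nonneg[of y t] by (cases "0 < t") (auto simp: abs_mult intro!: mult_left_mono)
  qed
  show "set_integrable lborel {0<..} (\<lambda>t. subordinator y t * heat t h n)"
    unfolding set_integrable_def by (rule integrable_dominated_convergence[OF meas c1 dom c2 c3])
  assume "((\<lambda>j. poisson_kernel y j * h (n - j)) has_sum s) UNIV"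
  from filterlim_compose[OF this[unfolded has_sum_def] box]
  have "(\<lambda>J. \<Sum>j\<in>?box J. poisson_kernel y j * h (n - j)) \<longlonglongrightarrow> s" .
  moreover have "(\<lambda>J. \<Sum>j\<in>?box J. poisson_kernel y j * h (n - j)) \<longlonglongrightarrow> (LINT t:{0<..}|lborel. subordinator y t * heat t h n)"
    using dc[OF c1 c2 c3] unfolding valJ set_lebesgue_integral_def .
  ultimately show "s = (LINT t:{0<..}|lborel. subordinator y t * heat t h n)"
    by (rule LIMSEQ_unique)
qed

text \<open>The factor \<open>y\<^sup>2 / t\<close> is absorbed by half of the exponential, since
  \<open>x e\<^sup>-\<^sup>x \<le> 1\<close>; the other half belongs to the same density with
  \<open>y / \<surd>2\<close> instead of \<open>y\<close>.\<close>
lemma subordinator_over_t: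
  assumes y: "0 < y" and t: "0 < t"
  shows "y\<^sup>2 / t * subordinator y t \<le> 8 * sqrt 2 * subordinator (y / sqrt 2) t"
proof -
  define x where "x = y\<^sup>2 / (8 * t)"
  have "x \<le> exp x" using exp_ge_add_one_self[of x] by linarith
  then have "x * exp (- x) \<le> 1" by (simp add: exp_minus divide_simps)
  then have "8 * (x * exp (- x)) * exp (- x) \<le> 8 * 1 * exp (- x)" by (intro mult_right_mono mult_left_mono) auto
  moreover have "exp (- (y\<^sup>2) / (4 * t)) = exp (- x) * exp (- x)" by (simp add: x_def flip: exp_add)
  moreover have "y\<^sup>2 / t = 8 * x" using t by (simp add: x_def)
  ultimately have "y\<^sup>2 / t * exp (- (y\<^sup>2) / (4 * t)) \<le> 8 * exp (- x)" by (simp add: mult.assoc)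
  then have "y / (2 * sqrt pi) * ((y\<^sup>2 / t * exp (- (y\<^sup>2) / (4 * t))) / t powr (3 / 2))
      \<le> y / (2 * sqrt pi) * ((8 * exp (- x)) / t powr (3 / 2))"
    using y by (intro mult_left_mono divide_right_mono) auto
  also have "\<dots> = 8 * sqrt 2 * subordinator (y / sqrt 2) t"
    by (simp add: subordinator_def x_def power_divide)
  finally show ?thesis by (simp add: subordinator_def mult_ac)
qed

text \<open>Scaling suggests \<open>t \<approx> y\<^sup>2\<close>. For the exponents \<open>p \<le>
  1\<close> that occur, \<open>(y\<^sup>2 / t)\<^sup>p \<le> 1 + y\<^sup>2 / t\<close> reduces the
  moment to \<open>subordinator_over_t\<close>.\<close>
lemma subordinated_power_bound:
  assumes y: "0 < y" and p: "0 \<le> p" "p \<le> 1" and C: "0 \<le> C"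
    and int: "set_integrable lborel {0<..} (\<lambda>t. subordinator y t * u t)"
    and u: "\<And>t. 0 < t \<Longrightarrow> \<bar>u t\<bar> \<le> C * t powr (- p)"
  shows "\<bar>LINT t:{0<..}|lborel. subordinator y t * u t\<bar> \<le> C * (1 + 8 * sqrt 2) * y powr (- (2 * p))"
proof -
  let ?D = "C * y powr (- (2 * p))"
  let ?w = "\<lambda>t. ?D * subordinator y t + ?D * (8 * sqrt 2) * subordinator (y / sqrt 2) t"
  have y2: "0 < y / sqrt 2" using y by simp
  have pw: "\<bar>subordinator y t * u t\<bar> \<le> ?w t" if t: "0 < t" for t
  proof -
    define x where "x = y\<^sup>2 / t"
    have x: "0 < x" using y t by (simp add: x_def)
    have "x powr p \<le> 1 + x"
    proof (cases "x \<le> 1")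
      case True
      then have "x powr p \<le> 1" using p x by (intro powr_le1) auto
      then show ?thesis using x by linarith
    next
      case False
      then have "x powr p \<le> x powr 1" using p by (intro powr_mono) auto
      then show ?thesis using x by simp
    qed
    moreover have "t powr (- p) = y powr (- (2 * p)) * x powr p"
    proof -
      have "x powr p = y powr (2 * p) / t powr p" using y t by (simp add: x_def powr_divide square_powr)
      then show ?thesis using y by (simp add: powr_minus field_simps)
    qed
    ultimately have "t powr (- p) \<le> y powr (- (2 * p)) * (1 + x)"
      by (simp add: mult_left_mono)
    then have "\<bar>u t\<bar> \<le> C * (y powr (- (2 * p)) * (1 + x))"
      using u[OF t] mult_left_mono[OF _ C] by (meson order_trans)
    then have "\<bar>subordinator y t * u t\<bar> \<le> subordinator y t * (C * (y powr (- (2 * p)) * (1 + x)))"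
      using y by (simp add: abs_mult subordinator_nonneg mult_left_mono)
    also have "\<dots> = ?D * subordinator y t + ?D * (x * subordinator y t)" by (simp add: algebra_simps)
    also have "\<dots> \<le> ?D * subordinator y t + ?D * (8 * sqrt 2 * subordinator (y / sqrt 2) t)"
      unfolding x_def using C by (intro add_left_mono mult_left_mono subordinator_over_t y t) auto
    finally show ?thesis by (simp add: mult.assoc)
  qed
  have i1: "set_integrable lborel {0<..} (\<lambda>t. ?D * subordinator y t)"
    "set_integrable lborel {0<..} (\<lambda>t. ?D * (8 * sqrt 2) * subordinator (y / sqrt 2) t)"
    by (intro set_integrable_mult_right impI subordinator_integrable y y2)+
  have iw: "set_integrable lborel {0<..} ?w" by (rule set_integral_add(1)[OF i1])
  have vw: "(LINT t:{0<..}|lborel. ?w t) = C * (1 + 8 * sqrt 2) * y powr (- (2 * p))"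
    unfolding set_integral_add(2)[OF i1] set_integral_mult_right subordinator_integral[OF y] subordinator_integral[OF y2]
    by (simp add: algebra_simps)
  have "(LINT t:{0<..}|lborel. subordinator y t * u t) \<le> (LINT t:{0<..}|lborel. ?w t)"
    by (rule set_integral_mono[OF int iw]) (use pw in \<open>auto simp: abs_le_iff\<close>)
  moreover have "(LINT t:{0<..}|lborel. - 1 * (subordinator y t * u t)) \<le> (LINT t:{0<..}|lborel. ?w t)"
    by (rule set_integral_mono[OF _ iw]) (intro set_integrable_mult_right impI int, use pw in \<open>auto simp: abs_le_iff\<close>)
  then have "- 1 * (LINT t:{0<..}|lborel. subordinator y t * u t) \<le> (LINT t:{0<..}|lborel. ?w t)"
    by (simp only: set_integral_mult_right)
  ultimately show ?thesis unfolding vw by linarith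
qed

text \<open>Heat decay is compatible with a blow-up at \<open>t = 0\<close>, so the boundedness of
  high differences of \<open>f\<close> itself is not immediate; it is the second difference estimate
  with step \<open>1\<close>.\<close>
lemma bounded_differences:
  assumes f: "growth_order a f" and a: "0 < a" and dec: "heat_decay a j f" and k: "real k < a" "a < real (k + 2)"
  shows "\<exists>B. \<forall>n. \<bar>(delta_right ^^ (k + 2)) f n\<bar> \<le> B"
proof -
  have eg: "exp_growth f" by (rule growth_order_exp_growth[OF f a])
  have "heat_decay a (k + 2) f" by (rule heat_decay_all_orders[OF f a k(2) dec])
  then interpret decaying_heat a "a - real k" k f
    by unfold_locales (use k eg in simp_all)
  obtain C where C: "\<And>m n. \<bar>g (m + n) + g (m - n) - 2 * g m\<bar> \<le> C * \<bar>real_of_int n\<bar> powr (a - real k)"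
    using second_difference by blast
  have "\<bar>(delta_right ^^ (k + 2)) f n\<bar> \<le> C" for n
    using C[of "n + 1" 1] by (simp add: g_def delta_right_def algebra_simps)
  then show ?thesis by blast
qed

lemma poisson_summable_lap:
  assumes g: "poisson_summable g"
  shows "poisson_summable (lap g)"
proof -
  let ?d = "\<lambda>j. 1 + (real_of_int j)\<^sup>2"
  have r: "(\<lambda>j. \<bar>g (j + e)\<bar> / ?d j) summable_on UNIV" for e
    using poisson_summable_reflect(1)[OF g, of e]
      summable_on_reindex_bij_betw[OF bij_reflect, of "\<lambda>j. \<bar>g (e - j)\<bar> / ?d j" 0]
    by (simp add: add.commute)
  have "(\<lambda>j. \<bar>g (j + - 1)\<bar> / ?d j + 2 * (\<bar>g (j + 0)\<bar> / ?d j) + \<bar>g (j + 1)\<bar> / ?d j) summable_on UNIV"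
    by (intro summable_on_add summable_on_cmult_right r)
  then show ?thesis unfolding poisson_summable_iff
  proof (rule summable_on_comparison_test)
    fix j
    have "\<bar>lap g j\<bar> \<le> \<bar>g (j + - 1)\<bar> + 2 * \<bar>g (j + 0)\<bar> + \<bar>g (j + 1)\<bar>" by (simp add: tri_def)
    from divide_right_mono[OF this, of "?d j"]
    show "\<bar>lap g j\<bar> / ?d j \<le> \<bar>g (j + - 1)\<bar> / ?d j + 2 * (\<bar>g (j + 0)\<bar> / ?d j) + \<bar>g (j + 1)\<bar> / ?d j"
      by (simp add: add_divide_distrib add_nonneg_nonneg)
  qed (simp add: add_nonneg_nonneg)
qed

lemma half_lap_pow_minus: "half_lap_pow i (\<lambda>n. - g n) n = - half_lap_pow i g n"
  by (simp add: half_lap_pow_def infsum_uminus)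

text \<open>An even number of factors \<open>\<surd>(-\<Delta>)\<close> can be moved onto
  \<open>f\<close>.\<close>
lemma half_lap_pow_add_even:
  assumes "poisson_summable f"
  shows "half_lap_pow (i + 2 * b) f n = half_lap_pow i (\<lambda>n. (- 1) ^ b * (lap ^^ b) f n) n"
  using assms
proof (induction b arbitrary: f n)
  case (Suc b)
  have "half_lap_pow (i + 2 * Suc b) f n = - half_lap_pow (i + 2 * b) (lap f) n"
    using half_lap_pow_Suc_Suc[OF Suc.prems, of "i + 2 * b" n] half_lap_pow_lap[OF Suc.prems, of "i + 2 * b" n] by simp
  also have "half_lap_pow (i + 2 * b) (lap f) n = half_lap_pow i (\<lambda>n. (- 1) ^ b * (lap ^^ b) (lap f) n) n"
    by (rule Suc.IH[OF poisson_summable_lap[OF Suc.prems]])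
  also have "- \<dots> = half_lap_pow i (\<lambda>n. (- 1) ^ Suc b * (lap ^^ Suc b) f n) n"
    unfolding half_lap_pow_minus[symmetric] by (simp add: funpow_swap1)
  finally show ?case .
qed simp

text \<open>The derivative of order \<open>2 K\<close> is the Poisson extension of \<open>h =
  (-\<Delta>)\<^sup>K f\<close>, hence an average of the heat flow of \<open>h\<close>, whose decay
  is the assumption. If \<open>l = 2 K - 1\<close>, this is integrated from infinity.\<close>
lemma heat_decay_imp_poisson_decay:
  assumes f: "poisson_summable f" and gr: "growth_order a f" and a: "0 < a"
    and K: "real (2 * K) - 2 \<le> a" "a < real (2 * K)" and dec: "heat_decay a (2 * K) f"
    and l: "a < real l" "l = 2 * K \<or> Suc l = 2 * K"
  shows "poisson_decay a l f"
proof -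
  have eg: "exp_growth f" by (rule growth_order_exp_growth[OF gr a])
  define h where "h = (\<lambda>n. (- 1) ^ K * (lap ^^ K) f n)"
  have "\<exists>B. \<forall>n. \<bar>(delta_right ^^ (2 * K)) f n\<bar> \<le> B"
  proof (cases "real (2 * K) - 2 < a")
    case True
    have "0 < K" using K(2) a by (cases K) auto
    then have e: "2 * K = (2 * K - 2) + 2" by simp
    have "real (2 * K - 2) < a" "a < real ((2 * K - 2) + 2)" using True K(2) \<open>0 < K\<close> by (auto simp: of_nat_diff)
    from bounded_differences[OF gr a dec this] show ?thesis by (simp only: e[symmetric])
  next
    case False
    \<comment> \<open>Now \<open>2 K\<close> exceeds \<open>a\<close> by exactly \<open>2\<close>; the differences of order \<open>2 K - 1\<close> are bounded first.\<close>
    then have aK: "a = real (2 * K) - 2" using K(1) by simp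
    then have "2 \<le> K" using a by (cases K rule: nat.exhaust) (auto simp: le_Suc_eq)
    then have e: "2 * K = Suc ((2 * K - 3) + 2)" by simp
    have "real (2 * K - 3) < a" "a < real ((2 * K - 3) + 2)" using aK \<open>2 \<le> K\<close> by (auto simp: of_nat_diff)
    from bounded_differences[OF gr a dec this] obtain B where B: "\<And>n. \<bar>(delta_right ^^ ((2 * K - 3) + 2)) f n\<bar> \<le> B" by blast
    have "\<bar>(delta_right ^^ (2 * K)) f n\<bar> \<le> 2 * B" for n
    proof -
      have "(delta_right ^^ (2 * K)) f n = delta_right ((delta_right ^^ ((2 * K - 3) + 2)) f) n"
        by (subst e) simp
      then show ?thesis using B[of n] B[of "n + 1"] unfolding delta_right_def[of "(delta_right ^^ _) f"] by linarith
    qed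
    then show ?thesis by blast
  qed
  then obtain B where "\<And>n. \<bar>(delta_right ^^ (2 * K)) f n\<bar> \<le> B" by blast
  then have hB: "\<bar>h n\<bar> \<le> B" for n by (simp add: h_def abs_mult lap_pow_eq_delta)
  have hs: "poisson_summable h"
  proof -
    have "poisson_summable ((lap ^^ K) f)" by (induction K) (auto intro: f poisson_summable_lap)
    then show ?thesis by (simp add: h_def poisson_summable_iff abs_mult)
  qed
  obtain C where C: "\<And>t n. 0 < t \<Longrightarrow> \<bar>(delta_right ^^ (2 * K)) (heat t f) n\<bar> \<le> C * t powr ((a - real (2 * K)) / 2)"
    using dec unfolding heat_decay_def by blast
  have C0: "0 \<le> C" using order_trans[OF abs_ge_zero C[of 1 0]] by simp
  define p where "p = (real (2 * K) - a) / 2"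
  have p: "0 \<le> p" "p \<le> 1" using K by (simp_all add: p_def)
  have heat_h: "\<bar>heat t h n\<bar> \<le> C * t powr (- p)" if t: "0 < t" for t n
    using C[OF t, of "n - int K"] heat_cmult[OF exp_growth_tri_pow[OF eg], of t "(- 1) ^ K" K 1 "- 2" 1 n]
    by (simp add: h_def p_def abs_mult minus_divide_left lap_pow_eq_delta flip: heat_tri_pow[OF eg])
  have P2K: "poisson_deriv (2 * K) f y n = poisson_deriv 0 h y n" for y n
    by (simp add: poisson_deriv_def half_lap_pow_add_even[OF f] h_def power_add)
  have even: "\<bar>poisson_deriv (2 * K) f y n\<bar> \<le> C * (1 + 8 * sqrt 2) * y powr (a - real (2 * K))" if y: "0 < y" for y n
  proof -
    have "poisson_deriv 0 h y n = (LINT t:{0<..}|lborel. subordinator y t * heat t h n)"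
      by (rule poisson_as_heat_average(2)[OF hB y poisson_kernel_has_sum[OF hs y]])
    moreover have "\<bar>LINT t:{0<..}|lborel. subordinator y t * heat t h n\<bar> \<le> C * (1 + 8 * sqrt 2) * y powr (- (2 * p))"
      by (rule subordinated_power_bound[OF y p C0 poisson_as_heat_average(1)[OF hB y] heat_h])
    moreover have "- (2 * p) = a - real (2 * K)" by (simp add: p_def field_simps)
    ultimately show ?thesis unfolding P2K by (simp only:)
  qed
  show ?thesis
    using l(2)
  proof
    assume "l = 2 * K"
    then show ?thesis unfolding poisson_decay_def using even by blast
  next
    assume l2: "Suc l = 2 * K"
    define e where "e = real (2 * K) - a"
    have e: "1 < e" using l(1) l2 by (simp add: e_def flip: l2)
    have l0: "0 < l" using l(1) a by (cases l) auto
    show ?thesis unfolding poisson_decay_def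
    proof (intro exI allI impI)
      fix y :: real and n assume y: "0 < y"
      have "\<bar>poisson_deriv l f y n\<bar> \<le> (C * (1 + 8 * sqrt 2)) / (e - 1) * y powr (1 - e)"
      proof (rule decay_of_sublinear_primitive[of "\<lambda>i y. poisson_deriv i f y n", OF _ poisson_sublinear[OF f] l0 _ e y])
        show "((\<lambda>y. poisson_deriv i f y n) has_real_derivative poisson_deriv (Suc i) f y n) (at y)" for i y
          by (rule poisson_deriv_has_derivative[OF f])
        show "\<bar>poisson_deriv (Suc l) f y n\<bar> \<le> C * (1 + 8 * sqrt 2) * y powr (- e)" if "0 < y" for y
          using even[OF that] by (simp add: l2 e_def)
      qed
      moreover have "1 - e = a - real l" unfolding e_def l2[symmetric] by simp
      ultimately show "\<bar>poisson_deriv l f y n\<bar> \<le> (C * (1 + 8 * sqrt 2)) / (e - 1) * y powr (a - real l)"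
        by (simp only:)
    qed
  qed
qed

theorem Lambda_H_iff_Lambda_P:
  assumes f: "poisson_summable f" and a: "0 < a"
  shows "f \<in> Lambda_H a \<longleftrightarrow> (\<lambda>n. complex_of_real (f n)) \<in> Lambda_P a"
proof -
  define K where "K = nat \<lfloor>a / 2\<rfloor> + 1"
  define l where "l = nat \<lfloor>a\<rfloor> + 1"
  have fl: "real (nat \<lfloor>a / 2\<rfloor>) = of_int \<lfloor>a / 2\<rfloor>" "real (nat \<lfloor>a\<rfloor>) = of_int \<lfloor>a\<rfloor>" using a by simp_all
  have K: "real (2 * K) - 2 \<le> a" "a < real (2 * K)"
    using of_int_floor_le[of "a / 2"] fl half_floor_bound[OF a] by (simp_all add: K_def)
  have "real l = of_int \<lfloor>a\<rfloor> + 1" using fl by (simp add: l_def)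
  then have l: "a < real l" "real l - 1 \<le> a" using floor_correct[of a] by linarith+
  have "real l - 1 < real (2 * K)" "real (2 * K) - 2 < real l" using K l by linarith+
  then have lK: "l = 2 * K \<or> Suc l = 2 * K" by linarith
  have "growth_order a f \<and> heat_decay a (2 * K) f \<longleftrightarrow> poisson_decay a l f"
  proof
    assume "growth_order a f \<and> heat_decay a (2 * K) f"
    then show "poisson_decay a l f"
      using heat_decay_imp_poisson_decay[OF f _ a K _ l(1) lK] by blast
  next
    assume dec: "poisson_decay a l f"
    have hd: "heat_decay a (2 * K) f"
      by (rule poisson_decay_imp_heat_decay[OF f dec a]) (use l lK in auto)
    have "K = 1" if "a < 2"
    proof -
      have "real (2 * K) < 4" "0 < real (2 * K)" using K that a by linarith+
      then show ?thesis by simp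
    qed
    then show "growth_order a f \<and> heat_decay a (2 * K) f"
      using poisson_decay_imp_growth_order[OF f hd a] hd by blast
  qed
  then show ?thesis unfolding Lambda_H_iff[OF a] Lambda_P_iff[OF f] K_def l_def .
qed

theorem theorem1:
  shows "(\<forall>\<alpha>::real. \<alpha> > 0 \<and> \<alpha> \<notin> \<nat> \<longrightarrow> Lambda_H \<alpha> = holder_space \<alpha>)
    \<and> (\<forall>\<alpha>::nat. \<alpha> \<ge> 1 \<longrightarrow> Lambda_H (real \<alpha>) = zygmund \<alpha>)
    \<and> (\<forall>f :: int \<Rightarrow> real. poisson_summable f \<longrightarrow>
         (\<forall>\<alpha>::real. \<alpha> > 0 \<and> \<alpha> \<notin> \<nat> \<longrightarrow>
            (f \<in> holder_space \<alpha> \<longleftrightarrow> f \<in> Lambda_H \<alpha>) \<and>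
            (f \<in> Lambda_H \<alpha> \<longleftrightarrow> (\<lambda>n. complex_of_real (f n)) \<in> Lambda_P \<alpha>)) \<and>
         (\<forall>\<alpha>::nat. \<alpha> \<ge> 1 \<longrightarrow>
            (f \<in> zygmund \<alpha> \<longleftrightarrow> f \<in> Lambda_H (real \<alpha>)) \<and>
            (f \<in> Lambda_H (real \<alpha>) \<longleftrightarrow> (\<lambda>n. complex_of_real (f n)) \<in> Lambda_P (real \<alpha>))))"
proof (intro conjI allI impI)
  fix a :: real assume "a > 0 \<and> a \<notin> \<nat>"
  then show "Lambda_H a = holder_space a" by (intro Lambda_H_eq_holder_space) auto
next
  fix a :: nat assume "a \<ge> 1"
  then show "Lambda_H (real a) = zygmund a" by (rule Lambda_H_eq_zygmund)
next
  fix f :: "int \<Rightarrow> real" and a :: real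
  assume f: "poisson_summable f" and a: "a > 0 \<and> a \<notin> \<nat>"
  show "f \<in> holder_space a \<longleftrightarrow> f \<in> Lambda_H a" using Lambda_H_eq_holder_space[of a] a by simp
  show "f \<in> Lambda_H a \<longleftrightarrow> (\<lambda>n. complex_of_real (f n)) \<in> Lambda_P a"
    by (rule Lambda_H_iff_Lambda_P[OF f]) (use a in simp)
next
  fix f :: "int \<Rightarrow> real" and a :: nat
  assume f: "poisson_summable f" and a: "a \<ge> 1"
  show "f \<in> zygmund a \<longleftrightarrow> f \<in> Lambda_H (real a)" using Lambda_H_eq_zygmund[OF a] by simp
  show "f \<in> Lambda_H (real a) \<longleftrightarrow> (\<lambda>n. complex_of_real (f n)) \<in> Lambda_P (real a)"
    by (rule Lambda_H_iff_Lambda_P[OF f]) (use a in simp)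
qed

end
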